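(* Let $n\ge1$, $\alpha>-1$, $q\ge 1$, and let $\Phi\in\mathscr U^q$ satisfy the Dini condition: there is $C>0$ such that $\int_0^t\frac{\Phi(s)}{s^2}ds\le C\frac{\Phi(t)}{t}$ for all $t>0$. Then the Hankel operator $h_b$ extends into a bounded operator on $\mathcal A_\alpha^\Phi(\mathbb B^n)$ if and only if $b\in\mathcal B$, the Bloch space.
   Context: $\mathbb B^n$ is the unit ball of $\mathbb C^n$, $d\nu$ is Lebesgue measure on it, and $d\nu_\alpha(z)=c_\alpha(1-|z|^2)^\alpha d\nu(z)$ with $\nu_\alpha(\mathbb B^n)=1$. A growth function is a continuous non-decreasing function from $[0,\infty)$ onto itself. $\mathscr U^q$ ($q\ge1$) is the set of growth functions $\Phi$ of upper type $q$ (there is $C>0$ with $\Phi(st)\le Ct^q\Phi(s)$ for all $s>0$, $t\ge1$) such that $t\mapsto\Phi(t)/t$ is non-decreasing. Equivalent growth functions ($c\Phi_1(ct)\le\Phi_2(t)\le c^{-1}\Phi_1(c^{-1}t)$ for some $c>0$) define the same spaces, and by convention any $\Phi\in\mathscr U^q$ is supposed convex and $C^1$ with $\Phi'(t)\simeq\Phi(t)/t$. $\mathcal A_\alpha^\Phi(\mathbb B^n)$ is the space of holomorphic $f$ on $\mathbb B^n$ with $\int_{\mathbb B^n}\Phi(|f|)\,d\nu_\alpha<\infty$, with norm $\|f\|^{lux}_{\alpha,\Phi}=\inf\{\lambda>0:\int\Phi(|f|/\lambda)\,d\nu_\alpha\le1\}$. $\mathcal A^2_\alpha$ is the case $\Phi(t)=t^2$.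 $P_\alpha f(z)=\int_{\mathbb B^n}\frac{f(\xi)}{(1-\langle z,\xi\rangle)^{n+1+\alpha}}d\nu_\alpha(\xi)$ is the Bergman projection. For a symbol $b\in\mathcal A_\alpha^2(\mathbb B^n)$ the small Hankel operator is defined on bounded holomorphic $f$ by $h_b(f)=P_\alpha(b\overline f)$. "$h_b$ extends into a bounded operator from $\mathcal A_\alpha^{\Phi_1}$ to $\mathcal A_\alpha^{\Phi_2}$" means there is $C$ with $\|h_b(f)\|^{lux}_{\alpha,\Phi_2}\le C\|f\|^{lux}_{\alpha,\Phi_1}$ for all bounded holomorphic $f$ (here $\Phi_1=\Phi_2=\Phi$). With $Rf(z)=\sum_j z_j\frac{\partial f}{\partial z_j}(z)$, the Bloch space $\mathcal B$ is the space of holomorphic $f$ on $\mathbb B^n$ with $\sup_{z}|Rf(z)|(1-|z|^2)<\infty$. *)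

theory Defs
  imports "HOL-Analysis.Analysis"
begin

text \<open>
  Points of \<open>\<complex>\<^sup>n\<close> are vectors \<^typ>\<open>complex ^ 'n\<close> with \<open>n = CARD('n) \<ge> 1\<close>.  The library norm on this
  type is the Hermitian one and \<^const>\<open>lborel\<close> is Lebesgue measure on \<open>\<real>\<close> to the power \<open>2n\<close>;
  the library inner product \<^const>\<open>inner\<close>, however, is only the real one.
\<close>

definition herm :: "complex ^ 'n \<Rightarrow> complex ^ 'n \<Rightarrow> complex" where
  "herm z w = (\<Sum>j\<in>UNIV. z $ j * cnj (w $ j))"

abbreviation unit_ball :: "(complex ^ 'n) set" where
  "unit_ball \<equiv> ball 0 1"

text \<open>Holomorphy in several variables: the real Frechet derivative exists at every point of the
  ball and is complex linear.\<close>

definition holomorphic_ball :: "(complex ^ 'n \<Rightarrow> complex) \<Rightarrow> bool" where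
  "holomorphic_ball f \<longleftrightarrow>
     (\<forall>z\<in>unit_ball. \<exists>D. (f has_derivative D) (at z) \<and> (\<forall>c v. D (c *s v) = c * D v))"

definition partial_deriv :: "'n \<Rightarrow> (complex ^ 'n \<Rightarrow> complex) \<Rightarrow> complex ^ 'n \<Rightarrow> complex" where
  "partial_deriv j f z = deriv (\<lambda>w. f (\<chi> i. if i = j then w else z $ i)) (z $ j)"

definition radial_deriv :: "(complex ^ 'n \<Rightarrow> complex) \<Rightarrow> complex ^ 'n \<Rightarrow> complex" where
  "radial_deriv f z = (\<Sum>j\<in>UNIV. z $ j * partial_deriv j f z)"

definition bloch :: "(complex ^ 'n \<Rightarrow> complex) set" where
  "bloch = {f. holomorphic_ball f \<and>
     bdd_above ((\<lambda>z. cmod (radial_deriv f z) * (1 - (norm z)\<^sup>2)) ` unit_ball)}"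


definition growth_function :: "(real \<Rightarrow> real) \<Rightarrow> bool" where
  "growth_function \<Phi> \<longleftrightarrow>
     continuous_on {0..} \<Phi> \<and> mono_on {0..} \<Phi> \<and> \<Phi> ` {0..} = {0..}"

definition upper_type :: "real \<Rightarrow> (real \<Rightarrow> real) \<Rightarrow> bool" where
  "upper_type q \<Phi> \<longleftrightarrow> (\<exists>C>0. \<forall>s>0. \<forall>t\<ge>1. \<Phi> (s * t) \<le> C * t powr q * \<Phi> s)"

definition growth_class :: "real \<Rightarrow> (real \<Rightarrow> real) set" where
  "growth_class q =
     {\<Phi>. growth_function \<Phi> \<and> upper_type q \<Phi> \<and> mono_on {0<..} (\<lambda>t. \<Phi> t / t)}"

text \<open>The standing convention on members of \<^const>\<open>growth_class\<close>: each is replaced by an equivalent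
  one that is convex and continuously differentiable with \<open>\<Phi>'(t)\<close> comparable to \<open>\<Phi>(t) / t\<close>.
  By convexity, continuity of the derivative on the open half line gives it (one-sidedly) at
  \<open>0\<close> too.\<close>

definition regular_growth :: "(real \<Rightarrow> real) \<Rightarrow> bool" where
  "regular_growth \<Phi> \<longleftrightarrow>
     convex_on {0..} \<Phi> \<and>
     (\<forall>t>0. \<Phi> differentiable (at t)) \<and> continuous_on {0<..} (deriv \<Phi>) \<and>
     (\<exists>c>0. \<forall>t>0. c * (\<Phi> t / t) \<le> deriv \<Phi> t \<and> c * deriv \<Phi> t \<le> \<Phi> t / t)"

text \<open>The integral is a nonnegative Lebesgue integral, so the bound includes its convergence at
  \<open>0\<close>.\<close>

definition dini :: "(real \<Rightarrow> real) \<Rightarrow> bool" where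
  "dini \<Phi> \<longleftrightarrow>
     (\<exists>C>0. \<forall>t>0. (\<integral>\<^sup>+s\<in>{0<..t}. ennreal (\<Phi> s / s\<^sup>2) \<partial>lborel) \<le> ennreal (C * (\<Phi> t / t)))"


text \<open>The weighted measure lives on the ball; the factor in front of the weight is \<open>c\<^sub>\<alpha>\<close>,
  which makes the total mass \<open>1\<close> when \<open>\<alpha> > -1\<close>.\<close>

definition nu :: "real \<Rightarrow> (complex ^ 'n) measure" where
  "nu \<alpha> = density (restrict_space lborel unit_ball)
     (\<lambda>z. ennreal (1 / (LINT w:(unit_ball :: (complex ^ 'n) set)|lborel. (1 - (norm w)\<^sup>2) powr \<alpha>)
                     * (1 - (norm z)\<^sup>2) powr \<alpha>))"

definition bergman_orlicz :: "real \<Rightarrow> (real \<Rightarrow> real) \<Rightarrow> (complex ^ 'n \<Rightarrow> complex) set" where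
  "bergman_orlicz \<alpha> \<Phi> =
     {f. holomorphic_ball f \<and> (\<integral>\<^sup>+z. ennreal (\<Phi> (cmod (f z))) \<partial>nu \<alpha>) < \<infinity>}"

text \<open>The norm takes values in \<^typ>\<open>ennreal\<close>: it is \<open>\<infinity>\<close> when no \<open>r\<close> is admissible.\<close>

definition lux_norm :: "real \<Rightarrow> (real \<Rightarrow> real) \<Rightarrow> (complex ^ 'n \<Rightarrow> complex) \<Rightarrow> ennreal" where
  "lux_norm \<alpha> \<Phi> f =
     (INF r\<in>{r::real. r > 0 \<and> (\<integral>\<^sup>+z. ennreal (\<Phi> (cmod (f z) / r)) \<partial>nu \<alpha>) \<le> 1}. ennreal r)"

text \<open>The complex power is the principal branch; \<open>1 - \<langle>z, \<xi>\<rangle>\<close> has positive real part on the ball.\<close>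

definition bergman_proj :: "real \<Rightarrow> (complex ^ 'n \<Rightarrow> complex) \<Rightarrow> complex ^ 'n \<Rightarrow> complex" where
  "bergman_proj \<alpha> f z =
     (LINT \<xi>|nu \<alpha>. f \<xi> / (1 - herm z \<xi>) powr complex_of_real (real CARD('n) + 1 + \<alpha>))"

definition hankel ::
  "real \<Rightarrow> (complex ^ 'n \<Rightarrow> complex) \<Rightarrow> (complex ^ 'n \<Rightarrow> complex) \<Rightarrow> complex ^ 'n \<Rightarrow> complex" where
  "hankel \<alpha> b f = bergman_proj \<alpha> (\<lambda>\<xi>. b \<xi> * cnj (f \<xi>))"

definition hankel_extends_bounded ::
  "real \<Rightarrow> (complex ^ 'n \<Rightarrow> complex) \<Rightarrow> (real \<Rightarrow> real) \<Rightarrow> (real \<Rightarrow> real) \<Rightarrow> bool" where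
  "hankel_extends_bounded \<alpha> b \<Phi>\<^sub>1 \<Phi>\<^sub>2 \<longleftrightarrow>
     (\<exists>C::real. \<forall>f. holomorphic_ball f \<and> bounded (f ` unit_ball) \<longrightarrow>
        lux_norm \<alpha> \<Phi>\<^sub>2 (hankel \<alpha> b f) \<le> ennreal C * lux_norm \<alpha> \<Phi>\<^sub>1 f)"

end

theory Submission
  imports Defs "HOL-Complex_Analysis.Cauchy_Integral_Formula"
begin

text \<open>
  Write \<open>rho w = 1 - |w|\<^sup>2\<close>, \<open>N = n + 1 + \<alpha>\<close> and \<open>kern s z w = (1 - \<langle>w, z\<rangle>)\<^sup>-\<^sup>s\<close>.  Everything rests on one
  integration by parts on the ball: for holomorphic \<open>u\<^sub>j\<close> and \<open>F\<close>,
  \<open>\<integral> (\<Sum>\<^sub>j \<partial>\<^sub>j u\<^sub>j) cnj F rho d\<nu>\<^sub>\<alpha> = (\<alpha> + 1) \<integral> (\<Sum>\<^sub>j u\<^sub>j cnj w\<^sub>j) cnj F d\<nu>\<^sub>\<alpha>\<close>.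
  The weight is cut off inside the ball, so no boundary regularity is needed.  For the field
  \<open>w\<close> the identity shifts the weight from \<open>\<alpha>\<close> to \<open>\<alpha> + 1\<close>; for the field \<open>z - w\<close> it says that
  \<open>\<integral> u (t z + (1 - t) w) cnj (kern N z w) d\<nu>\<^sub>\<alpha>\<close> does not depend on \<open>t\<close>, which is the reproducing formula.
  That formula evaluates \<open>\<integral> |kern N z|\<^sup>2 d\<nu>\<^sub>\<alpha> = (rho z)\<^sup>-\<^sup>N\<close>, and averaging it over the
  points \<open>t z\<close> gives the Forelli-Rudin estimates.

  If \<open>b\<close> is Bloch, the radial identity replaces \<open>b\<close> by the bounded function
  \<open>rho (N b + R b) / (\<alpha> + 1)\<close> in \<open>h\<^sub>b f\<close>, so \<open>|h\<^sub>b f|\<close> is dominated by the positive Bergman operator applied to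
  \<open>|f|\<close>.  The Dini condition gives \<open>\<Phi>\<close> a lower type larger than \<open>1\<close>, and a Schur test performed with Jensen's
  inequality bounds that operator without interpolation.  Conversely, testing on
  \<open>f = (rho z)\<^sup>k kern k z\<close> for a large integer \<open>k\<close> and evaluating \<open>h\<^sub>b f\<close> at \<open>z\<close> bounds
  \<open>(rho z)\<^sup>k \<integral> b(w) (1 - \<langle>z, w\<rangle>)\<^sup>-\<^sup>N\<^sup>-\<^sup>k d\<nu>\<^sub>\<alpha>(w)\<close>; radial integration lowers \<open>k\<close> to \<open>1\<close>, where this transform is
  \<open>b + R b / N\<close>.
\<close>

subsection \<open>The Hermitian form and the Bergman kernels\<close>

text \<open>Holomorphy means Frechet differentiability with a complex linear derivative, so
  continuity of derivatives is never assumed: Cauchy estimates bound them and difference quotients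
  make them measurable. The reproducing formula is proved first for positive weights and carried to
  all \<open>a > -1\<close> by the weight shift. Positivity enters twice: the derivative in
  \<open>t\<close> vanishes by the contraction identity at weight \<open>a - 1\<close>, and the
  limit \<open>t -> 0\<close>, where \<open>u\<close> is merely integrable, uses that
  \<open>x powr a\<close> is increasing. Only twice the critical exponent has an exact kernel
  integral; smaller exponents are reached by radial averaging, larger ones by a supremum bound. In
  the Schur test the weight \<open>rho powr (- s)\<close> returns with exponents
  \<open>s * (p - 1)\<close> and \<open>s * (r - 1)\<close>, which must be positive; this is where a
  lower type above 1 enters. In the converse, take \<open>T\<close> with
  \<open>\<Phi> T = rho z powr (- N)\<close>: the norm of the test function is at most of order
  \<open>1 / T\<close> and evaluation at \<open>z\<close> costs at most order \<open>T\<close>, so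
  the two cancel whatever \<Phi> is.\<close>

abbreviation rho :: "complex ^ 'n \<Rightarrow> real" where
  "rho w \<equiv> 1 - (norm w)\<^sup>2"

abbreviation dir_deriv :: "(complex ^ 'n \<Rightarrow> complex) \<Rightarrow> complex ^ 'n \<Rightarrow> complex ^ 'n \<Rightarrow> complex" where
  "dir_deriv f z v \<equiv> frechet_derivative f (at z) v"

text \<open>Holomorphic in the last argument \<open>w\<close> and antiholomorphic in
  \<open>z\<close>. The Bergman kernel as a function of \<open>z\<close> is therefore the conjugate
  \<open>cnj (kern N z w)\<close>, which on the ball is \<open>kern N w z\<close>.\<close>

definition kern :: "real \<Rightarrow> complex ^ 'n \<Rightarrow> complex ^ 'n \<Rightarrow> complex" where
  "kern s z w = (1 - herm w z) powr (- complex_of_real s)"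

lemma rho_pos: "norm w < 1 \<Longrightarrow> 0 < rho w"
  using abs_square_less_1[of "norm w"] by simp

lemma rho_le: "norm w \<le> 1 \<Longrightarrow> rho w \<le> 2 * (1 - norm w)"
  using zero_le_power2[of "norm w - 1"] by (simp add: power2_eq_square algebra_simps)

lemma le_rho: "norm w \<le> 1 \<Longrightarrow> 1 - norm w \<le> rho w"
  by (simp add: power2_eq_square mult_left_le)

lemma herm_add_left: "herm (z + z') w = herm z w + herm z' w"
  by (simp add: herm_def algebra_simps sum.distrib)

lemma herm_diff_left: "herm (z - z') w = herm z w - herm z' w"
  by (simp add: herm_def algebra_simps sum_subtractf)

lemma herm_scale_left: "herm (c *s z) w = c * herm z w"
  by (simp add: herm_def sum_distrib_left mult.assoc)

lemma herm_scaleR_left: "herm (t *\<^sub>R z) w = of_real t * herm z w"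
  by (simp add: herm_def sum_distrib_left mult.assoc) (simp add: scaleR_conv_of_real)

lemma herm_zero_left [simp]: "herm 0 w = 0"
  by (simp add: herm_def)

lemma cnj_herm [simp]: "cnj (herm z w) = herm w z"
  by (simp add: herm_def mult.commute)

lemma cnj_one_minus_herm: "cnj (1 - herm z w) = 1 - herm w z"
  by simp

lemma herm_scaleR_right: "herm z (t *\<^sub>R w) = of_real t * herm z w"
  by (metis cnj_herm complex_cnj_complex_of_real complex_cnj_mult herm_scaleR_left)

lemma herm_self: "herm z z = of_real ((norm z)\<^sup>2)"
proof -
  have "(norm z)\<^sup>2 = (\<Sum>i\<in>UNIV. (cmod (z $ i))\<^sup>2)"
    by (simp add: norm_vec_def L2_set_def sum_nonneg)
  then show ?thesis
    by (simp add: herm_def complex_norm_square[symmetric])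
qed

lemma cmod_herm_le: "cmod (herm z w) \<le> norm z * norm w"
proof -
  have "cmod (herm z w) \<le> (\<Sum>i\<in>UNIV. cmod (z $ i) * cmod (w $ i))"
    unfolding herm_def by (rule order_trans[OF norm_sum]) (simp add: norm_mult)
  also have "\<dots> \<le> norm z * norm w"
    using L2_set_mult_ineq[of "\<lambda>i. cmod (z $ i)" "\<lambda>i. cmod (w $ i)" UNIV]
    by (simp add: norm_vec_def)
  finally show ?thesis .
qed

lemma bounded_linear_herm: "bounded_linear (\<lambda>z. herm z w)"
proof (rule bounded_linear_intro[where K = "norm w"])
  show "herm (x + y) w = herm x w + herm y w" for x y by (rule herm_add_left)
  show "herm (r *\<^sub>R x) w = r *\<^sub>R herm x w" for r x
    by (simp add: herm_scaleR_left scaleR_conv_of_real[where 'a = complex])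
  show "norm (herm x w) \<le> norm x * norm w" for x by (rule cmod_herm_le)
qed

lemma continuous_herm: "continuous_on UNIV (\<lambda>(z, w). herm z w)"
  unfolding herm_def case_prod_unfold by (intro continuous_intros)

lemma measurable_herm [measurable]:
  "(\<lambda>(z, w). herm z w) \<in> borel_measurable (borel \<Otimes>\<^sub>M borel)"
  unfolding borel_prod by (rule borel_measurable_continuous_onI[OF continuous_herm])

lemma measurable_herm1 [measurable]: "(\<lambda>z. herm z w) \<in> borel_measurable borel"
  using bounded_linear.continuous_on[OF bounded_linear_herm continuous_on_id, of UNIV w]
  by (rule borel_measurable_continuous_onI)

lemma measurable_herm2 [measurable]: "(\<lambda>z. herm w z) \<in> borel_measurable borel"
proof -
  have "(\<lambda>z. cnj (herm z w)) \<in> borel_measurable borel"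
    by (intro borel_measurable_continuous_onI continuous_on_cnj
       bounded_linear.continuous_on[OF bounded_linear_herm continuous_on_id])
  then show ?thesis by simp
qed

text \<open>The hypothesis bounds only the product of the norms, so one point may lie on the sphere
  or be a real multiple \<open>t *\<^sub>R w\<close> with \<open>t\<close> slightly above 1.\<close>

lemma Re_one_minus_herm:
  assumes "norm z * norm w < 1"
  shows "0 < Re (1 - herm w z)" "1 - norm z * norm w \<le> cmod (1 - herm w z)"
    "1 - herm w z \<notin> \<real>\<^sub>\<le>\<^sub>0" "1 - herm w z \<noteq> 0"
proof -
  have *: "cmod (herm w z) \<le> norm z * norm w"
    using cmod_herm_le[of w z] by (simp add: mult.commute)
  show 1: "0 < Re (1 - herm w z)"
    using * assms abs_Re_le_cmod[of "herm w z"] by auto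
  show "1 - norm z * norm w \<le> cmod (1 - herm w z)"
    using * norm_triangle_ineq2[of 1 "herm w z"] by simp
  show "1 - herm w z \<notin> \<real>\<^sub>\<le>\<^sub>0" "1 - herm w z \<noteq> 0"
    using 1 by (auto simp: complex_nonpos_Reals_iff complex_eq_iff)
qed

lemma norm_mult_less_1:
  assumes "norm z < 1" "norm w \<le> 1"
  shows "norm z * norm w < (1::real)"
  using mult_left_mono[OF assms(2), of "norm z"] assms(1) by auto

lemma cmod_one_minus_herm_le:
  assumes "norm z \<le> 1" "norm w \<le> 1"
  shows "cmod (1 - herm w z) \<le> 2"
  using norm_triangle_ineq4[of 1 "herm w z"] cmod_herm_le[of w z] mult_mono[OF assms(2,1)] by simp

lemma cmod_one_minus_herm_commute: "cmod (1 - herm w z) = cmod (1 - herm z w)"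
  by (metis cnj_one_minus_herm complex_mod_cnj)

lemma cmod_powr_real: "cmod (x powr complex_of_real s) = cmod x powr s"
  by (auto simp: powr_def)

lemma cmod_kern: "cmod (kern s z w) = cmod (1 - herm w z) powr (- s)"
  unfolding kern_def of_real_minus[symmetric] by (rule cmod_powr_real)

lemma cmod_kern_le:
  assumes "norm z < 1" "norm w \<le> 1" "0 \<le> s"
  shows "cmod (kern s z w) \<le> (1 - norm z) powr (- s)"
proof -
  have "norm z * norm w \<le> norm z"
    using assms by (simp add: mult_left_le)
  then show ?thesis
    unfolding cmod_kern using Re_one_minus_herm(2)[OF norm_mult_less_1[OF assms(1,2)]] assms
    by (intro powr_mono2') auto
qed

lemma kern_mult: "kern s z w * kern t z w = kern (s + t) z w"
  by (simp add: kern_def powr_add[symmetric])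

lemma kern_at_0 [simp]: "kern s z 0 = 1"
  by (simp add: kern_def)

lemma kern_unfold_1:
  "norm z * norm w < 1 \<Longrightarrow> (1 - herm w z) * kern (s + 1) z w = kern s z w"
  using Re_one_minus_herm(4)[of z w]
  by (simp add: kern_def powr_diff powr_minus field_simps powr_add)

lemma cnj_kern:
  assumes "norm z * norm w < 1"
  shows "cnj (kern s z w) = kern s w z"
proof -
  have "cnj ((1 - herm w z) powr (- complex_of_real s)) = cnj (1 - herm w z) powr cnj (- complex_of_real s)"
    by (rule cnj_powr) (use Re_one_minus_herm(1)[OF assms] in auto)
  then show ?thesis
    by (simp add: kern_def)
qed

lemma measurable_kern [measurable]: 
  "(\<lambda>(z, w). kern s z w) \<in> borel_measurable (borel \<Otimes>\<^sub>M borel)"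
  unfolding kern_def powr_def by measurable

lemma has_derivative_kern:
  assumes "norm z * norm w < 1"
  shows "((\<lambda>w. kern s z w) has_derivative (\<lambda>v. of_real s * herm v z * kern (s + 1) z w)) (at w)"
proof -
  have 1: "((\<lambda>w. 1 - herm w z) has_derivative (\<lambda>v. - herm v z)) (at w)"
    by (auto intro!: derivative_eq_intros bounded_linear.has_derivative[OF bounded_linear_herm])
  have 2: "((\<lambda>x. x powr (- complex_of_real s)) has_field_derivative
      (- complex_of_real s * (1 - herm w z) powr (- complex_of_real s - 1))) (at (1 - herm w z))"
    by (rule has_field_derivative_powr[OF Re_one_minus_herm(3)[OF assms]])
  have "((\<lambda>w. (1 - herm w z) powr (- complex_of_real s)) has_derivative
     (\<lambda>v. - complex_of_real s * (1 - herm w z) powr (- complex_of_real s - 1) * (- herm v z))) (at w)"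
    using has_derivative_compose[OF 1 has_field_derivative_imp_has_derivative[OF 2]] by simp
  moreover have "- complex_of_real s - 1 = - complex_of_real (s + 1)" by simp
  ultimately show ?thesis
    unfolding kern_def by (simp only: minus_mult_minus mult_minus_left mult_minus_right mult_ac minus_minus)
qed

subsection \<open>Holomorphic functions on the ball\<close>

lemma holomorphic_ballI:
  assumes "\<And>z. norm z < 1 \<Longrightarrow> (f has_derivative D z) (at z)"
    and "\<And>z c v. norm z < 1 \<Longrightarrow> D z (c *s v) = c * D z v"
  shows "holomorphic_ball f"
  using assms unfolding holomorphic_ball_def by (metis mem_ball_0)

lemma holomorphic_ballD:
  assumes "holomorphic_ball f" "norm z < 1"
  shows "(f has_derivative dir_deriv f z) (at z)" "dir_deriv f z (c *s v) = c * dir_deriv f z v"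
proof -
  obtain D where D: "(f has_derivative D) (at z)" "\<forall>c v. D (c *s v) = c * D v"
    using assms unfolding holomorphic_ball_def by (metis mem_ball_0)
  have "D = frechet_derivative f (at z)"
    by (rule frechet_derivative_at[OF D(1)])
  with D show "(f has_derivative dir_deriv f z) (at z)" "dir_deriv f z (c *s v) = c * dir_deriv f z v"
    by auto
qed

lemma dir_deriv_eqI: "(f has_derivative D) (at z) \<Longrightarrow> dir_deriv f z v = D v"
  using frechet_derivative_at by metis

lemma holomorphic_ball_continuous_on: "holomorphic_ball f \<Longrightarrow> continuous_on unit_ball f"
  by (meson continuous_at_imp_continuous_on has_derivative_continuous holomorphic_ballD(1) mem_ball_0)

lemma holomorphic_ball_const: "holomorphic_ball (\<lambda>_. c)"
  by (rule holomorphic_ballI[where D = "\<lambda>_ _. 0"]) auto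

lemma has_derivative_component: "((\<lambda>w. w $ j) has_derivative (\<lambda>v. v $ j)) (at (z :: complex ^ 'n))"
  by (rule bounded_linear_imp_has_derivative[OF bounded_linear_vec_nth])

lemma holomorphic_ball_component: "holomorphic_ball (\<lambda>w. w $ j)"
  by (rule holomorphic_ballI[where D = "\<lambda>_ v. v $ j"]) (auto intro: has_derivative_component)

lemma holomorphic_ball_add:
  assumes "holomorphic_ball f" "holomorphic_ball g"
  shows "holomorphic_ball (\<lambda>w. f w + g w)"
  by (rule holomorphic_ballI[OF has_derivative_add[OF holomorphic_ballD(1)[OF assms(1)] holomorphic_ballD(1)[OF assms(2)]]])
     (auto simp: assms holomorphic_ballD(2) algebra_simps)

lemma holomorphic_ball_mult:
  assumes "holomorphic_ball f" "holomorphic_ball g"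
  shows "holomorphic_ball (\<lambda>w. f w * g w)"
  by (rule holomorphic_ballI[OF has_derivative_mult[OF holomorphic_ballD(1)[OF assms(1)] holomorphic_ballD(1)[OF assms(2)]]])
     (auto simp: assms holomorphic_ballD(2) algebra_simps)

lemma holomorphic_ball_diff:
  assumes "holomorphic_ball f" "holomorphic_ball g"
  shows "holomorphic_ball (\<lambda>w. f w - g w)"
  using holomorphic_ball_add[OF assms(1) holomorphic_ball_mult[OF holomorphic_ball_const[of "-1"] assms(2)]]
  by simp

lemma holomorphic_ball_kern:
  assumes "norm z < 1"
  shows "holomorphic_ball (kern s z)"
proof (rule holomorphic_ballI)
  show "(kern s z has_derivative (\<lambda>v. of_real s * herm v z * kern (s + 1) z w)) (at w)" if "norm w < 1" for w
    using has_derivative_kern[of z w s] norm_mult_less_1[of z w] assms that by simp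
qed (simp add: herm_scale_left)

lemma dir_deriv_kern:
  "norm z * norm w < 1 \<Longrightarrow> dir_deriv (kern s z) w v = of_real s * herm v z * kern (s + 1) z w"
  by (rule dir_deriv_eqI[OF has_derivative_kern])

lemma dir_deriv_mult:
  assumes "holomorphic_ball f" "holomorphic_ball g" "norm w < 1"
  shows "dir_deriv (\<lambda>w. f w * g w) w v = f w * dir_deriv g w v + dir_deriv f w v * g w"
  by (rule dir_deriv_eqI[OF has_derivative_mult[OF holomorphic_ballD(1)[OF assms(1,3)] holomorphic_ballD(1)[OF assms(2,3)]]])

lemma linear_dir_deriv:
  assumes "holomorphic_ball f" "norm w < 1"
  shows "linear (dir_deriv f w)"
  using holomorphic_ballD(1)[OF assms] has_derivative_linear by blast

lemma dir_deriv_axis_sum: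
  assumes "holomorphic_ball f" "norm w < 1"
  shows "(\<Sum>j\<in>UNIV. v $ j * dir_deriv f w (axis j 1)) = dir_deriv f w v"
proof -
  have "(\<Sum>j\<in>UNIV. v $ j * dir_deriv f w (axis j 1)) = (\<Sum>j\<in>UNIV. dir_deriv f w (v $ j *s axis j 1))"
    by (simp add: holomorphic_ballD(2)[OF assms])
  also have "\<dots> = dir_deriv f w (\<Sum>j\<in>UNIV. v $ j *s axis j 1)"
    by (simp add: linear_sum[OF linear_dir_deriv[OF assms]])
  finally show ?thesis
    by (simp add: basis_expansion)
qed

lemma has_field_derivative_slice:
  assumes "(f has_derivative D) (at (w + \<zeta> *s v))" "\<And>c v. D (c *s v) = c * D v"
  shows "((\<lambda>\<zeta>. f (w + \<zeta> *s v)) has_field_derivative D v) (at \<zeta>)"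
proof -
  have "bounded_linear (\<lambda>\<zeta>. \<zeta> *s v)"
    by (rule bounded_linear_intro[where K = "norm v"])
       (auto simp: vec_eq_iff algebra_simps norm_vec_def norm_mult L2_set_right_distrib[symmetric])
  then have "((\<lambda>\<zeta>. w + \<zeta> *s v) has_derivative (\<lambda>\<zeta>. \<zeta> *s v)) (at \<zeta>)"
    by (auto intro!: derivative_eq_intros bounded_linear_imp_has_derivative)
  from has_derivative_compose[OF this assms(1)] show ?thesis
    by (simp add: has_field_derivative_def assms(2) mult.commute[of _ "D v"])
qed

lemma norm_cscale: "norm (c *s v) = cmod c * norm (v :: complex ^ 'n)"
  by (auto simp: norm_vec_def norm_mult L2_set_right_distrib)

text \<open>On the complex line through \<open>w\<close> in direction \<open>v\<close> this is the
  one-variable Cauchy inequality on the disc of radius \<open>r / norm v\<close>, whose image stays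
  within distance \<open>r\<close> of \<open>w\<close>.\<close>

lemma cauchy_estimate:
  assumes f: "holomorphic_ball f" and r: "0 < r" "norm w + r < 1"
    and M: "\<And>y. norm (y - w) \<le> r \<Longrightarrow> cmod (f y) \<le> M"
  shows "cmod (dir_deriv f w v) \<le> M / r * norm v"
proof (cases "v = 0")
  case True
  then show ?thesis
    using linear_0[OF linear_dir_deriv[OF f, of w]] r by simp
next
  case False
  then have nv: "norm v > 0" by simp
  let ?R = "r / norm v"
  let ?g = "\<lambda>\<zeta>. f (w + \<zeta> *s v)"
  have in_ball: "norm (\<zeta> *s v) \<le> r" "norm (w + \<zeta> *s v) < 1" if "cmod \<zeta> \<le> ?R" for \<zeta>
  proof -
    show *: "norm (\<zeta> *s v) \<le> r"
      using that nv by (simp add: norm_cscale field_simps)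
    show "norm (w + \<zeta> *s v) < 1"
      using norm_triangle_ineq[of w "\<zeta> *s v"] * r by linarith
  qed
  have der: "(?g has_field_derivative dir_deriv f (w + \<zeta> *s v) v) (at \<zeta>)" if "cmod \<zeta> \<le> ?R" for \<zeta>
    by (rule has_field_derivative_slice) (use holomorphic_ballD[OF f in_ball(2)[OF that]] in auto)
  have "norm ((deriv ^^ 1) ?g 0) \<le> fact 1 * M / ?R ^ 1"
  proof (rule Cauchy_inequality)
    show "?g holomorphic_on ball 0 ?R"
      unfolding holomorphic_on_open[OF open_ball] using der by (meson less_imp_le mem_ball_0)
    show "continuous_on (cball 0 ?R) ?g"
      by (intro continuous_at_imp_continuous_on ballI) (use der DERIV_isCont in \<open>force\<close>)
    show "0 < ?R" using r nv by simp
    show "norm (?g x) \<le> M" if "norm (0 - x) = ?R" for x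
      using that by (intro M) (use in_ball(1)[of x] in simp)
  qed
  moreover have "deriv ?g 0 = dir_deriv f w v"
    using DERIV_imp_deriv[OF der[of 0]] r nv by simp
  ultimately show ?thesis
    by (simp add: mult.commute)
qed

text \<open>Compactness bounds \<open>f\<close> on a ball halfway between radius \<open>r\<close>
  and 1; the Cauchy estimate with the remaining gap then bounds the derivative. This is the
  substitute for continuity of the derivative.\<close>

lemma holomorphic_ball_bounds:
  assumes f: "holomorphic_ball f" and r: "0 \<le> r" "r < 1"
  obtains M where "0 \<le> M" "\<And>w. norm w \<le> r \<Longrightarrow> cmod (f w) \<le> M"
    "\<And>w v. norm w \<le> r \<Longrightarrow> cmod (dir_deriv f w v) \<le> M * norm v"
proof -
  let ?d = "(1 - r) / 2"
  have "compact (f ` cball 0 (r + ?d))"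
    using r by (intro compact_continuous_image continuous_on_subset[OF holomorphic_ball_continuous_on[OF f]])
       (auto simp: field_simps)
  from compact_imp_bounded[OF this] obtain M where "\<forall>x\<in>f ` cball 0 (r + ?d). cmod x \<le> M"
    unfolding bounded_iff ..
  then have M: "\<And>w. norm w \<le> r + ?d \<Longrightarrow> cmod (f w) \<le> M"
    by auto
  have M0: "0 \<le> M" using order_trans[OF norm_ge_zero M[of 0]] r by simp
  have d: "?d > 0" "?d \<le> 1" using r by auto
  show ?thesis
  proof (rule that[of "M / ?d"])
    have "M \<le> M / ?d" using mult_left_mono[OF d(2) M0] d(1) by (simp add: pos_le_divide_eq)
    then show "cmod (f w) \<le> M / ?d" if "norm w \<le> r" for w
      using M[of w] that d by linarith
    show "cmod (dir_deriv f w v) \<le> M / ?d * norm v" if "norm w \<le> r" for w v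
    proof (rule cauchy_estimate[OF f d(1)])
      show "norm w + ?d < 1" using that r by (simp add: field_simps)
      show "cmod (f y) \<le> M" if "norm (y - w) \<le> ?d" for y
        using norm_triangle_ineq[of "y - w" w] that \<open>norm w \<le> r\<close> by (intro M) (simp add: field_simps)
    qed
  qed (use M0 d in simp)
qed

lemma partial_deriv_eq:
  assumes "holomorphic_ball f" "norm z < 1"
  shows "partial_deriv j f z = dir_deriv f z (axis j 1)"
proof -
  have eq: "(\<chi> i. if i = j then w else z $ i) = (z - (z $ j) *s axis j 1) + w *s axis j 1" for w
    by (auto simp: vec_eq_iff axis_def)
  have "((\<lambda>w. f ((z - (z $ j) *s axis j 1) + w *s axis j 1)) has_field_derivative dir_deriv f z (axis j 1)) (at (z $ j))"
    by (rule has_field_derivative_slice) (use holomorphic_ballD[OF assms] in auto)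
  then show ?thesis
    unfolding partial_deriv_def eq by (rule DERIV_imp_deriv)
qed

lemma radial_deriv_eq:
  assumes "holomorphic_ball f" "norm z < 1"
  shows "radial_deriv f z = dir_deriv f z z"
  unfolding radial_deriv_def by (simp add: partial_deriv_eq[OF assms] dir_deriv_axis_sum[OF assms])

subsection \<open>Integration by parts on the ball\<close>

text \<open>The sequential form serves two ends: a pointwise limit of difference quotients is
  measurable, and dominated convergence applies to it.\<close>

lemma has_derivative_imp_quotient_tendsto:
  fixes h :: "'a::real_normed_vector \<Rightarrow> 'b::real_normed_vector"
  assumes "(h has_derivative D) (at w)"
  shows "(\<lambda>k. real (Suc k) *\<^sub>R (h (w + inverse (real (Suc k)) *\<^sub>R a) - h w)) \<longlonglongrightarrow> D a"
proof -
  have "((\<lambda>t. h (w + t *\<^sub>R a)) has_derivative (\<lambda>t. D (t *\<^sub>R a))) (at 0)"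
    by (rule has_derivative_compose[where g = h]) (auto intro!: derivative_eq_intros simp: assms)
  then have "((\<lambda>t. h (w + t *\<^sub>R a)) has_vector_derivative D a) (at 0)"
    unfolding has_vector_derivative_def
    using linear_scale[OF has_derivative_linear[OF assms]] by simp
  then have "((\<lambda>t. norm (h (w + t *\<^sub>R a) - h w - t *\<^sub>R D a) / norm t) \<longlongrightarrow> 0) (at 0)"
    unfolding has_vector_derivative_def has_derivative_at by simp
  moreover have "filterlim (\<lambda>k. inverse (real (Suc k))) (at 0) sequentially"
    using LIMSEQ_inverse_real_of_nat by (auto simp: filterlim_at)
  ultimately have "(\<lambda>k. norm (h (w + inverse (real (Suc k)) *\<^sub>R a) - h w - inverse (real (Suc k)) *\<^sub>R D a)
      / norm (inverse (real (Suc k)))) \<longlonglongrightarrow> 0"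
    by (rule filterlim_compose)
  moreover have "norm (h (w + inverse (real (Suc k)) *\<^sub>R a) - h w - inverse (real (Suc k)) *\<^sub>R D a) / norm (inverse (real (Suc k)))
     = norm (real (Suc k) *\<^sub>R (h (w + inverse (real (Suc k)) *\<^sub>R a) - h w) - D a)" (is "norm ?x / _ = norm ?y") for k
  proof -
    have "?y = real (Suc k) *\<^sub>R ?x" by (simp add: algebra_simps del: of_nat_Suc)
    then have "norm ?y = real (Suc k) * norm ?x" by (simp only: norm_scaleR abs_of_nat)
    then show ?thesis by (simp add: divide_inverse mult.commute)
  qed
  ultimately show ?thesis
    unfolding LIM_zero_iff[symmetric, where l = "D a"] by (simp add: tendsto_norm_zero_iff del: of_nat_Suc)
qed

lemma lborel_integral_shift:
  fixes h :: "'a::euclidean_space \<Rightarrow> 'b::euclidean_space"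
  assumes "h \<in> borel_measurable borel"
  shows "integrable lborel (\<lambda>w. h (w + c)) \<longleftrightarrow> integrable lborel h"
    "(LINT w|lborel. h (w + c)) = (LINT w|lborel. h w)"
  using integrable_distr_eq[of "(+) c" lborel borel h] integral_distr[of "(+) c" lborel borel h] assms
  by (auto simp: lborel_distr_plus add.commute)

text \<open>Translation invariance makes every difference quotient integrate to 0. The quotients are
  bounded by the mean value theorem and live in one fixed ball, so the limit may be taken under the
  integral.\<close>

lemma integral_derivative_compact_support:
  fixes h :: "'a::euclidean_space \<Rightarrow> 'b::euclidean_space"
  assumes der: "\<And>w. (h has_derivative h' w) (at w)"
    and bd: "\<And>w v. norm (h' w v) \<le> B * norm v"
    and supp: "\<And>w. R < norm w \<Longrightarrow> h w = 0"
  shows "integrable lborel (\<lambda>w. h' w a)" "(LINT w|lborel. h' w a) = 0"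
proof -
  let ?c = "\<lambda>k. inverse (real (Suc k)) *\<^sub>R a"
  let ?q = "\<lambda>k w. real (Suc k) *\<^sub>R (h (w + ?c k) - h w)"
  have cont: "continuous_on S h" for S
    using der by (meson continuous_at_imp_continuous_on has_derivative_continuous)
  have meas [measurable]: "h \<in> borel_measurable borel"
    by (rule borel_measurable_continuous_onI[OF cont])
  have "integrable lborel (\<lambda>w. indicator (cball 0 R) w *\<^sub>R h w)"
    by (rule borel_integrable_compact[OF compact_cball cont])
  moreover have "(\<lambda>w. indicator (cball 0 R) w *\<^sub>R h w) = h"
    using supp by (auto simp: fun_eq_iff indicator_def not_le)
  ultimately have int: "integrable lborel h" by simp
  have int': "integrable lborel (\<lambda>w. h (w + c))" for c
    using lborel_integral_shift(1)[OF meas] int by simp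
  have q0: "integral\<^sup>L lborel (?q k) = 0" for k
    using int int' by (simp add: lborel_integral_shift(2)[OF meas])
  have B0: "0 \<le> B * norm a" using bd[of 0 a] norm_ge_zero order_trans by blast
  have lip: "norm (h (w + ?c k) - h w) \<le> B * norm (?c k)" for w k
    using differentiable_bound[of UNIV h h' B "w + ?c k" w] der
    by (simp add: onorm_le bd)
  have c_le: "norm (?c k) \<le> norm a" for k
    by (simp add: field_simps)
  have bound: "norm (?q k w) \<le> indicator (cball 0 (R + norm a)) w *\<^sub>R (B * norm a)" for k w
  proof (cases "norm w \<le> R + norm a")
    case True
    have "norm (?q k w) = real (Suc k) * norm (h (w + ?c k) - h w)" by simp
    also have "\<dots> \<le> real (Suc k) * (B * norm (?c k))"
      by (intro mult_left_mono lip) auto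
    also have "\<dots> = B * norm a" by simp
    finally show ?thesis using True by (simp add: indicator_def)
  next
    case False
    then have "h w = 0" using supp[of w] norm_ge_zero[of a] by linarith
    moreover have "norm w \<le> norm (w + ?c k) + norm (?c k)"
      by (metis add_diff_cancel_right' norm_triangle_ineq4)
    then have "h (w + ?c k) = 0"
      using False c_le[of k] by (intro supp) linarith
    ultimately show ?thesis using False by (simp add: indicator_def)
  qed
  have lim: "(\<lambda>k. ?q k w) \<longlonglongrightarrow> h' w a" for w
    by (rule has_derivative_imp_quotient_tendsto[OF der])
  have meas': "(\<lambda>w. h' w a) \<in> borel_measurable lborel"
    by (rule borel_measurable_LIMSEQ_metric[OF _ lim]) measurable
  have dom: "integrable lborel (\<lambda>w. indicator (cball 0 (R + norm a)) w *\<^sub>R (B * norm a) :: real)"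
    by (rule borel_integrable_compact) auto
  show "integrable lborel (\<lambda>w. h' w a)"
    by (rule integrable_dominated_convergence[where s = ?q, OF meas' _ dom]) (use lim bound in auto)
  have "(\<lambda>k. integral\<^sup>L lborel (?q k)) \<longlonglongrightarrow> (LINT w|lborel. h' w a)"
    by (rule integral_dominated_convergence[OF meas' _ dom]) (use lim bound in auto)
  then show "(LINT w|lborel. h' w a) = 0"
    unfolding q0 by (simp add: LIMSEQ_const_iff)
qed

section \<open>Integration by parts against a weight cut off near the sphere\<close>

lemma has_derivative_rho: "(rho has_derivative (\<lambda>v. - 2 * inner w v)) (at w)"
  unfolding power2_norm_eq_inner
  by (auto intro!: derivative_eq_intros simp: inner_commute)

lemma measurable_rho [measurable]: "rho \<in> borel_measurable borel"
  by measurable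

lemma sets_unit_ball [measurable]: "unit_ball \<in> sets borel"
  by simp

lemma norm_le_sqrt_if_rho_ge: "0 < e \<Longrightarrow> e \<le> rho w \<Longrightarrow> norm w \<le> sqrt (1 - e)"
  by (intro real_le_rsqrt) simp

lemma has_derivative_cnj: "(f has_derivative D) F \<Longrightarrow> ((\<lambda>x. cnj (f x)) has_derivative (\<lambda>x. cnj (D x))) F"
  by (rule bounded_linear.has_derivative[OF bounded_linear_cnj])

text \<open>\<open>g\<close> is a profile to be composed with \<open>rho\<close>. Vanishing for all
  \<open>x \<le> e\<close>, negative \<open>x\<close> included, lets a product with
  \<open>g (rho w)\<close> be extended by 0 across the sphere; bounds are asked only for
  \<open>x \<le> 1\<close>, the range of \<open>rho\<close>.\<close>

locale cutoff =
  fixes g g' :: "real \<Rightarrow> real" and e G :: real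
  assumes e: "0 < e" "e < 1"
    and g: "\<And>x. (g has_real_derivative g' x) (at x)"
    and zero: "\<And>x. x \<le> e \<Longrightarrow> g x = 0" "\<And>x. x \<le> e \<Longrightarrow> g' x = 0"
    and bound: "\<And>x. x \<le> 1 \<Longrightarrow> \<bar>g x\<bar> \<le> G" "\<And>x. x \<le> 1 \<Longrightarrow> \<bar>g' x\<bar> \<le> G"
    and meas: "g' \<in> borel_measurable borel"
begin

text \<open>The Wirtinger derivative in \<open>w $ j\<close> of \<open>u * cnj F * g (rho w)\<close>
  has integral 0. It does not see the antiholomorphic factor \<open>cnj F\<close>, and applied to
  \<open>g (rho w)\<close> it gives \<open>- cnj (w $ j) * g' (rho w)\<close>.\<close>

lemma parts:
  fixes u F :: "complex ^ 'n \<Rightarrow> complex"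
  assumes u: "holomorphic_ball u" and F: "holomorphic_ball F"
  shows "integrable lborel (\<lambda>w. indicator unit_ball w *\<^sub>R (dir_deriv u w (axis j 1) * cnj (F w) * g (rho w)))" (is "integrable _ ?A")
    and "integrable lborel (\<lambda>w. indicator unit_ball w *\<^sub>R (u w * cnj (w $ j) * cnj (F w) * g' (rho w)))" (is "integrable _ ?B")
    and "(LINT w|lborel. indicator unit_ball w *\<^sub>R (dir_deriv u w (axis j 1) * cnj (F w) * g (rho w)))
      = (LINT w|lborel. indicator unit_ball w *\<^sub>R (u w * cnj (w $ j) * cnj (F w) * g' (rho w)))"
proof -
  let ?h = "\<lambda>w. if norm w < 1 then u w * cnj (F w) * of_real (g (rho w)) else 0"
  let ?h' = "\<lambda>w v. if norm w < 1 then 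
     dir_deriv u w v * cnj (F w) * of_real (g (rho w)) + u w * cnj (dir_deriv F w v) * of_real (g (rho w))
     + u w * cnj (F w) * of_real (g' (rho w) * (- 2 * inner w v)) else 0"
  define r where "r = sqrt (1 - e)"
  have r: "0 \<le> r" "r < 1" using e by (auto simp: r_def)
  obtain Mu where Mu: "0 \<le> Mu" "\<And>w. norm w \<le> r \<Longrightarrow> cmod (u w) \<le> Mu"
    "\<And>w v. norm w \<le> r \<Longrightarrow> cmod (dir_deriv u w v) \<le> Mu * norm v"
    using holomorphic_ball_bounds[OF u r] by metis
  obtain MF where MF: "0 \<le> MF" "\<And>w. norm w \<le> r \<Longrightarrow> cmod (F w) \<le> MF"
    "\<And>w v. norm w \<le> r \<Longrightarrow> cmod (dir_deriv F w v) \<le> MF * norm v"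
    using holomorphic_ball_bounds[OF F r] by metis
  have G0: "0 \<le> G" using bound(1)[of 0] by linarith
  have rho_small: "rho w \<le> e" if "\<not> norm w \<le> r" for w :: "complex ^ 'n"
    using norm_le_sqrt_if_rho_ge[of e w] that e unfolding r_def by linarith
  have der: "(?h has_derivative ?h' w) (at w)" for w
  proof (cases "norm w < 1")
    case True
    have 1: "((\<lambda>w. of_real (g (rho w)) :: complex) has_derivative (\<lambda>v. of_real (g' (rho w) * (- 2 * inner w v)))) (at w)"
      by (rule bounded_linear.has_derivative[OF bounded_linear_of_real])
         (rule has_derivative_compose[OF has_derivative_rho has_field_derivative_imp_has_derivative[OF g]])
    have "((\<lambda>w. u w * cnj (F w) * of_real (g (rho w))) has_derivative ?h' w) (at w)"
      by (rule has_derivative_eq_rhs[OF has_derivative_mult[OF has_derivative_mult[OF holomorphic_ballD(1)[OF u True]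
            has_derivative_cnj[OF holomorphic_ballD(1)[OF F True]]] 1]])
         (auto simp: True algebra_simps)
    then show ?thesis
      by (rule has_derivative_transform_within_open[where s = unit_ball]) (use True in auto)
  next
    case False
    then have "rho w \<le> 0" by simp
    \<comment> \<open>The set \<open>rho < e\<close> is open and contains the sphere and its
      exterior, and the extended function vanishes on it; so differentiability holds at boundary
      points too.\<close>
    then have w: "w \<in> rho -` {..<e}" using e by auto
    have "(?h has_derivative (\<lambda>_. 0)) (at w)"
    proof (rule has_derivative_transform_within_open[OF has_derivative_const[of 0] _ w])
      show "open (rho -` {..<e} :: (complex ^ 'n) set)"
        by (intro open_vimage continuous_intros)
    qed (simp add: zero)
    then show ?thesis using False by simp
  qed
  \<comment> \<open>The 4 is 1 + 1 + 2: one from each derivative of \<open>u\<close> and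
    \<open>F\<close>, and 2 from the derivative of \<open>rho\<close>.\<close>
  have bd: "norm (?h' w v) \<le> (4 * Mu * MF * G) * norm v" for w v
  proof (cases "norm w \<le> r")
    case True
    let ?v = "norm v"
    have n: "norm w < 1" using True r by simp
    have gg: "\<bar>g (rho w)\<bar> \<le> G" "\<bar>g' (rho w)\<bar> \<le> G" using bound[of "rho w"] by auto
    have 1: "norm (dir_deriv u w v * cnj (F w) * of_real (g (rho w))) \<le> (Mu * ?v) * MF * G"
      unfolding norm_mult complex_mod_cnj norm_of_real using Mu MF gg True by (intro mult_mono mult_nonneg_nonneg) auto
    have 2: "norm (u w * cnj (dir_deriv F w v) * of_real (g (rho w))) \<le> Mu * (MF * ?v) * G"
      unfolding norm_mult complex_mod_cnj norm_of_real using Mu MF gg True by (intro mult_mono mult_nonneg_nonneg) auto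
    have "\<bar>- 2 * inner w v\<bar> \<le> 2 * ?v"
      using Cauchy_Schwarz_ineq2[of w v] mult_right_mono[of "norm w" 1 "norm v"] n by simp
    then have 3: "norm (u w * cnj (F w) * of_real (g' (rho w) * (- 2 * inner w v))) \<le> Mu * MF * (G * (2 * ?v))"
      unfolding norm_mult complex_mod_cnj norm_of_real abs_mult[of "g' _"]  using Mu MF gg True by (intro mult_mono mult_nonneg_nonneg) auto
    have "norm (?h' w v) \<le> (Mu * ?v) * MF * G + Mu * (MF * ?v) * G + Mu * MF * (G * (2 * ?v))"
      unfolding if_P[OF n] by (intro norm_triangle_mono 1 2 3)
    also have "\<dots> = (4 * Mu * MF * G) * norm v" by (simp add: algebra_simps)
    finally show ?thesis .
  next
    case False
    then show ?thesis using rho_small[of w] Mu MF G0 by (simp add: zero)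
  qed
  have supp: "?h w = 0" if "1 < norm w" for w using that by simp
  note I = integral_derivative_compact_support[of ?h ?h', OF der bd supp]
  \<comment> \<open>Twice the Wirtinger derivative. By complex linearity the two \<open>u\<close>
    terms add up and the two conjugated \<open>F\<close> terms cancel.\<close>
  let ?D = "\<lambda>w. ?h' w (axis j 1) - \<i> * ?h' w (axis j \<i>)"
  have intD: "integrable lborel ?D" and D0: "(LINT w|lborel. ?D w) = 0"
    using I by (auto simp del: of_real_mult)
  have axis_i: "axis j \<i> = \<i> *s axis j (1::complex)" by (auto simp: vec_eq_iff axis_def)
  have "?D w = 2 * (?A w - ?B w)" for w
  proof (cases "norm w < 1")
    case True
    have e1: "inner w (axis j 1) = Re (w $ j)" by (simp add: inner_axis)
    have e2: "inner w (axis j \<i>) = Im (w $ j)" by (simp add: inner_axis)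
    have "of_real (Re (w $ j)) - \<i> * of_real (Im (w $ j)) = cnj (w $ j)"
      by (simp add: complex_eq_iff)
    then have *: "of_real (Re (w $ j)) = cnj (w $ j) + \<i> * of_real (Im (w $ j))"
      by (simp add: algebra_simps)
    show ?thesis using True unfolding e1 e2 unfolding axis_i holomorphic_ballD(2)[OF u True] holomorphic_ballD(2)[OF F True]
      by (simp add: algebra_simps *)
  qed simp
  then have D: "?D = (\<lambda>w. 2 * (?A w - ?B w))" by blast
  have intD': "integrable lborel (\<lambda>w. 2 * (?A w - ?B w))" and D0': "(LINT w|lborel. 2 * (?A w - ?B w)) = 0"
    using intD D0 unfolding D .
  have half: "1 / 2 * (2 * x) = x" for x :: complex by simp
  have intAB: "integrable lborel (\<lambda>w. ?A w - ?B w)"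
    using integrable_mult_right[OF intD', of "1/2"] unfolding half .
  have AB0: "(LINT w|lborel. ?A w - ?B w) = 0"
    using D0' by (subst (asm) integral_mult_right_zero) simp
  \<comment> \<open>Only \<open>?B\<close> is bounded by hand. \<open>?A\<close> contains a
    derivative, and its measurability and integrability are inherited from \<open>?A - ?B\<close>,
    which is already known to be integrable.\<close>
  show intB: "integrable lborel ?B"
  proof -
    have cu: "continuous_on unit_ball u" "continuous_on unit_ball F"
      using u F by (auto intro: holomorphic_ball_continuous_on)
    have [measurable]: "(\<lambda>w. indicator unit_ball w *\<^sub>R (u w * cnj (w $ j) * cnj (F w))) \<in> borel_measurable borel"
      by (rule borel_measurable_continuous_on_indicator) (auto intro!: continuous_intros cu)
    have [measurable]: "(\<lambda>w::complex ^ 'n. g' (rho w)) \<in> borel_measurable borel" using meas by measurable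
    have eq: "?B = (\<lambda>w. (indicator unit_ball w *\<^sub>R (u w * cnj (w $ j) * cnj (F w))) * of_real (g' (rho w)))"
      by (auto simp: fun_eq_iff)
    have mB: "?B \<in> borel_measurable lborel" unfolding eq by measurable
    have nB: "norm (?B w) \<le> indicator (cball 0 1) w *\<^sub>R (Mu * 1 * MF * G)" for w
    proof (cases "norm w \<le> r")
      case True
      have "cmod (w $ j) \<le> 1" using Finite_Cartesian_Product.norm_nth_le[of w j] True r by linarith
      moreover have "\<bar>g' (rho w)\<bar> \<le> G" using bound[of "rho w"] by auto
      ultimately have "cmod (u w * cnj (w $ j) * cnj (F w) * g' (rho w)) \<le> Mu * 1 * MF * G"
        unfolding norm_mult complex_mod_cnj norm_of_real using Mu MF True by (intro mult_mono mult_nonneg_nonneg) auto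
      then show ?thesis using True r by (simp add: indicator_def)
    next
      case False
      then show ?thesis using rho_small[of w] Mu MF G0 by (simp add: zero indicator_def)
    qed
    have dom: "integrable lborel (\<lambda>w::complex ^ 'n. indicator (cball 0 1) w *\<^sub>R (Mu * 1 * MF * G))"
      by (rule borel_integrable_compact) auto
    show ?thesis
      by (rule Bochner_Integration.integrable_bound[OF dom mB]) (rule AE_I2, rule order_trans[OF nB], simp)
  qed
  show intA: "integrable lborel ?A"
    using Bochner_Integration.integrable_add[OF intAB intB] by simp
  show "integral\<^sup>L lborel ?A = integral\<^sup>L lborel ?B"
    using AB0 intA intB by simp
qed

lemma divergence:
  fixes u :: "'n::finite \<Rightarrow> complex ^ 'n \<Rightarrow> complex" and F :: "complex ^ 'n \<Rightarrow> complex"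
  assumes u: "\<And>j. holomorphic_ball (u j)" and F: "holomorphic_ball F"
  shows "(LINT w|lborel. indicator unit_ball w *\<^sub>R ((\<Sum>j\<in>UNIV. dir_deriv (u j) w (axis j 1)) * cnj (F w) * g (rho w)))
      = (LINT w|lborel. indicator unit_ball w *\<^sub>R ((\<Sum>j\<in>UNIV. u j w * cnj (w $ j)) * cnj (F w) * g' (rho w)))"
  unfolding sum_distrib_right scaleR_sum_right
  using parts[OF u F] by (subst (1 2) Bochner_Integration.integral_sum) (auto simp del: indicator_scaleR_eq_if)

end


text \<open>The cutoff of \<open>x powr (a + 1)\<close> at height \<open>e\<close> is chosen to be continuously differentiable, with it
  and its derivative dominated by constant multiples of \<open>x powr (a + 1)\<close> and \<open>x powr a\<close> uniformly in \<open>e\<close>.\<close>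

definition cut :: "real \<Rightarrow> real \<Rightarrow> real \<Rightarrow> real" where
  "cut a e x = (if x \<le> e then 0 else (x - e)\<^sup>2 * x powr (a - 1))"

definition cut' :: "real \<Rightarrow> real \<Rightarrow> real \<Rightarrow> real" where
  "cut' a e x = (if x \<le> e then 0 else (x - e) * x powr (a - 2) * (2 * x + (a - 1) * (x - e)))"

lemma measurable_cut' [measurable]: "cut' a e \<in> borel_measurable borel"
  unfolding cut'_def by measurable

lemma measurable_cut [measurable]: "cut a e \<in> borel_measurable borel"
  unfolding cut_def by measurable

text \<open>The factor \<open>(x - e)\<^sup>2\<close> vanishes to second order at \<open>e\<close>,
  so the two branches fit together differentiably; the power is differentiated only at
  \<open>x \<ge> e > 0\<close>.\<close>

lemma DERIV_cut:
  assumes "0 < e"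
  shows "(cut a e has_real_derivative cut' a e x) (at x)"
proof (cases "x < e")
  case True
  have "((\<lambda>_. 0) has_real_derivative 0) (at x)" by simp
  then have "(cut a e has_real_derivative 0) (at x)"
    by (rule DERIV_cong_ev[OF refl _ refl, THEN iffD1, rotated])
       (use eventually_nhds_in_open[of "{..<e}" x] True in \<open>auto elim!: eventually_mono simp: cut_def\<close>)
  then show ?thesis using True by (simp add: cut'_def)
next
  case False
  then have x: "0 < x" "e \<le> x" using assms by auto
  let ?p = "\<lambda>x. if x \<le> e then 0 else (x - e)\<^sup>2"
  have p: "(?p has_real_derivative (if x \<le> e then 0 else 2 * (x - e))) (at x)"
  proof (cases "x = e")
    case True
    have "((\<lambda>y. (?p y - ?p x) / (y - x)) \<longlongrightarrow> 0) (at x)"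
    proof (rule Lim_null_comparison)
      show "\<forall>\<^sub>F y in at x. norm ((?p y - ?p x) / (y - x)) \<le> \<bar>y - x\<bar>"
        using True by (intro always_eventually allI) (auto simp: power2_eq_square)
      show "((\<lambda>y. \<bar>y - x\<bar>) \<longlongrightarrow> 0) (at x)"
        by (auto intro!: tendsto_eq_intros)
    qed
    then show ?thesis using True by (simp add: has_field_derivative_iff)
  next
    case False
    then have "e < x" using x by simp
    have "((\<lambda>x. (x - e)\<^sup>2) has_real_derivative 2 * (x - e)) (at x)"
      by (auto intro!: derivative_eq_intros)
    then have "(?p has_real_derivative 2 * (x - e)) (at x)"
      by (rule DERIV_cong_ev[OF refl _ refl, THEN iffD1, rotated])
         (use eventually_nhds_in_open[of "{e<..}" x] \<open>e < x\<close> in \<open>auto elim!: eventually_mono\<close>)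
    then show ?thesis using \<open>e < x\<close> by simp
  qed
  have q: "((\<lambda>x. x powr (a - 1)) has_real_derivative (a - 1) * x powr (a - 1 - 1)) (at x)"
    by (rule has_real_derivative_powr) (use x in auto)
  have "((\<lambda>x. ?p x * x powr (a - 1)) has_real_derivative cut' a e x) (at x)"
  proof (rule DERIV_cong[OF DERIV_mult[OF p q]])
    have "x powr (a - 1) = x * x powr (a - 2)"
      using x powr_add[of x 1 "a - 2"] by simp
    then show "(if x \<le> e then 0 else 2 * (x - e)) * x powr (a - 1) + (a - 1) * x powr (a - 1 - 1) * ?p x = cut' a e x"
      by (simp add: cut'_def algebra_simps power2_eq_square)
  qed
  moreover have "(\<lambda>x. ?p x * x powr (a - 1)) = cut a e"
    by (auto simp: cut_def fun_eq_iff)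
  ultimately show ?thesis by simp
qed

lemma cut_bounds:
  assumes "0 < e" "-1 < a" "0 < x"
  shows "0 \<le> cut a e x" "cut a e x \<le> x powr (a + 1)" "0 \<le> cut' a e x" "cut' a e x \<le> (3 + a) * x powr a"
proof -
  show "0 \<le> cut a e x" by (simp add: cut_def)
  have "(x - e)\<^sup>2 * x powr (a - 1) \<le> x\<^sup>2 * x powr (a - 1)" if "e < x"
    using that assms by (intro mult_right_mono power_mono) auto
  also have "x\<^sup>2 * x powr (a - 1) = x powr (a + 1)"
    using assms powr_add[of x 2 "a - 1"] by (simp add: add.commute)
  finally show "cut a e x \<le> x powr (a + 1)" by (simp add: cut_def)
  \<comment> \<open>The expression equals \<open>(a + 1) * (x - e) + 2 * e\<close>, hence the sign.
    It also equals \<open>(a + 1) * x + (1 - a) * e\<close>, where \<open>1 - a < 2\<close> and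
    \<open>e < x\<close>, hence the upper bound.\<close>
  have *: "0 \<le> 2 * x + (a - 1) * (x - e)" "2 * x + (a - 1) * (x - e) \<le> (3 + a) * x" if "e < x"
  proof -
    have "0 \<le> (a + 1) * (x - e)" using that assms by simp
    then show "0 \<le> 2 * x + (a - 1) * (x - e)" using assms by (simp add: algebra_simps)
    have "0 \<le> (a + 1) * e" using assms by simp
    then show "2 * x + (a - 1) * (x - e) \<le> (3 + a) * x" using that assms by (simp add: algebra_simps)
  qed
  show "0 \<le> cut' a e x" using * by (simp add: cut'_def)
  have "(x - e) * x powr (a - 2) * (2 * x + (a - 1) * (x - e)) \<le> x * x powr (a - 2) * ((3 + a) * x)" if "e < x"
    using * that assms by (intro mult_mono mult_nonneg_nonneg) auto
  also have "x * x powr (a - 2) * ((3 + a) * x) = (3 + a) * x powr a"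
    using assms powr_add[of x 2 "a - 2"] by (simp add: power2_eq_square)
  finally show "cut' a e x \<le> (3 + a) * x powr a" using assms by (simp add: cut'_def)
qed

lemma cut_tendsto:
  assumes "0 < x"
  shows "(\<lambda>k. cut a (inverse (real (k + 2))) x) \<longlonglongrightarrow> x powr (a + 1)"
    "(\<lambda>k. cut' a (inverse (real (k + 2))) x) \<longlonglongrightarrow> (a + 1) * x powr a"
proof -
  let ?e = "\<lambda>k. inverse (real (k + 2))"
  have e: "?e \<longlonglongrightarrow> 0"
    using LIMSEQ_ignore_initial_segment[OF tendsto_inverse_0_at_top[OF filterlim_real_sequentially], of 2] by simp
  have ev: "eventually (\<lambda>k. ?e k < x) sequentially"
    using order_tendstoD(2)[OF e assms] .
  have "(\<lambda>k. (x - ?e k)\<^sup>2 * x powr (a - 1)) \<longlonglongrightarrow> (x - 0)\<^sup>2 * x powr (a - 1)"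
    by (intro tendsto_intros e)
  moreover have "x\<^sup>2 * x powr (a - 1) = x powr (a + 1)"
    using assms powr_add[of x 2 "a - 1"] by (simp add: add.commute)
  ultimately have 1: "(\<lambda>k. (x - ?e k)\<^sup>2 * x powr (a - 1)) \<longlonglongrightarrow> x powr (a + 1)" by simp
  show "(\<lambda>k. cut a (?e k) x) \<longlonglongrightarrow> x powr (a + 1)"
    by (rule Lim_transform_eventually[OF 1]) (use ev in \<open>auto elim!: eventually_mono simp: cut_def\<close>)
  have "(\<lambda>k. (x - ?e k) * x powr (a - 2) * (2 * x + (a - 1) * (x - ?e k)))
      \<longlonglongrightarrow> (x - 0) * x powr (a - 2) * (2 * x + (a - 1) * (x - 0))"
    by (intro tendsto_intros e)
  moreover have "(x - 0) * x powr (a - 2) * (2 * x + (a - 1) * (x - 0)) = (a + 1) * x powr a"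
    using assms powr_add[of x 2 "a - 2"] by (simp add: power2_eq_square algebra_simps)
  ultimately have 2: "(\<lambda>k. (x - ?e k) * x powr (a - 2) * (2 * x + (a - 1) * (x - ?e k))) \<longlonglongrightarrow> (a + 1) * x powr a" by simp
  show "(\<lambda>k. cut' a (?e k) x) \<longlonglongrightarrow> (a + 1) * x powr a"
    by (rule Lim_transform_eventually[OF 2]) (use ev in \<open>auto elim!: eventually_mono simp: cut'_def\<close>)
qed

text \<open>On \<open>(e, 1]\<close> the power \<open>x powr a\<close> is at most 1 for
  \<open>a \<ge> 0\<close> and at most \<open>e powr a\<close> for \<open>a < 0\<close>. This
  constant depends on \<open>e\<close> and serves only to enter the locale; limits in
  \<open>e\<close> use \<open>cut_bounds\<close>.\<close>

lemma cutoff_cut: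
  assumes "0 < e" "e < 1" "-1 < a"
  shows "cutoff (cut a e) (cut' a e) e ((3 + a) * (1 + e powr a))"
proof
  show "(cut a e has_real_derivative cut' a e x) (at x)" for x by (rule DERIV_cut[OF assms(1)])
  have G: "1 \<le> (3 + a) * (1 + e powr a)"
    using mult_mono[of 1 "3 + a" 1 "1 + e powr a"] assms by simp
  show "\<bar>cut a e x\<bar> \<le> (3 + a) * (1 + e powr a)" if "x \<le> 1" for x
  proof (cases "0 < x")
    case True
    have "x powr (a + 1) \<le> 1" using that assms True by (auto intro!: powr_le1)
    then show ?thesis using cut_bounds[OF assms(1,3) True] G by auto
  qed (use assms G in \<open>simp add: cut_def\<close>)
  show "\<bar>cut' a e x\<bar> \<le> (3 + a) * (1 + e powr a)" if "x \<le> 1" for x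
  proof (cases "e < x")
    case True
    have "x powr a \<le> 1 + e powr a"
    proof (cases "0 \<le> a")
      case True
      then have "x powr a \<le> 1" using that \<open>e < x\<close> assms by (intro powr_le1) auto
      then show ?thesis using powr_ge_zero[of e a] by linarith
    next
      case False
      then have "x powr a \<le> e powr a" using \<open>e < x\<close> assms powr_mono2'[of a e x] by simp
      then show ?thesis by linarith
    qed
    then have "(3 + a) * x powr a \<le> (3 + a) * (1 + e powr a)" using assms by (intro mult_left_mono) auto
    moreover have "0 \<le> cut' a e x" "cut' a e x \<le> (3 + a) * x powr a"
      using cut_bounds(3,4)[OF assms(1,3), of x] True assms by auto
    ultimately show ?thesis by linarith
  qed (use assms G in \<open>simp add: cut'_def\<close>)
qed (use assms in \<open>auto simp: cut_def cut'_def\<close>)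

text \<open>The offset 2 keeps the cutoff height strictly below 1 for every index.\<close>

lemma inverse_nat_bounds: "0 < inverse (real (k + 2))" "inverse (real (k + 2)) < 1"
  by (auto simp: field_simps)

text \<open>Fatou's lemma, applied to the divergence identity for the field \<open>w\<close> and \<open>F = 1\<close>, replaces
  polar coordinates here.\<close>

lemma integrable_rho_powr:
  assumes a: "-1 < a"
  shows "integrable lborel (\<lambda>w :: complex ^ 'n. indicator unit_ball w *\<^sub>R rho w powr a)"
proof -
  let ?e = "\<lambda>k. inverse (real (k + 2))"
  let ?n = "real CARD('n)"
  define V where "V = measure lborel (unit_ball :: (complex ^ 'n) set)"
  have ball_int: "integrable lborel (\<lambda>w :: complex ^ 'n. indicator unit_ball w :: real)"
    using emeasure_lborel_ball_finite by (intro integrable_real_indicator) (auto simp: less_top)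
  have key: "integrable lborel (\<lambda>w :: complex ^ 'n. indicator unit_ball w * ((norm w)\<^sup>2 * cut' a (?e k) (rho w)))"
    "(LINT w|lborel. indicator unit_ball w * ((norm (w :: complex ^ 'n))\<^sup>2 * cut' a (?e k) (rho w))) \<le> ?n * V" for k
  proof -
    interpret cutoff "cut a (?e k)" "cut' a (?e k)" "?e k" "(3 + a) * (1 + ?e k powr a)"
      by (rule cutoff_cut[OF inverse_nat_bounds a])
    have d1: "dir_deriv (\<lambda>w. w $ j) w (axis j 1) = 1" for w :: "complex ^ 'n" and j
      by (subst dir_deriv_eqI[OF has_derivative_component]) (simp add: axis_def)
    have d2: "(\<Sum>j\<in>UNIV. w $ j * cnj (w $ j)) = of_real ((norm w)\<^sup>2)" for w :: "complex ^ 'n"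
      using herm_self[of w] by (simp add: herm_def)
    have bdd: "integrable lborel (\<lambda>w :: complex ^ 'n. indicator unit_ball w * h (rho w))"
      if [measurable]: "h \<in> borel_measurable borel" and h: "\<And>x. x \<le> 1 \<Longrightarrow> \<bar>h x\<bar> \<le> K" for h :: "real \<Rightarrow> real" and K
    proof (rule Bochner_Integration.integrable_bound[OF integrable_mult_left[OF ball_int, of K]])
      show "AE w in lborel. norm (indicator unit_ball w * h (rho (w :: complex ^ 'n))) \<le> norm (indicator unit_ball w * K)"
        using h by (intro AE_I2) (auto simp: indicator_def intro: order_trans[OF _ abs_ge_self])
      have "(\<lambda>w :: complex ^ 'n. h (rho w)) \<in> borel_measurable borel"
        by (rule measurable_compose[OF measurable_rho that(1)])
      then show "(\<lambda>w :: complex ^ 'n. indicator unit_ball w * h (rho w)) \<in> borel_measurable lborel"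
        by simp
    qed
    \<comment> \<open>At \<open>x = rho w\<close> the factor \<open>1 - x\<close> is
      \<open>(norm w)\<^sup>2\<close>; the indicator equals 1 on the ball and keeps the profile
      bounded for negative \<open>x\<close>.\<close>
    have "integrable lborel (\<lambda>w :: complex ^ 'n. indicator unit_ball w * ((\<lambda>x. (1 - x) * indicator {0..1} x * cut' a (?e k) x) (rho w)))"
    proof (rule bdd[where K = "(3 + a) * (1 + ?e k powr a)"])
      show "\<bar>(1 - x) * indicator {0..1} x * cut' a (?e k) x\<bar> \<le> (3 + a) * (1 + ?e k powr a)" if "x \<le> 1" for x
        using mult_mono[of "\<bar>(1 - x) * indicator {0..1} x\<bar>" 1 "\<bar>cut' a (?e k) x\<bar>" "(3 + a) * (1 + ?e k powr a)"] bound(2)[OF that]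
        by (auto simp: abs_mult indicator_def)
    qed measurable
    also have "(\<lambda>w :: complex ^ 'n. indicator unit_ball w * ((\<lambda>x. (1 - x) * indicator {0..1} x * cut' a (?e k) x) (rho w)))
      = (\<lambda>w. indicator unit_ball w * ((norm w)\<^sup>2 * cut' a (?e k) (rho w)))"
      using rho_pos by (force simp: fun_eq_iff indicator_def)
    finally show int: "integrable lborel (\<lambda>w :: complex ^ 'n. indicator unit_ball w * ((norm w)\<^sup>2 * cut' a (?e k) (rho w)))" .
    have int2: "integrable lborel (\<lambda>w :: complex ^ 'n. indicator unit_ball w * cut a (?e k) (rho w))"
      by (rule bdd[OF _ bound(1)]) measurable
    have "(LINT w|lborel. indicator unit_ball w *\<^sub>R ((\<Sum>j\<in>UNIV. dir_deriv (\<lambda>w. w $ j) w (axis j 1)) * cnj 1 * cut a (?e k) (rho (w :: complex ^ 'n))))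
      = (LINT w|lborel. indicator unit_ball w *\<^sub>R ((\<Sum>j\<in>UNIV. w $ j * cnj (w $ j)) * cnj 1 * cut' a (?e k) (rho (w :: complex ^ 'n))))"
      by (rule divergence) (auto intro: holomorphic_ball_component holomorphic_ball_const)
    then have "(LINT w|lborel. complex_of_real (?n * (indicator unit_ball w * cut a (?e k) (rho (w :: complex ^ 'n)))))
       = (LINT w|lborel. complex_of_real (indicator unit_ball w * ((norm (w :: complex ^ 'n))\<^sup>2 * cut' a (?e k) (rho w))))"
      by (simp add: d1 d2 scaleR_conv_of_real mult.left_commute del: indicator_scaleR_eq_if)
    then have "(LINT w|lborel. indicator unit_ball w * ((norm (w :: complex ^ 'n))\<^sup>2 * cut' a (?e k) (rho w)))
       = ?n * (LINT w|lborel. indicator unit_ball w * cut a (?e k) (rho (w :: complex ^ 'n)))"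
      using int2 by (simp add: integral_complex_of_real del: of_real_mult) 
    also have "\<dots> \<le> ?n * (LINT w|lborel. indicator (unit_ball :: (complex ^ 'n) set) w)"
    proof (intro mult_left_mono integral_mono int2 ball_int)
      show "indicator unit_ball w * cut a (?e k) (rho w) \<le> indicator unit_ball w" for w :: "complex ^ 'n"
      proof (cases "norm w < 1")
        case True
        have "rho w powr (a + 1) \<le> 1" using rho_pos[OF True] a by (intro powr_le1) auto
        then show ?thesis using cut_bounds(2)[OF inverse_nat_bounds(1) a rho_pos[OF True], of k] by (simp add: indicator_def)
      qed simp
    qed auto
    finally show "(LINT w|lborel. indicator unit_ball w * ((norm (w :: complex ^ 'n))\<^sup>2 * cut' a (?e k) (rho w))) \<le> ?n * V"
      by (simp add: V_def)
  qed
  let ?f = "\<lambda>w :: complex ^ 'n. indicator unit_ball w * ((norm w)\<^sup>2 * ((a + 1) * rho w powr a))"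
  let ?fk = "\<lambda>k (w :: complex ^ 'n). indicator unit_ball w * ((norm w)\<^sup>2 * cut' a (?e k) (rho w))"
  have fk0: "0 \<le> ?fk k w" for k w
    using cut_bounds(3)[OF inverse_nat_bounds(1) a rho_pos, of w k] by (simp add: indicator_def)
  have "(\<integral>\<^sup>+w. ennreal (?f w) \<partial>lborel) = (\<integral>\<^sup>+w. liminf (\<lambda>k. ennreal (?fk k w)) \<partial>lborel)"
  proof (rule nn_integral_cong)
    fix w :: "complex ^ 'n"
    have "(\<lambda>k. ?fk k w) \<longlonglongrightarrow> ?f w"
      using cut_tendsto(2)[OF rho_pos, of w a] by (auto simp: indicator_def intro!: tendsto_intros)
    then have "(\<lambda>k. ennreal (?fk k w)) \<longlonglongrightarrow> ennreal (?f w)" by (rule tendsto_ennrealI)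
    then show "ennreal (?f w) = liminf (\<lambda>k. ennreal (?fk k w))"
      by (simp add: lim_imp_Liminf)
  qed
  also have "\<dots> \<le> liminf (\<lambda>k. \<integral>\<^sup>+w. ennreal (?fk k w) \<partial>lborel)"
    by (rule nn_integral_liminf) measurable
  also have "\<dots> \<le> liminf (\<lambda>k::nat. ennreal (?n * V))"
    using key fk0 by (intro Liminf_mono always_eventually allI)
       (subst nn_integral_eq_integral, auto intro: ennreal_leI)
  also have "\<dots> = ennreal (?n * V)" by (simp add: Liminf_const)
  finally have fin: "(\<integral>\<^sup>+w. ennreal (?f w) \<partial>lborel) < \<infinity>"
    by (simp add: order_le_less_trans)
  have f0: "0 \<le> ?f w" for w using a by (auto simp: indicator_def)
  have intf: "integrable lborel ?f"
    by (rule integrableI_nonneg) (use fin f0 in auto)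
  have c: "0 \<le> 1 + (1/2) powr a" by simp
  show ?thesis
  proof (rule Bochner_Integration.integrable_bound)
    show "integrable lborel (\<lambda>w :: complex ^ 'n. indicator unit_ball w * (1 + (1/2) powr a) + ?f w * (2 / (a + 1)))"
      by (intro Bochner_Integration.integrable_add integrable_mult_left ball_int intf)
    show "AE w in lborel. norm (indicator unit_ball w *\<^sub>R rho (w :: complex ^ 'n) powr a)
       \<le> norm (indicator unit_ball w * (1 + (1/2) powr a) + ?f w * (2 / (a + 1)))"
    proof (intro AE_I2)
      fix w :: "complex ^ 'n"
      show "norm (indicator unit_ball w *\<^sub>R rho (w :: complex ^ 'n) powr a)
       \<le> norm (indicator unit_ball w * (1 + (1/2) powr a) + ?f w * (2 / (a + 1)))"
      proof (cases "norm w < 1")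
        case True
        have r: "0 < rho w" "rho w \<le> 1" using rho_pos[OF True] by auto
        \<comment> \<open>The identity controls \<open>rho w powr a\<close> only with the factor
          \<open>(norm w)\<^sup>2\<close>, which degenerates at the centre. Where
          \<open>rho w \<le> 1/2\<close> that factor is at least 1/2; elsewhere the power is
          bounded, for either sign of \<open>a\<close>.\<close>
        have "rho w powr a \<le> 1 + (1/2) powr a + (norm w)\<^sup>2 * rho w powr a * 2"
        proof (cases "rho w \<le> 1/2")
          case True
          then have "1 * rho w powr a \<le> ((norm w)\<^sup>2 * 2) * rho w powr a"
            by (intro mult_right_mono) auto
          then show ?thesis by (simp add: mult_ac add_increasing)
        next
          case False
          have "rho w powr a \<le> 1 + (1/2) powr a"
          proof (cases "0 \<le> a")
            case True
            then have "rho w powr a \<le> 1" using r by (intro powr_le1) auto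
            then show ?thesis using powr_ge_zero[of "1/2" a] by linarith
          next
            case neg: False
            then show ?thesis using False powr_mono2'[of a "1/2" "rho w"] by simp
          qed
          moreover have "0 \<le> (norm w)\<^sup>2 * rho w powr a * 2" by simp
          ultimately show ?thesis by linarith
        qed
        moreover have "?f w * (2 / (a + 1)) = (norm w)\<^sup>2 * rho w powr a * 2"
          using True a by (simp add: field_simps)
        moreover have "0 \<le> ?f w * (2 / (a + 1))" using f0[of w] a by simp
        ultimately show ?thesis using True c by (simp add: abs_of_nonneg)
      qed simp
    qed
  qed measurable
qed

text \<open>The cutoff height tends to 0 on both sides. The two integrability hypotheses supply the
  dominating functions, and the factor \<open>a + 1\<close> is the limit of \<open>cut'\<close>
  divided by \<open>x powr a\<close>.\<close>

lemma divergence_identity: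
  fixes u :: "'n::finite \<Rightarrow> complex ^ 'n \<Rightarrow> complex" and F :: "complex ^ 'n \<Rightarrow> complex"
  assumes a: "-1 < a" and u: "\<And>j. holomorphic_ball (u j)" and F: "holomorphic_ball F"
    and int1: "integrable lborel (\<lambda>w. indicator unit_ball w *\<^sub>R ((\<Sum>j\<in>UNIV. dir_deriv (u j) w (axis j 1)) * cnj (F w) * of_real (rho w powr (a + 1))))"
    and int2: "integrable lborel (\<lambda>w. indicator unit_ball w *\<^sub>R ((\<Sum>j\<in>UNIV. u j w * cnj (w $ j)) * cnj (F w) * of_real (rho w powr a)))"
  shows "(LINT w|lborel. indicator unit_ball w *\<^sub>R ((\<Sum>j\<in>UNIV. dir_deriv (u j) w (axis j 1)) * cnj (F w) * of_real (rho w powr (a + 1))))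
    = of_real (a + 1) * (LINT w|lborel. indicator unit_ball w *\<^sub>R ((\<Sum>j\<in>UNIV. u j w * cnj (w $ j)) * cnj (F w) * of_real (rho w powr a)))"
proof -
  let ?e = "\<lambda>k. inverse (real (k + 2))"
  let ?D = "\<lambda>w. (\<Sum>j\<in>UNIV. dir_deriv (u j) w (axis j 1)) * cnj (F w)"
  let ?U = "\<lambda>w. (\<Sum>j\<in>UNIV. u j w * cnj (w $ j)) * cnj (F w)"
  have eq: "(LINT w|lborel. indicator unit_ball w *\<^sub>R (?D w * of_real (cut a (?e k) (rho w))))
     = (LINT w|lborel. indicator unit_ball w *\<^sub>R (?U w * of_real (cut' a (?e k) (rho w))))" for k
    by (rule cutoff.divergence[OF cutoff_cut[OF inverse_nat_bounds a] u F])
  have lim: "(\<lambda>k. LINT w|lborel. indicator unit_ball w *\<^sub>R (H w * of_real (h k (rho w))))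
      \<longlonglongrightarrow> (LINT w|lborel. indicator unit_ball w *\<^sub>R (H w * of_real (c * rho w powr p)))"
    if int: "integrable lborel (\<lambda>w. indicator unit_ball w *\<^sub>R (H w * of_real (rho w powr p)))"
      and [measurable]: "\<And>k. h k \<in> borel_measurable borel"
      and bd: "\<And>k x. 0 < x \<Longrightarrow> \<bar>h k x\<bar> \<le> K * x powr p"
      and conv: "\<And>x. 0 < x \<Longrightarrow> (\<lambda>k. h k x) \<longlonglongrightarrow> c * x powr p"
    for H :: "complex ^ 'n \<Rightarrow> complex" and h :: "nat \<Rightarrow> real \<Rightarrow> real" and c p K
  proof (rule integral_dominated_convergence)
    have m: "(\<lambda>w. indicator unit_ball w *\<^sub>R (H w * of_real (rho w powr p))) \<in> borel_measurable lborel"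
      using int by (rule borel_measurable_integrable)
    \<comment> \<open>Measurability of \<open>H\<close> itself is not given; it is recovered on the
      ball by dividing by the positive function \<open>rho w powr p\<close>.\<close>
    have m2: "(\<lambda>w. indicator unit_ball w *\<^sub>R (H w * of_real (q (rho w)))) \<in> borel_measurable lborel"
      if [measurable]: "q \<in> borel_measurable borel" for q :: "real \<Rightarrow> real"
    proof -
      have eq: "(\<lambda>w. indicator unit_ball w *\<^sub>R (H w * of_real (q (rho w)))) =
         (\<lambda>w. (indicator unit_ball w *\<^sub>R (H w * of_real (rho w powr p))) * of_real (q (rho w) / rho w powr p))"
        using rho_pos by (force simp: indicator_def fun_eq_iff)
      show ?thesis unfolding eq by (rule borel_measurable_times[OF m]) measurable
    qed
    show "(\<lambda>w. indicator unit_ball w *\<^sub>R (H w * of_real (c * rho w powr p))) \<in> borel_measurable lborel"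
      "\<And>k. (\<lambda>w. indicator unit_ball w *\<^sub>R (H w * of_real (h k (rho w)))) \<in> borel_measurable lborel"
      using m2[of "\<lambda>x. c * x powr p"] m2[of "h _"] by auto
    show "integrable lborel (\<lambda>w. norm (indicator unit_ball w *\<^sub>R (H w * of_real (rho w powr p))) * K)"
      using int by (intro integrable_mult_left integrable_norm)
    show "AE w in lborel. (\<lambda>k. indicator unit_ball w *\<^sub>R (H w * of_real (h k (rho w)))) \<longlonglongrightarrow> indicator unit_ball w *\<^sub>R (H w * of_real (c * rho w powr p))"
      using conv[OF rho_pos] by (intro AE_I2) (auto simp: indicator_def simp del: of_real_mult intro!: tendsto_intros)
    show "AE w in lborel. norm (indicator unit_ball w *\<^sub>R (H w * of_real (h k (rho w))))
       \<le> norm (indicator unit_ball w *\<^sub>R (H w * of_real (rho w powr p))) * K" for k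
    proof (intro AE_I2)
      fix w :: "complex ^ 'n"
      have "cmod (H w) * \<bar>h k (rho w)\<bar> \<le> cmod (H w) * (K * rho w powr p)" if "norm w < 1"
        using bd[OF rho_pos[OF that]] by (intro mult_left_mono) auto
      then show "norm (indicator unit_ball w *\<^sub>R (H w * of_real (h k (rho w))))
         \<le> norm (indicator unit_ball w *\<^sub>R (H w * of_real (rho w powr p))) * K"
        by (auto simp: indicator_def norm_mult mult.commute mult.left_commute)
    qed
  qed
  have "(\<lambda>k. LINT w|lborel. indicator unit_ball w *\<^sub>R (?D w * of_real (cut a (?e k) (rho w))))
      \<longlonglongrightarrow> (LINT w|lborel. indicator unit_ball w *\<^sub>R (?D w * of_real (1 * rho w powr (a + 1))))"
    using cut_bounds(1,2)[OF inverse_nat_bounds(1) a] cut_tendsto(1)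
    by (intro lim[OF int1, where K = 1]) auto
  moreover have "(\<lambda>k. LINT w|lborel. indicator unit_ball w *\<^sub>R (?U w * of_real (cut' a (?e k) (rho w))))
      \<longlonglongrightarrow> (LINT w|lborel. indicator unit_ball w *\<^sub>R (?U w * of_real ((a + 1) * rho w powr a)))"
    using cut_bounds(3,4)[OF inverse_nat_bounds(1) a] cut_tendsto(2)
    by (intro lim[OF int2, where K = "3 + a"]) auto
  ultimately have "(LINT w|lborel. indicator unit_ball w *\<^sub>R (?D w * of_real (1 * rho w powr (a + 1))))
     = (LINT w|lborel. indicator unit_ball w *\<^sub>R (?U w * of_real ((a + 1) * rho w powr a)))"
    unfolding eq by (rule LIMSEQ_unique)
  also have "(\<lambda>w. indicator unit_ball w *\<^sub>R (?U w * of_real ((a + 1) * rho w powr a)))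
      = (\<lambda>w. of_real (a + 1) * (indicator unit_ball w *\<^sub>R (?U w * of_real (rho w powr a))))"
    by (auto simp: fun_eq_iff indicator_def)
  also have "integral\<^sup>L lborel \<dots> = of_real (a + 1) * (LINT w|lborel. indicator unit_ball w *\<^sub>R (?U w * of_real (rho w powr a)))"
    by (rule integral_mult_right_zero)
  finally show ?thesis by simp
qed

subsection \<open>The weighted measure\<close>

text \<open>The reciprocal of the normalising constant of \<open>nu a\<close>; the type argument
  carries the dimension.\<close>

definition nu_mass :: "'n::finite itself \<Rightarrow> real \<Rightarrow> real" where
  "nu_mass _ a = (LINT w:(unit_ball :: (complex ^ 'n) set)|lborel. (1 - (norm w)\<^sup>2) powr a)"

lemma space_nu [simp]: "space (nu a) = unit_ball"
  by (simp add: nu_def space_restrict_space)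

lemma sets_nu: "sets (nu a :: (complex ^ 'n) measure) = sets (restrict_space borel unit_ball)"
  by (simp add: nu_def sets_restrict_space)

lemma measurable_id_nu: "(\<lambda>x. x) \<in> measurable (nu a) borel"
  unfolding measurable_cong_sets[OF sets_nu refl]
  by (rule measurable_restrict_space1) simp

lemma continuous_on_measurable_nu:
  assumes "continuous_on unit_ball f"
  shows "f \<in> borel_measurable (nu a)"
  unfolding measurable_cong_sets[OF sets_nu refl]
  by (rule borel_measurable_continuous_on_restrict[OF assms])

lemma holomorphic_measurable_nu: "holomorphic_ball f \<Longrightarrow> f \<in> borel_measurable (nu a)"
  by (intro continuous_on_measurable_nu holomorphic_ball_continuous_on)

lemma nu_eq:
  "nu a = density (restrict_space lborel (unit_ball :: (complex ^ 'n) set)) (\<lambda>z. ennreal (rho z powr a / nu_mass TYPE('n) a))"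
  unfolding nu_def nu_mass_def by simp

context
  fixes a :: real
  assumes a: "-1 < a"
begin

lemma nu_mass_pos: "0 < nu_mass TYPE('n::finite) a"
proof -
  let ?f = "\<lambda>w :: complex ^ 'n. indicator unit_ball w *\<^sub>R rho w powr a"
  have int: "integrable lborel ?f" by (rule integrable_rho_powr[OF a])
  have nn: "0 \<le> ?f w" for w by simp
  have "integral\<^sup>L lborel ?f \<noteq> 0"
  proof
    assume "integral\<^sup>L lborel ?f = 0"
    then have "AE w in lborel. ?f w = 0"
      using integral_nonneg_eq_0_iff_AE[OF int] by simp
    then have "AE w in lborel. w \<notin> (unit_ball :: (complex ^ 'n) set)"
      by eventually_elim (use rho_pos in \<open>force simp: indicator_def\<close>)
    then have "emeasure lborel (unit_ball :: (complex ^ 'n) set) = 0"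
      by (subst (asm) AE_iff_null_sets[symmetric]) auto
    then show False
      using emeasure_lborel_ball_finite[of "0 :: complex ^ 'n" 1] content_ball_pos[of 1 "0 :: complex ^ 'n"]
      by (simp add: measure_def)
  qed
  moreover have "0 \<le> integral\<^sup>L lborel ?f" by (rule Bochner_Integration.integral_nonneg) simp
  ultimately show ?thesis
    unfolding nu_mass_def set_lebesgue_integral_def by linarith
qed

lemma nn_integral_nu:
  fixes f :: "complex ^ 'n \<Rightarrow> ennreal"
  assumes "f \<in> borel_measurable (nu a)"
  shows "(\<integral>\<^sup>+w. f w \<partial>nu a) = (\<integral>\<^sup>+w. ennreal (rho w powr a / nu_mass TYPE('n) a) * f w * indicator unit_ball w \<partial>lborel)"
proof -
  have m: "f \<in> borel_measurable (restrict_space lborel unit_ball)"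
    using assms by (simp add: nu_def)
  show ?thesis
    unfolding nu_eq
    by (subst nn_integral_density) (auto simp: m nn_integral_restrict_space intro!: measurable_restrict_space1)
qed

lemma nu_integral:
  fixes f :: "complex ^ 'n \<Rightarrow> complex"
  assumes "f \<in> borel_measurable (nu a)"
  shows "integrable (nu a) f \<longleftrightarrow> integrable lborel (\<lambda>w. indicator unit_ball w *\<^sub>R (f w * of_real (rho w powr a)))"
    and "(LINT w|nu a. f w) = (LINT w|lborel. indicator unit_ball w *\<^sub>R (f w * of_real (rho w powr a))) / nu_mass TYPE('n) a"
proof -
  let ?c = "nu_mass TYPE('n) a"
  have m: "f \<in> borel_measurable (restrict_space lborel unit_ball)"
    using assms by (simp add: nu_def)
  have c: "0 < ?c" by (rule nu_mass_pos)
  have m2: "(\<lambda>z :: complex ^ 'n. rho z powr a / ?c) \<in> borel_measurable (restrict_space lborel unit_ball)"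
    by (rule measurable_restrict_space1) measurable
  have eq: "(\<lambda>w. indicator unit_ball w *\<^sub>R ((rho w powr a / ?c) *\<^sub>R f w)) 
      = (\<lambda>w. (indicator unit_ball w *\<^sub>R (f w * of_real (rho w powr a))) / of_real ?c)"
    by (auto simp: fun_eq_iff scaleR_conv_of_real[where 'a = complex] field_simps)
  have iff: "integrable lborel (\<lambda>w. g w / of_real ?c) \<longleftrightarrow> integrable lborel g" for g :: "complex ^ 'n \<Rightarrow> complex"
  proof
    assume "integrable lborel (\<lambda>w. g w / of_real ?c)"
    then have "integrable lborel (\<lambda>w. g w / of_real ?c * of_real ?c)" by (rule integrable_mult_left)
    then show "integrable lborel g" using c by simp
  qed (rule integrable_divide)
  show "integrable (nu a) f \<longleftrightarrow> integrable lborel (\<lambda>w. indicator unit_ball w *\<^sub>R (f w * of_real (rho w powr a)))"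
    unfolding nu_eq
    by (subst integrable_density[OF m m2])
       (use c in \<open>auto simp: integrable_restrict_space set_integrable_def eq iff simp del: indicator_scaleR_eq_if scaleR_scaleR\<close>)
  show "(LINT w|nu a. f w) = (LINT w|lborel. indicator unit_ball w *\<^sub>R (f w * of_real (rho w powr a))) / nu_mass TYPE('n) a"
    unfolding nu_eq
    by (subst integral_density[OF m m2])
       (use c in \<open>auto simp: integral_restrict_space set_lebesgue_integral_def eq simp del: indicator_scaleR_eq_if scaleR_scaleR\<close>)
qed

lemma emeasure_nu: "emeasure (nu a) (unit_ball :: (complex ^ 'n) set) = 1"
proof -
  have "emeasure (nu a) (space (nu a :: (complex ^ 'n) measure)) = (\<integral>\<^sup>+w. 1 \<partial>(nu a :: (complex ^ 'n) measure))"
    by simp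
  also have "\<dots> = (\<integral>\<^sup>+w. ennreal (rho w powr a / nu_mass TYPE('n) a) * indicator unit_ball w \<partial>(lborel :: (complex ^ 'n) measure))"
    by (subst nn_integral_nu) auto
  also have "\<dots> = (\<integral>\<^sup>+w. ennreal (indicator unit_ball w *\<^sub>R rho w powr a / nu_mass TYPE('n) a) \<partial>(lborel :: (complex ^ 'n) measure))"
    by (intro nn_integral_cong) (auto simp: indicator_def)
  also have "\<dots> = ennreal (LINT w|(lborel :: (complex ^ 'n) measure). indicator unit_ball w *\<^sub>R rho w powr a / nu_mass TYPE('n) a)"
    using nu_mass_pos[where 'n = 'n] integrable_rho_powr[OF a]
    by (intro nn_integral_eq_integral integrable_divide AE_I2) (auto simp: less_imp_le simp del: indicator_scaleR_eq_if)
  also have "(LINT w|(lborel :: (complex ^ 'n) measure). indicator unit_ball w *\<^sub>R rho w powr a / nu_mass TYPE('n) a) = 1"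
    using nu_mass_pos[where 'n = 'n]
    by (subst integral_divide_zero) (simp add: nu_mass_def set_lebesgue_integral_def del: indicator_scaleR_eq_if)
  finally show ?thesis by simp
qed

lemma measure_nu: "measure (nu a) (unit_ball :: (complex ^ 'n) set) = 1"
  by (simp add: measure_def emeasure_nu)

lemma finite_measure_nu: "finite_measure (nu a :: (complex ^ 'n) measure)"
  by (rule finite_measureI) (simp add: emeasure_nu)

lemma sigma_finite_nu: "sigma_finite_measure (nu a :: (complex ^ 'n) measure)"
  using finite_measure_nu by (rule finite_measure.axioms(1))

lemma integral_nu_const: "(LINT w :: complex ^ 'n|nu a. c) = (c :: 'b :: {banach, second_countable_topology})"
  by (simp add: measure_nu)

lemma integrable_nu_bounded:
  fixes f :: "complex ^ 'n \<Rightarrow> 'b :: {banach, second_countable_topology}"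
  assumes "f \<in> borel_measurable (nu a)" "\<And>w. norm w < 1 \<Longrightarrow> norm (f w) \<le> B"
  shows "integrable (nu a) f"
proof -
  interpret finite_measure "nu a :: (complex ^ 'n) measure" by (rule finite_measure_nu)
  show ?thesis
    by (rule integrable_const_bound[where B = B]) (use assms in \<open>auto intro!: AE_I2\<close>)
qed

lemma integrable_nu_mult_bounded:
  fixes f g :: "complex ^ 'n \<Rightarrow> complex"
  assumes "integrable (nu a) f" "g \<in> borel_measurable (nu a)" "\<And>w. norm w < 1 \<Longrightarrow> norm (g w) \<le> B"
  shows "integrable (nu a) (\<lambda>w. f w * g w)"
proof (rule Bochner_Integration.integrable_bound)
  show "integrable (nu a) (\<lambda>w. norm (f w) * B)" using assms(1) by (intro integrable_mult_left integrable_norm)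
  show "(\<lambda>w. f w * g w) \<in> borel_measurable (nu a)" using assms by auto
  show "AE w in nu a. norm (f w * g w) \<le> norm (norm (f w) * B)"
    using assms(3) by (intro AE_I2) (auto simp: norm_mult intro!: mult_left_mono intro: order_trans[OF _ abs_ge_self])
qed

text \<open>The extra factor \<open>rho w\<close> on the left turns the weight
  \<open>rho w powr a\<close> into \<open>rho w powr (a + 1)\<close>. The parameters
  \<open>D\<close> and \<open>U\<close> let callers supply closed forms valid only inside the
  ball.\<close>

lemma nu_divergence:
  fixes u :: "'n::finite \<Rightarrow> complex ^ 'n \<Rightarrow> complex" and F :: "complex ^ 'n \<Rightarrow> complex"
  assumes u: "\<And>j. holomorphic_ball (u j)" and F: "holomorphic_ball F"
    and D: "\<And>w. norm w < 1 \<Longrightarrow> (\<Sum>j\<in>UNIV. dir_deriv (u j) w (axis j 1)) = D w"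
    and U: "\<And>w. norm w < 1 \<Longrightarrow> (\<Sum>j\<in>UNIV. u j w * cnj (w $ j)) = U w"
    and int1: "integrable (nu a) (\<lambda>w. D w * cnj (F w) * of_real (rho w))"
    and int2: "integrable (nu a) (\<lambda>w. U w * cnj (F w))"
  shows "(LINT w|nu a. D w * cnj (F w) * of_real (rho w)) = of_real (a + 1) * (LINT w|nu a. U w * cnj (F w))"
proof -
  let ?c = "nu_mass TYPE('n) a"
  let ?D' = "\<lambda>w. (\<Sum>j\<in>UNIV. dir_deriv (u j) w (axis j 1))"
  let ?U' = "\<lambda>w. (\<Sum>j\<in>UNIV. u j w * cnj (w $ j))"
  have eq1: "(\<lambda>w. indicator unit_ball w *\<^sub>R (D w * cnj (F w) * of_real (rho w) * of_real (rho w powr a))) =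
      (\<lambda>w. indicator unit_ball w *\<^sub>R (?D' w * cnj (F w) * of_real (rho w powr (a + 1))))"
  proof
    show "indicator unit_ball w *\<^sub>R (D w * cnj (F w) * of_real (rho w) * of_real (rho w powr a)) =
       indicator unit_ball w *\<^sub>R (?D' w * cnj (F w) * of_real (rho w powr (a + 1)))" for w
    proof (cases "norm w < 1")
      case True
      have "rho w powr (a + 1) = rho w * rho w powr a"
        using rho_pos[OF True] powr_add[of "rho w" 1 a] by (simp add: add.commute)
      then have "of_real (rho w powr (a + 1)) = (of_real (rho w) * of_real (rho w powr a) :: complex)"
        by (simp only: of_real_mult)
      then show ?thesis using True D[OF True] by (simp only: mult.assoc)
    qed simp
  qed
  have eq2: "(\<lambda>w. indicator unit_ball w *\<^sub>R (U w * cnj (F w) * of_real (rho w powr a))) =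
      (\<lambda>w. indicator unit_ball w *\<^sub>R (?U' w * cnj (F w) * of_real (rho w powr a)))"
    using U by (auto simp: fun_eq_iff indicator_def)
  have m: "(\<lambda>w. D w * cnj (F w) * of_real (rho w)) \<in> borel_measurable (nu a)"
     "(\<lambda>w. U w * cnj (F w)) \<in> borel_measurable (nu a)"
    using int1 int2 by auto
  note i1 = int1[unfolded nu_integral(1)[OF m(1)] eq1] and i2 = int2[unfolded nu_integral(1)[OF m(2)] eq2]
  have "(LINT w|nu a. D w * cnj (F w) * of_real (rho w))
     = (LINT w|lborel. indicator unit_ball w *\<^sub>R (?D' w * cnj (F w) * of_real (rho w powr (a + 1)))) / ?c"
    unfolding nu_integral(2)[OF m(1)] eq1 ..
  also have "\<dots> = of_real (a + 1) * ((LINT w|lborel. indicator unit_ball w *\<^sub>R (?U' w * cnj (F w) * of_real (rho w powr a))) / ?c)"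
    unfolding divergence_identity[OF a u F i1 i2] by simp
  also have "\<dots> = of_real (a + 1) * (LINT w|nu a. U w * cnj (F w))"
    unfolding nu_integral(2)[OF m(2)] eq2 ..
  finally show ?thesis .
qed

end

section \<open>Radial identities and the ratio between consecutive weights\<close>

lemma sum_component_cnj: "(\<Sum>j\<in>UNIV. w $ j * cnj (w $ j)) = of_real ((norm w)\<^sup>2)"
  using herm_self[of w] by (simp add: herm_def)

lemma dir_deriv_component: "dir_deriv (\<lambda>w. w $ j) w v = v $ j"
  by (rule dir_deriv_eqI[OF has_derivative_component])

lemma divergence_coordinate_mult:
  fixes f :: "complex ^ 'n \<Rightarrow> complex"
  assumes "holomorphic_ball f" "norm w < 1"
  shows "(\<Sum>j\<in>UNIV. dir_deriv (\<lambda>w. w $ j * f w) w (axis j 1)) = of_nat CARD('n) * f w + dir_deriv f w w"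
  using assms
  by (simp add: dir_deriv_mult holomorphic_ball_component dir_deriv_component sum.distrib dir_deriv_axis_sum)

text \<open>For the field with components \<open>w $ j * f w\<close> the divergence is
  \<open>n f + R f\<close> and the pairing with \<open>w\<close> is
  \<open>f |w|^2 = f - rho f\<close>. Moving the \<open>rho f\<close> term to the left adds
  \<open>a + 1\<close> to \<open>n\<close>, which produces the critical exponent.\<close>

lemma nu_radial:
  fixes f F :: "complex ^ 'n \<Rightarrow> complex"
  assumes a: "-1 < a" and f: "holomorphic_ball f" and F: "holomorphic_ball F"
    and int1: "integrable (nu a) (\<lambda>w. f w * cnj (F w))"
    and int2: "integrable (nu a) (\<lambda>w. dir_deriv f w w * cnj (F w) * of_real (rho w))"
  shows "(LINT w|nu a. (of_real (real CARD('n) + 1 + a) * f w + dir_deriv f w w) * cnj (F w) * of_real (rho w))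
     = of_real (a + 1) * (LINT w|nu a. f w * cnj (F w))"
proof -
  have [measurable]: "(\<lambda>w. f w * cnj (F w)) \<in> borel_measurable (nu a)" using int1 by auto
  have meas_rho: "(\<lambda>w :: complex ^ 'n. of_real (rho w) :: complex) \<in> borel_measurable (nu a)"
    by (intro continuous_on_measurable_nu continuous_intros)
  have int3: "integrable (nu a) (\<lambda>w. f w * cnj (F w) * of_real (rho w))"
  proof (rule integrable_nu_mult_bounded[OF a int1 meas_rho])
    show "norm (of_real (rho w) :: complex) \<le> 1" if "norm w < 1" for w :: "complex ^ 'n"
      unfolding norm_of_real using rho_pos[OF that] by simp
  qed
  have "(LINT w|nu a. (of_nat CARD('n) * f w + dir_deriv f w w) * cnj (F w) * of_real (rho w))
     = of_real (a + 1) * (LINT w|nu a. (f w * of_real ((norm w)\<^sup>2)) * cnj (F w))"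
  proof (rule nu_divergence[OF a _ F])
    show "holomorphic_ball (\<lambda>w. w $ j * f w)" for j by (intro holomorphic_ball_mult holomorphic_ball_component f)
    show "(\<Sum>j\<in>UNIV. dir_deriv (\<lambda>w. w $ j * f w) w (axis j 1)) = of_nat CARD('n) * f w + dir_deriv f w w" if "norm w < 1" for w
      by (rule divergence_coordinate_mult[OF f that])
    show "(\<Sum>j\<in>UNIV. w $ j * f w * cnj (w $ j)) = f w * of_real ((norm w)\<^sup>2)" for w
      unfolding sum_component_cnj[symmetric] by (simp add: sum_distrib_left mult_ac)
    have "integrable (nu a) (\<lambda>w. of_nat CARD('n) * (f w * cnj (F w) * of_real (rho w)) + dir_deriv f w w * cnj (F w) * of_real (rho w))"
      by (intro Bochner_Integration.integrable_add integrable_mult_right int3 int2)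
    then show "integrable (nu a) (\<lambda>w. (of_nat CARD('n) * f w + dir_deriv f w w) * cnj (F w) * of_real (rho w))"
      by (simp add: algebra_simps)
    have "integrable (nu a) (\<lambda>w. f w * cnj (F w) - f w * cnj (F w) * of_real (rho w))"
      by (intro Bochner_Integration.integrable_diff int1 int3)
    then show "integrable (nu a) (\<lambda>w. (f w * of_real ((norm w)\<^sup>2)) * cnj (F w))"
      by (simp add: algebra_simps)
  qed
  also have "(LINT w|nu a. (f w * of_real ((norm w)\<^sup>2)) * cnj (F w)) =
     (LINT w|nu a. f w * cnj (F w) - f w * cnj (F w) * of_real (rho w))"
    by (rule Bochner_Integration.integral_cong) (auto simp: algebra_simps)
  also have "\<dots> = (LINT w|nu a. f w * cnj (F w)) - (LINT w|nu a. f w * cnj (F w) * of_real (rho w))"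
    by (rule Bochner_Integration.integral_diff[OF int1 int3])
  also have "(LINT w|nu a. (of_nat CARD('n) * f w + dir_deriv f w w) * cnj (F w) * of_real (rho w))
    = (LINT w|nu a. of_nat CARD('n) * (f w * cnj (F w) * of_real (rho w)) + dir_deriv f w w * cnj (F w) * of_real (rho w))"
    by (rule Bochner_Integration.integral_cong) (auto simp: algebra_simps)
  also have "\<dots> = of_nat CARD('n) * (LINT w|nu a. f w * cnj (F w) * of_real (rho w)) + (LINT w|nu a. dir_deriv f w w * cnj (F w) * of_real (rho w))"
    by (subst Bochner_Integration.integral_add) (use int2 int3 in auto)
  finally have *: "of_nat CARD('n) * (LINT w|nu a. f w * cnj (F w) * of_real (rho w)) + (LINT w|nu a. dir_deriv f w w * cnj (F w) * of_real (rho w))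
    = of_real (a + 1) * ((LINT w|nu a. f w * cnj (F w)) - (LINT w|nu a. f w * cnj (F w) * of_real (rho w)))" .
  have "(LINT w|nu a. (of_real (real CARD('n) + 1 + a) * f w + dir_deriv f w w) * cnj (F w) * of_real (rho w))
    = (LINT w|nu a. of_real (real CARD('n) + 1 + a) * (f w * cnj (F w) * of_real (rho w)) + dir_deriv f w w * cnj (F w) * of_real (rho w))"
    by (rule Bochner_Integration.integral_cong) (auto simp: algebra_simps)
  also have "\<dots> = of_real (real CARD('n) + 1 + a) * (LINT w|nu a. f w * cnj (F w) * of_real (rho w)) + (LINT w|nu a. dir_deriv f w w * cnj (F w) * of_real (rho w))"
    by (subst Bochner_Integration.integral_add) (use int2 int3 in auto)
  also have "\<dots> = of_real (a + 1) * (LINT w|nu a. f w * cnj (F w))"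
    using * by (simp add: algebra_simps)
  finally show ?thesis .
qed

text \<open>The case \<open>f = F = 1\<close> of the radial identity. It fixes the ratio of the
  masses of the weights \<open>a\<close> and \<open>a + 1\<close> without evaluating either by Beta
  functions.\<close>

lemma integral_rho_nu:
  assumes a: "-1 < a"
  shows "(LINT w :: complex ^ 'n|nu a. complex_of_real (rho w)) = of_real ((a + 1) / (real CARD('n) + 1 + a))"
proof -
  interpret finite_measure "nu a :: (complex ^ 'n) measure" by (rule finite_measure_nu[OF a])
  have d: "dir_deriv (\<lambda>_. 1) w w = 0" for w :: "complex ^ 'n"
    by (rule dir_deriv_eqI) simp
  have "(LINT w :: complex ^ 'n|nu a. (of_real (real CARD('n) + 1 + a) * 1 + dir_deriv (\<lambda>_. 1) w w) * cnj 1 * of_real (rho w))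
     = of_real (a + 1) * (LINT w :: complex ^ 'n|nu a. 1 * cnj 1)"
    by (rule nu_radial[OF a]) (auto simp: d holomorphic_ball_const)
  then have "of_real (real CARD('n) + 1 + a) * (LINT w :: complex ^ 'n|nu a. complex_of_real (rho w)) = complex_of_real (a + 1)"
    by (simp add: d measure_nu[OF a])
  moreover have "of_real (real CARD('n) + 1 + a) \<noteq> (0 :: complex)"
    using a of_nat_0_le_iff[of "CARD('n)"] by (simp only: of_real_eq_0_iff)
  ultimately have "(LINT w :: complex ^ 'n|nu a. complex_of_real (rho w)) = complex_of_real (a + 1) / of_real (real CARD('n) + 1 + a)"
    by (simp add: field_simps)
  then show ?thesis by (simp only: of_real_divide)
qed

text \<open>The measures differ by the density \<open>rho\<close> and a constant; testing with the
  function 1 identifies the constant through \<open>integral_rho_nu\<close>.\<close>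

lemma nu_shift:
  fixes f :: "complex ^ 'n \<Rightarrow> complex"
  assumes a: "-1 < a" and f: "f \<in> borel_measurable (nu a)"
  shows "integrable (nu (a + 1)) f \<longleftrightarrow> integrable (nu a) (\<lambda>w. f w * of_real (rho w))"
    and "of_real (a + 1) * (LINT w|nu (a + 1). f w) = of_real (real CARD('n) + 1 + a) * (LINT w|nu a. f w * of_real (rho w))"
proof -
  let ?c = "\<lambda>a. nu_mass TYPE('n) a"
  have a1: "-1 < a + 1" using a by simp
  have eq: "(\<lambda>w. indicator unit_ball w *\<^sub>R (g w * of_real (rho w powr (a + 1)))) = 
      (\<lambda>w. indicator unit_ball w *\<^sub>R (g w * of_real (rho w) * of_real (rho w powr a)))" for g :: "complex ^ 'n \<Rightarrow> complex"
  proof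
    show "indicator unit_ball w *\<^sub>R (g w * of_real (rho w powr (a + 1))) = 
       indicator unit_ball w *\<^sub>R (g w * of_real (rho w) * of_real (rho w powr a))" for w
    proof (cases "norm w < 1")
      case True
      have "rho w powr (a + 1) = rho w * rho w powr a"
        using rho_pos[OF True] powr_add[of "rho w" 1 a] by (simp add: add.commute)
      then have "of_real (rho w powr (a + 1)) = (of_real (rho w) * of_real (rho w powr a) :: complex)"
        by (simp only: of_real_mult)
      then show ?thesis by (simp only: mult.assoc)
    qed simp
  qed
  have m1: "g \<in> borel_measurable (nu (a + 1))" if "g \<in> borel_measurable (nu a)" for g :: "complex ^ 'n \<Rightarrow> complex"
    using that by (simp add: measurable_cong_sets[OF sets_nu refl])
  have meas_rho: "(\<lambda>w :: complex ^ 'n. of_real (rho w) :: complex) \<in> borel_measurable (nu a)"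
    by (intro continuous_on_measurable_nu continuous_intros)
  have m2: "(\<lambda>w. g w * of_real (rho w)) \<in> borel_measurable (nu a)" if "g \<in> borel_measurable (nu a)" for g :: "complex ^ 'n \<Rightarrow> complex"
    using that meas_rho by (rule borel_measurable_times)
  show "integrable (nu (a + 1)) f \<longleftrightarrow> integrable (nu a) (\<lambda>w. f w * of_real (rho w))"
    unfolding nu_integral(1)[OF a1 m1[OF f]] nu_integral(1)[OF a m2[OF f]] eq ..
  have *: "(LINT w|nu (a + 1). g w) = (LINT w|nu a. g w * of_real (rho w)) * of_real (?c a / ?c (a + 1))"
    if "g \<in> borel_measurable (nu a)" for g :: "complex ^ 'n \<Rightarrow> complex"
    unfolding nu_integral(2)[OF a1 m1[OF that]] nu_integral(2)[OF a m2[OF that]] eq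
    using nu_mass_pos[OF a, where 'n = 'n] by simp
  have "1 = of_real ((a + 1) / (real CARD('n) + 1 + a)) * complex_of_real (?c a / ?c (a + 1))"
    using *[of "\<lambda>_. 1"] integral_rho_nu[OF a, where 'n = 'n] by (simp add: measure_nu[OF a1])
  then have "(a + 1) / (real CARD('n) + 1 + a) * (?c a / ?c (a + 1)) = 1"
    by (metis of_real_eq_1_iff of_real_mult)
  moreover have "0 < real CARD('n) + 1 + a" using a of_nat_0_le_iff[of "CARD('n)"] by linarith
  ultimately have r: "(a + 1) * (?c a / ?c (a + 1)) = real CARD('n) + 1 + a"
    by (simp only: times_divide_eq_left divide_eq_1_iff)
  show "of_real (a + 1) * (LINT w|nu (a + 1). f w) = of_real (real CARD('n) + 1 + a) * (LINT w|nu a. f w * of_real (rho w))"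
    unfolding *[OF f] r[symmetric] by simp
qed

subsection \<open>The reproducing formula\<close>

text \<open>By the mean value theorem the bound on \<open>f'\<close> is a Lipschitz bound on
  \<open>f\<close>, so the remainder quotients are dominated by \<open>2 * B\<close>. The derivative
  is measurable as a limit of quotients, taken from an index on at which the shifted parameter lies
  in the ball.\<close>

lemma has_derivative_integral_dominated:
  fixes f :: "'p::euclidean_space \<Rightarrow> 'a \<Rightarrow> 'b::{banach, second_countable_topology}"
  assumes r: "0 < r"
    and der: "\<And>q x. q \<in> ball p r \<Longrightarrow> x \<in> space M \<Longrightarrow> ((\<lambda>q. f q x) has_derivative f' q x) (at q)"
    and bd: "\<And>q x v. q \<in> ball p r \<Longrightarrow> x \<in> space M \<Longrightarrow> norm (f' q x v) \<le> B x * norm v"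
    and B: "integrable M B"
    and int: "\<And>q. q \<in> ball p r \<Longrightarrow> integrable M (f q)"
  shows "((\<lambda>q. LINT x|M. f q x) has_derivative (\<lambda>v. LINT x|M. f' p x v)) (at p)"
proof -
  have p: "p \<in> ball p r" using r by simp
  have lip: "norm (f q x - f p x) \<le> B x * norm (q - p)" if "q \<in> ball p r" "x \<in> space M" for q x
  proof (rule differentiable_bound[of "ball p r" "\<lambda>q. f q x" "\<lambda>q. f' q x"])
    show "((\<lambda>q. f q x) has_derivative f' y x) (at y within ball p r)" if "y \<in> ball p r" for y
      using der[OF that \<open>x \<in> space M\<close>] by (rule has_derivative_at_withinI)
    show "onorm (f' y x) \<le> B x" if "y \<in> ball p r" for y
      by (rule onorm_le) (rule bd[OF that \<open>x \<in> space M\<close>])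
  qed (use that p in auto)
  have lin: "linear (f' p x)" if "x \<in> space M" for x
    using has_derivative_linear[OF der[OF p that]] .
  have int': "integrable M (\<lambda>x. f' p x v)" for v
  proof -
    have "(\<lambda>k. inverse (real (Suc k)) *\<^sub>R v) \<longlonglongrightarrow> 0"
      using tendsto_scaleR[OF LIMSEQ_inverse_real_of_nat tendsto_const, of v] by simp
    from tendsto_add[OF tendsto_const[of p] this]
    have "(\<lambda>k. p + inverse (real (Suc k)) *\<^sub>R v) \<longlonglongrightarrow> p" by simp
    then have "\<forall>\<^sub>F k in sequentially. p + inverse (real (Suc k)) *\<^sub>R v \<in> ball p r"
      by (rule topological_tendstoD) (use r in auto)
    then obtain K where K: "\<And>k. k \<ge> K \<Longrightarrow> p + inverse (real (Suc k)) *\<^sub>R v \<in> ball p r"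
      by (auto simp: eventually_sequentially)
    have "(\<lambda>x. f' p x v) \<in> borel_measurable M"
    proof (rule borel_measurable_LIMSEQ_metric)
      show "(\<lambda>x. real (Suc (k + K)) *\<^sub>R (f (p + inverse (real (Suc (k + K))) *\<^sub>R v) x - f p x)) \<in> borel_measurable M" for k
        using int[OF K[of "k + K"]] int[OF p] by (intro borel_measurable_scaleR borel_measurable_diff) auto
      show "(\<lambda>k. real (Suc (k + K)) *\<^sub>R (f (p + inverse (real (Suc (k + K))) *\<^sub>R v) x - f p x)) \<longlonglongrightarrow> f' p x v"
        if "x \<in> space M" for x
        using has_derivative_imp_quotient_tendsto[OF der[OF p that], of v]
        by (rule LIMSEQ_ignore_initial_segment)
    qed
    then show ?thesis
    proof (rule Bochner_Integration.integrable_bound[rotated])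
      show "integrable M (\<lambda>x. B x * norm v)" using B by simp
      show "AE x in M. norm (f' p x v) \<le> norm (B x * norm v)"
        using bd[OF p] by (intro AE_I2) (auto intro: order_trans[OF _ abs_ge_self])
    qed
  qed
  have bdlin: "bounded_linear (\<lambda>v. LINT x|M. f' p x v)"
  proof (rule bounded_linear_intro[where K = "LINT x|M. B x"])
    fix v w :: 'p and t :: real
    have "(LINT x|M. f' p x (v + w)) = (LINT x|M. f' p x v + f' p x w)"
      by (intro Bochner_Integration.integral_cong refl linear_add[OF lin])
    then show "(LINT x|M. f' p x (v + w)) = (LINT x|M. f' p x v) + (LINT x|M. f' p x w)"
      using int' by simp
    have "(LINT x|M. f' p x (t *\<^sub>R v)) = (LINT x|M. t *\<^sub>R f' p x v)"
      by (intro Bochner_Integration.integral_cong refl linear_scale[OF lin])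
    then show "(LINT x|M. f' p x (t *\<^sub>R v)) = t *\<^sub>R (LINT x|M. f' p x v)"
      by simp
    have "norm (LINT x|M. f' p x v) \<le> (LINT x|M. B x * norm v)"
      using int' B bd[OF p] by (intro order_trans[OF Bochner_Integration.integral_norm_bound] Bochner_Integration.integral_mono) auto
    then show "norm (LINT x|M. f' p x v) \<le> norm v * (LINT x|M. B x)" by (simp add: mult.commute)
  qed
  show ?thesis
    unfolding has_derivative_at
  proof (intro conjI bdlin, unfold tendsto_at_iff_sequentially, intro allI impI)
    fix X :: "nat \<Rightarrow> 'p"
    assume X0: "\<forall>i. X i \<in> UNIV - {0}" and X: "X \<longlonglongrightarrow> 0"
    have "(\<lambda>k. p + X k) \<longlonglongrightarrow> p" using tendsto_add[OF tendsto_const[of p] X] by simp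
    then have "\<forall>\<^sub>F k in sequentially. p + X k \<in> ball p r"
      by (rule topological_tendstoD) (use r in auto)
    then obtain K where K: "\<And>k. k \<ge> K \<Longrightarrow> p + X k \<in> ball p r"
      by (auto simp: eventually_sequentially)
    let ?Y = "\<lambda>k. X (k + K)"
    have Y: "p + ?Y k \<in> ball p r" "?Y k \<noteq> 0" for k using K X0 by auto
    have Y0: "?Y \<longlonglongrightarrow> 0" using X by (rule LIMSEQ_ignore_initial_segment)
    let ?R = "\<lambda>k x. norm (f (p + ?Y k) x - f p x - f' p x (?Y k)) / norm (?Y k)"
    have intR: "integrable M (?R k)" for k
      using int[OF Y(1)] int[OF p] int' by auto
    have "(\<lambda>k. LINT x|M. ?R k x) \<longlonglongrightarrow> (LINT x|M. 0)"
    proof (rule integral_dominated_convergence)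
      show "integrable M (\<lambda>x. 2 * B x)" using B by simp
      show "?R k \<in> borel_measurable M" for k using intR by auto
      show "AE x in M. (\<lambda>k. ?R k x) \<longlonglongrightarrow> 0"
      proof (intro AE_I2)
        fix x assume "x \<in> space M"
        then have "((\<lambda>h. norm (f (p + h) x - f p x - f' p x h) / norm h) \<longlongrightarrow> 0) (at 0)"
          using der[OF p] unfolding has_derivative_at by blast
        moreover have "filterlim ?Y (at 0) sequentially"
          using Y0 Y(2) by (auto simp: filterlim_at)
        ultimately show "(\<lambda>k. ?R k x) \<longlonglongrightarrow> 0" by (rule filterlim_compose)
      qed
      show "AE x in M. norm (?R k x) \<le> 2 * B x" for k
      proof (intro AE_I2)
        fix x assume x: "x \<in> space M"
        have "norm (f (p + ?Y k) x - f p x - f' p x (?Y k)) \<le> norm (f (p + ?Y k) x - f p x) + norm (f' p x (?Y k))"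
          by (rule norm_triangle_ineq4)
        also have "\<dots> \<le> B x * norm (?Y k) + B x * norm (?Y k)"
          using lip[OF Y(1) x, of k] bd[OF p x, of "?Y k"] by (intro add_mono) auto
        finally show "norm (?R k x) \<le> 2 * B x"
          using Y(2)[of k] by (simp add: field_simps)
      qed
    qed simp
    then have lim: "(\<lambda>k. LINT x|M. ?R k x) \<longlonglongrightarrow> 0" by simp
    have le: "norm ((LINT x|M. f (p + ?Y k) x) - (LINT x|M. f p x) - (LINT x|M. f' p x (?Y k))) / norm (?Y k)
        \<le> (LINT x|M. ?R k x)" for k
    proof -
      have "(LINT x|M. f (p + ?Y k) x) - (LINT x|M. f p x) - (LINT x|M. f' p x (?Y k)) = (LINT x|M. f (p + ?Y k) x - f p x - f' p x (?Y k))"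
        using int[OF Y(1)] int[OF p] int' by simp
      then show ?thesis
        using Y(2)[of k] by (auto intro!: divide_right_mono Bochner_Integration.integral_norm_bound)
    qed
    have "(\<lambda>k. norm ((LINT x|M. f (p + ?Y k) x) - (LINT x|M. f p x) - (LINT x|M. f' p x (?Y k))) / norm (?Y k)) \<longlonglongrightarrow> 0"
      by (rule Lim_null_comparison[OF _ lim]) (use le in auto)
    then have "(\<lambda>k. ((\<lambda>h. norm ((LINT x|M. f (p + h) x) - (LINT x|M. f p x) - (LINT x|M. f' p x h)) / norm h) \<circ> X) (k + K)) \<longlonglongrightarrow> 0"
      by simp
    then show "((\<lambda>h. norm ((LINT x|M. f (p + h) x) - (LINT x|M. f p x) - (LINT x|M. f' p x h)) / norm h) \<circ> X) \<longlonglongrightarrow> 0"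
      by (rule LIMSEQ_offset)
  qed
qed

corollary has_vector_derivative_integral_dominated:
  fixes f :: "real \<Rightarrow> 'a \<Rightarrow> 'b::{banach, second_countable_topology}"
  assumes r: "0 < r"
    and der: "\<And>q x. \<bar>q - p\<bar> < r \<Longrightarrow> x \<in> space M \<Longrightarrow> ((\<lambda>q. f q x) has_vector_derivative f' q x) (at q)"
    and bd: "\<And>q x. \<bar>q - p\<bar> < r \<Longrightarrow> x \<in> space M \<Longrightarrow> norm (f' q x) \<le> B x"
    and B: "integrable M B"
    and int: "\<And>q. \<bar>q - p\<bar> < r \<Longrightarrow> integrable M (f q)"
  shows "((\<lambda>q. LINT x|M. f q x) has_vector_derivative (LINT x|M. f' p x)) (at p)"
proof -
  have "((\<lambda>q. LINT x|M. f q x) has_derivative (\<lambda>v. LINT x|M. v *\<^sub>R f' p x)) (at p)"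
  proof (rule has_derivative_integral_dominated[OF r _ _ B])
    show "norm (v *\<^sub>R f' q x) \<le> B x * norm v" if "q \<in> ball p r" "x \<in> space M" for q x v
      using mult_left_mono[OF bd[of q x], of "\<bar>v\<bar>"] that by (simp add: dist_real_def abs_minus_commute mult.commute)
  qed (use der int in \<open>auto simp: dist_real_def abs_minus_commute has_vector_derivative_def\<close>)
  then show ?thesis by (simp add: has_vector_derivative_def)
qed

section \<open>Mean values of kernels and the passage from weight \<open>a\<close> to
  \<open>a + 1\<close>\<close>

lemma measurable_kern_nu: "norm z < 1 \<Longrightarrow> kern s z \<in> borel_measurable (nu a)"
  by (intro holomorphic_measurable_nu holomorphic_ball_kern)

lemma cmod_kern_bound:
  fixes z :: "complex ^ 'n"
  assumes "norm z < 1"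
  obtains B where "0 \<le> B" "\<And>w. norm w \<le> 1 \<Longrightarrow> cmod (kern s z w) \<le> B"
proof (rule that[of "(1 - norm z) powr (- \<bar>s\<bar>) + 2 powr \<bar>s\<bar>"])
  fix w :: "complex ^ 'n" assume w: "norm w \<le> 1"
  show "cmod (kern s z w) \<le> (1 - norm z) powr (- \<bar>s\<bar>) + 2 powr \<bar>s\<bar>"
  proof (cases "0 \<le> s")
    case True
    then show ?thesis using cmod_kern_le[OF assms w True] by (simp add: add_increasing2)
  next
    case False
    have "cmod (1 - herm w z) powr (- s) \<le> 2 powr (- s)"
      using False cmod_one_minus_herm_le[of z w] assms w by (intro powr_mono2) auto
    then show ?thesis using False unfolding cmod_kern by (simp add: add_increasing)
  qed
qed simp

lemma kern_scaleR: "kern s (t *\<^sub>R z) w = kern s z (t *\<^sub>R w)"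
  by (simp add: kern_def herm_scaleR_left herm_scaleR_right)

lemma has_vector_derivative_kern_scaleR:
  assumes "norm z * norm (t *\<^sub>R w) < 1"
  shows "((\<lambda>t. kern s z (t *\<^sub>R w)) has_vector_derivative (of_real s * herm w z * kern (s + 1) z (t *\<^sub>R w))) (at t)"
proof -
  have "((\<lambda>t. t *\<^sub>R w) has_derivative (\<lambda>t. t *\<^sub>R w)) (at t)"
    by (auto intro!: derivative_eq_intros)
  from has_derivative_compose[OF this has_derivative_kern[OF assms, of s]] show ?thesis
    by (simp add: has_vector_derivative_def herm_scaleR_left scaleR_conv_of_real[where 'a = complex] mult_ac)
qed

context
  fixes a :: real
  assumes a: "-1 < a"
begin

text \<open>The constant field \<open>z\<close> has divergence 0, and its pairing with
  \<open>w\<close> is \<open>cnj (herm w z)\<close>.\<close>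

lemma integral_herm_mult_eq_0:
  fixes F :: "complex ^ 'n \<Rightarrow> complex"
  assumes F: "holomorphic_ball F" and B: "\<And>w. norm w < 1 \<Longrightarrow> cmod (F w) \<le> B"
  shows "(LINT w|nu a. herm w z * F w) = 0"
proof -
  have [measurable]: "F \<in> borel_measurable (nu a)" by (rule holomorphic_measurable_nu[OF F])
  have hm: "(\<lambda>w. herm w z) \<in> borel_measurable (nu a)"
    by (rule measurable_compose[OF measurable_id_nu measurable_herm1])
  have int: "integrable (nu a) (\<lambda>w. herm w z * F w)"
  proof (rule integrable_nu_bounded[OF a])
    show "(\<lambda>w. herm w z * F w) \<in> borel_measurable (nu a)" using hm by measurable
    show "norm (herm w z * F w) \<le> norm z * B" if "norm w < 1" for w
      unfolding norm_mult using cmod_herm_le[of w z] B[OF that] that mult_right_mono[of "norm w" 1 "norm z"]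
      by (intro mult_mono) auto
  qed
  have "(LINT w|nu a. 0 * cnj (F w) * of_real (rho w)) = of_real (a + 1) * (LINT w|nu a. cnj (herm w z) * cnj (F w))"
  proof (rule nu_divergence[OF a _ F])
    show "holomorphic_ball (\<lambda>w. z $ j)" for j by (rule holomorphic_ball_const)
    show "(\<Sum>j\<in>UNIV. dir_deriv (\<lambda>w. z $ j) w (axis j 1)) = 0" for w by simp
    show "(\<Sum>j\<in>UNIV. z $ j * cnj (w $ j)) = cnj (herm w z)" for w by (simp add: herm_def mult.commute)
    show "integrable (nu a) (\<lambda>w. cnj (herm w z) * cnj (F w))"
      using integrable_cnj[OF int] by simp
  qed simp
  then have "of_real (a + 1) * cnj (LINT w|nu a. herm w z * F w) = 0"
    by (subst Bochner_Integration.integral_cnj[symmetric]) simp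
  moreover have "complex_of_real (a + 1) \<noteq> 0" using a by (simp only: of_real_eq_0_iff)
  ultimately show ?thesis by simp
qed

text \<open>A mean value property: the \<open>t\<close> derivative of the integral of
  \<open>kern s z (t *\<^sub>R w)\<close> carries the factor \<open>herm w z\<close> and vanishes by
  the previous lemma, so the value at \<open>t = 1\<close> equals the value at \<open>t = 0\<close>,
  where the kernel is 1.\<close>

lemma integral_kern:
  fixes z :: "complex ^ 'n"
  assumes z: "norm z < 1"
  shows "(LINT w|nu a. kern s z w) = 1"
proof -
  let ?\<phi> = "\<lambda>t. LINT w|nu a. kern s z (t *\<^sub>R w)"
  define q where "q = (1 + norm z) / 2"
  have q: "norm z < q" "q < 1" "0 < q" using z norm_ge_zero[of z] unfolding q_def by (simp_all add: add_pos_nonneg)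
  have der: "(?\<phi> has_vector_derivative 0) (at t)" if t: "t \<in> {0..1}" for t
  proof -
    \<comment> \<open>The radius satisfies \<open>(1 + r) * norm z = q\<close>, so a two-sided
      neighbourhood of each \<open>t\<close> in \<open>{0..1}\<close>, endpoints included, keeps
      \<open>t' *\<^sub>R z\<close> within radius \<open>q < 1\<close>. For \<open>z = 0\<close> any
      radius works.\<close>
    define r where "r = (if norm z = 0 then 1 else (q - norm z) / norm z)"
    have r: "0 < r" using q by (auto simp: r_def)
    have small: "norm (t' *\<^sub>R z) \<le> q" if "\<bar>t' - t\<bar> < r" for t'
    proof (cases "norm z = 0")
      case False
      have "\<bar>t'\<bar> \<le> 1 + r" using that t by auto
      then have "\<bar>t'\<bar> * norm z \<le> (1 + r) * norm z" by (intro mult_right_mono) auto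
      also have "\<dots> = q" using False by (simp add: r_def field_simps)
      finally show ?thesis by simp
    qed (use q in auto)
    have kb: "kern s' z (t' *\<^sub>R w) = kern s' (t' *\<^sub>R z) w" for s' t' w by (simp add: kern_scaleR)
    obtain B where B: "0 \<le> B" "\<And>w v. norm w \<le> 1 \<Longrightarrow> norm v \<le> q \<Longrightarrow> cmod (kern (s + 1) (v :: complex ^ 'n) w) \<le> B"
    proof (rule that[of "(1 - q) powr (- \<bar>s + 1\<bar>) + 2 powr \<bar>s + 1\<bar>"])
      fix w v :: "complex ^ 'n" assume w: "norm w \<le> 1" and v: "norm v \<le> q"
      have v1: "norm v < 1" using v q by simp
      show "cmod (kern (s + 1) v w) \<le> (1 - q) powr (- \<bar>s + 1\<bar>) + 2 powr \<bar>s + 1\<bar>"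
      proof (cases "0 \<le> s + 1")
        case True
        have "(1 - norm v) powr (- (s + 1)) \<le> (1 - q) powr (- (s + 1))"
          using True v q by (intro powr_mono2') auto
        with cmod_kern_le[OF v1 w True] show ?thesis using True by (simp add: add_increasing2)
      next
        case False
        have "cmod (1 - herm w v) powr (- (s + 1)) \<le> 2 powr (- (s + 1))"
          using False cmod_one_minus_herm_le[of v w] v1 w by (intro powr_mono2) auto
        then show ?thesis using False unfolding cmod_kern by (simp add: add_increasing)
      qed
    qed simp
    have "(?\<phi> has_vector_derivative (LINT w|nu a. of_real s * herm w z * kern (s + 1) z (t *\<^sub>R w))) (at t)"
    proof (rule has_vector_derivative_integral_dominated[OF r])
      fix t' assume t': "\<bar>t' - t\<bar> < r"
      note n = small[OF t']
      then have n1: "norm (t' *\<^sub>R z) < 1" using q by simp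
      show "((\<lambda>t. kern s z (t *\<^sub>R w)) has_vector_derivative of_real s * herm w z * kern (s + 1) z (t' *\<^sub>R w)) (at t')"
        if "w \<in> space (nu a)" for w
        using norm_mult_less_1[OF n1, of w] that
        by (intro has_vector_derivative_kern_scaleR) (simp add: mult_ac)
      show "cmod (of_real s * herm w z * kern (s + 1) z (t' *\<^sub>R w)) \<le> \<bar>s\<bar> * 1 * B" if "w \<in> space (nu a)" for w
        unfolding norm_mult kb using B n that cmod_herm_le[of w z] z mult_mono[of "norm w" 1 "norm z" 1]
        by (intro mult_mono) auto
      show "integrable (nu a) (\<lambda>w. kern s z (t' *\<^sub>R w))"
      proof -
        obtain C where "\<And>w :: complex ^ 'n. norm w \<le> 1 \<Longrightarrow> cmod (kern s (t' *\<^sub>R z) w) \<le> C" using cmod_kern_bound[OF n1] by metis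
        then show ?thesis unfolding kb
          by (intro integrable_nu_bounded[OF a, where B = C] measurable_kern_nu n1) auto
      qed
    next
      show "integrable (nu a) (\<lambda>w :: complex ^ 'n. \<bar>s\<bar> * 1 * B)"
        by (rule integrable_nu_bounded[OF a]) auto
    qed
    moreover have "(LINT w|nu a. of_real s * herm w z * kern (s + 1) z (t *\<^sub>R w)) = 0"
    proof -
      have n1: "norm (t *\<^sub>R z) < 1" using small[of t] r q by simp
      obtain C where C: "\<And>w :: complex ^ 'n. norm w \<le> 1 \<Longrightarrow> cmod (kern (s + 1) (t *\<^sub>R z) w) \<le> C" using cmod_kern_bound[OF n1] by metis
      have "(LINT w|nu a. herm w z * kern (s + 1) (t *\<^sub>R z) w) = 0"
        by (rule integral_herm_mult_eq_0[OF holomorphic_ball_kern[OF n1], where B = C]) (use C in auto)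
      then show ?thesis unfolding kb mult.assoc by simp
    qed
    ultimately show ?thesis by simp
  qed
  have "?\<phi> 1 = ?\<phi> 0"
    by (rule has_derivative_zero_unique[of "{0..1}"])
       (use der in \<open>auto simp: has_vector_derivative_def intro: has_derivative_at_withinI\<close>)
  then show ?thesis by (simp add: integral_nu_const[OF a] measure_nu[OF a])
qed

text \<open>At the critical exponent the operator of the radial identity raises the kernel by one
  order: \<open>N * kern N z + R (kern N z) = N * kern (N + 1) z\<close>. The identity is applied to
  the kernel, with \<open>u\<close> as the conjugated factor, and then conjugated.\<close>

lemma weight_shift_rho:
  fixes u :: "complex ^ 'n \<Rightarrow> complex"
  assumes u: "holomorphic_ball u" "integrable (nu a) u" and z: "norm z < 1"
  defines "N \<equiv> real CARD('n) + 1 + a"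
  shows "of_real N * (LINT w|nu a. u w * cnj (kern (N + 1) z w) * of_real (rho w)) = of_real (a + 1) * (LINT w|nu a. u w * cnj (kern N z w))"
proof -
  have rad: "of_real N * kern N z w + dir_deriv (kern N z) w w = of_real N * kern (N + 1) z w" if "norm w < 1" for w
  proof -
    have n: "norm z * norm w < 1" using norm_mult_less_1[OF z, of w] that by simp
    show ?thesis using kern_unfold_1[OF n, of N]
      by (simp add: dir_deriv_kern[OF n] algebra_simps flip: distrib_left)
  qed
  obtain B where B: "0 \<le> B" "\<And>w :: complex ^ 'n. norm w \<le> 1 \<Longrightarrow> cmod (kern N z w) \<le> B" using cmod_kern_bound[OF z] by metis
  obtain B' where B': "0 \<le> B'" "\<And>w :: complex ^ 'n. norm w \<le> 1 \<Longrightarrow> cmod (kern (N + 1) z w) \<le> B'" using cmod_kern_bound[OF z] by metis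
  note hk = holomorphic_ball_kern[OF z]
  have mk: "(\<lambda>w. cnj (kern s z w)) \<in> borel_measurable (nu a)" for s
    by (intro continuous_on_measurable_nu continuous_intros holomorphic_ball_continuous_on hk)
  have int_k: "integrable (nu a) (\<lambda>w. u w * cnj (kern N z w))"
    by (rule integrable_nu_mult_bounded[OF a u(2) mk, where B = B]) (use B in auto)
  have int_k1: "integrable (nu a) (\<lambda>w. u w * cnj (of_real N * herm w z * kern (N + 1) z w * of_real (rho w)))"
  proof (rule integrable_nu_mult_bounded[OF a u(2)])
    show "(\<lambda>w. cnj (of_real N * herm w z * kern (N + 1) z w * of_real (rho w))) \<in> borel_measurable (nu a)"
      by (intro continuous_on_measurable_nu continuous_intros holomorphic_ball_continuous_on hk
           bounded_linear.continuous_on[OF bounded_linear_herm])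
    show "norm (cnj (of_real N * herm w z * kern (N + 1) z w * of_real (rho w))) \<le> \<bar>N\<bar> * 1 * B' * 1" if "norm w < 1" for w
      unfolding complex_mod_cnj norm_mult norm_of_real
      using cmod_herm_le[of w z] z that B' mult_mono[of "norm w" 1 "norm z" 1] rho_pos[OF that]
      by (intro mult_mono) auto
  qed
  have "(LINT w|nu a. (of_real N * kern N z w + dir_deriv (kern N z) w w) * cnj (u w) * of_real (rho w))
      = of_real (a + 1) * (LINT w|nu a. kern N z w * cnj (u w))"
  proof (rule nu_radial[OF a hk u(1), folded N_def])
    show "integrable (nu a) (\<lambda>w. kern N z w * cnj (u w))"
      using integrable_cnj[OF int_k] by (simp add: mult.commute)
    have "integrable (nu a) (\<lambda>w. (of_real N * herm w z * kern (N + 1) z w) * cnj (u w) * of_real (rho w))"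
      using integrable_cnj[OF int_k1] by (simp add: mult_ac)
    then show "integrable (nu a) (\<lambda>w. dir_deriv (kern N z) w w * cnj (u w) * of_real (rho w))"
      by (rule Bochner_Integration.integrable_cong[OF refl, THEN iffD1, rotated])
         (use norm_mult_less_1[OF z, of "_ :: complex ^ 'n"] in \<open>simp add: dir_deriv_kern\<close>)
  qed
  also have "(LINT w|nu a. (of_real N * kern N z w + dir_deriv (kern N z) w w) * cnj (u w) * of_real (rho w))
     = (LINT w|nu a. of_real N * (kern (N + 1) z w * cnj (u w) * of_real (rho w)))"
    by (rule Bochner_Integration.integral_cong) (auto simp: rad mult.assoc)
  also have "\<dots> = of_real N * (LINT w|nu a. kern (N + 1) z w * cnj (u w) * of_real (rho w))"
    by simp
  finally have "cnj (of_real N * (LINT w|nu a. kern (N + 1) z w * cnj (u w) * of_real (rho w)))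
     = cnj (of_real (a + 1) * (LINT w|nu a. kern N z w * cnj (u w)))" by simp
  then show ?thesis
    unfolding complex_cnj_mult by (simp add: mult_ac flip: Bochner_Integration.integral_cnj)
qed

text \<open>The Bergman projections for the weights \<open>a\<close> and \<open>a + 1\<close> agree
  on \<open>u\<close>: the constants of \<open>nu_shift\<close> and of the previous lemma
  cancel.\<close>

lemma weight_shift:
  fixes u :: "complex ^ 'n \<Rightarrow> complex"
  assumes u: "holomorphic_ball u" "integrable (nu a) u" and z: "norm z < 1"
  defines "N \<equiv> real CARD('n) + 1 + a"
  shows "(LINT w|nu (a + 1). u w * cnj (kern (N + 1) z w)) = (LINT w|nu a. u w * cnj (kern N z w))"
proof -
  have m: "(\<lambda>w. u w * cnj (kern (N + 1) z w)) \<in> borel_measurable (nu a)"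
    by (intro continuous_on_measurable_nu continuous_intros holomorphic_ball_continuous_on holomorphic_ball_kern z u(1))
  have "of_real (a + 1) * (LINT w|nu (a + 1). u w * cnj (kern (N + 1) z w)) = of_real (a + 1) * (LINT w|nu a. u w * cnj (kern N z w))"
    using nu_shift(2)[OF a m] weight_shift_rho[OF u z] unfolding N_def by simp
  moreover have "complex_of_real (a + 1) \<noteq> 0" using a by (simp only: of_real_eq_0_iff)
  ultimately show ?thesis by simp
qed

end

section \<open>Affine contractions of the ball towards a point\<close>

lemma dir_deriv_affine:
  fixes u :: "complex ^ 'n \<Rightarrow> complex"
  assumes u: "holomorphic_ball u" and z: "norm z < 1" and t: "0 \<le> t" "t \<le> 1" and w: "norm w < 1"
  shows "norm (t *\<^sub>R z + (1 - t) *\<^sub>R w) < 1"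
    and "((\<lambda>w. u (t *\<^sub>R z + (1 - t) *\<^sub>R w)) has_derivative (\<lambda>v. of_real (1 - t) * dir_deriv u (t *\<^sub>R z + (1 - t) *\<^sub>R w) v)) (at w)"
proof -
  have "norm (t *\<^sub>R z + (1 - t) *\<^sub>R w) \<le> t * norm z + (1 - t) * norm w"
    using norm_triangle_ineq[of "t *\<^sub>R z" "(1 - t) *\<^sub>R w"] t by simp
  also have "\<dots> < 1"
  proof (cases "t = 0")
    case False
    then have "t * norm z < t * 1" "(1 - t) * norm w \<le> (1 - t) * 1"
      using t z w by (auto simp: mult_left_le)
    then show ?thesis by simp
  qed (use w in simp)
  finally show n: "norm (t *\<^sub>R z + (1 - t) *\<^sub>R w) < 1" .
  have "((\<lambda>w. t *\<^sub>R z + (1 - t) *\<^sub>R w) has_derivative (\<lambda>v. (1 - t) *\<^sub>R v)) (at w)"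
    by (auto intro!: derivative_eq_intros)
  from has_derivative_compose[OF this holomorphic_ballD(1)[OF u n]]
  show "((\<lambda>w. u (t *\<^sub>R z + (1 - t) *\<^sub>R w)) has_derivative (\<lambda>v. of_real (1 - t) * dir_deriv u (t *\<^sub>R z + (1 - t) *\<^sub>R w) v)) (at w)"
    using linear_scale[OF linear_dir_deriv[OF u n]] by (simp add: scaleR_conv_of_real[where 'a = complex])
qed

lemma holomorphic_ball_affine:
  assumes u: "holomorphic_ball u" and z: "norm z < 1" and t: "0 \<le> t" "t \<le> 1"
  shows "holomorphic_ball (\<lambda>w. u (t *\<^sub>R z + (1 - t) *\<^sub>R w))"
  by (rule holomorphic_ballI[OF dir_deriv_affine(2)[OF u z t]])
     (auto simp: holomorphic_ballD(2)[OF u dir_deriv_affine(1)[OF u z t]])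

text \<open>A limit of difference quotients, each set to 0 where the shifted point leaves the ball;
  at every fixed \<open>w\<close> this happens for only finitely many indices.\<close>

lemma measurable_dir_deriv_const:
  fixes v :: "complex ^ 'n \<Rightarrow> complex"
  assumes v: "holomorphic_ball v"
  shows "(\<lambda>w. dir_deriv v w x) \<in> borel_measurable (nu a)"
proof -
  have cv: "continuous_on unit_ball v" by (rule holomorphic_ball_continuous_on[OF v])
  show ?thesis
  proof (rule borel_measurable_LIMSEQ_metric)
    let ?q = "\<lambda>k w. if norm (w + inverse (real (Suc k)) *\<^sub>R x) < 1 then 
        real (Suc k) *\<^sub>R (v (w + inverse (real (Suc k)) *\<^sub>R x) - v w) else 0"
    show "?q k \<in> borel_measurable (nu a)" for k
    proof -
      let ?c = "inverse (real (Suc k)) *\<^sub>R x"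
      have "(\<lambda>w. indicator unit_ball w *\<^sub>R v w) \<in> borel_measurable borel"
        by (rule borel_measurable_continuous_on_indicator) (use cv in auto)
      then have [measurable]: "(\<lambda>w. if norm w < 1 then v w else 0) \<in> borel_measurable borel"
        by (simp add: indicator_scaleR_eq_if)
      have [measurable]: "(\<lambda>w. (if norm (w + ?c) < 1 then v (w + ?c) else 0)) \<in> borel_measurable borel"
        by (rule measurable_compose[of "\<lambda>w. w + ?c" borel borel]) auto
      have "(\<lambda>w. if norm (w + ?c) < 1 then real (Suc k) *\<^sub>R ((if norm (w + ?c) < 1 then v (w + ?c) else 0) - (if norm w < 1 then v w else 0)) else 0) \<in> borel_measurable borel"
        by measurable
      then have "(\<lambda>w. if norm (w + ?c) < 1 then real (Suc k) *\<^sub>R ((if norm (w + ?c) < 1 then v (w + ?c) else 0) - (if norm w < 1 then v w else 0)) else 0) \<in> borel_measurable (nu a)"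
        by (rule measurable_compose[OF measurable_id_nu])
      then show ?thesis
        by (rule measurable_cong[THEN iffD1, rotated]) auto
    qed
    show "(\<lambda>k. ?q k w) \<longlonglongrightarrow> dir_deriv v w x" if "w \<in> space (nu a)" for w
    proof -
      have w: "norm w < 1" using that by simp
      have "(\<lambda>k. w + inverse (real (Suc k)) *\<^sub>R x) \<longlonglongrightarrow> w + 0 *\<^sub>R x"
        by (intro tendsto_intros LIMSEQ_inverse_real_of_nat)
      then have "(\<lambda>k. norm (w + inverse (real (Suc k)) *\<^sub>R x)) \<longlonglongrightarrow> norm (w + 0 *\<^sub>R x)"
        by (rule tendsto_norm)
      then have ev: "\<forall>\<^sub>F k in sequentially. norm (w + inverse (real (Suc k)) *\<^sub>R x) < 1"
        by (rule order_tendstoD(2)) (use w in simp)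
      show ?thesis
        by (rule Lim_transform_eventually[OF has_derivative_imp_quotient_tendsto[OF holomorphic_ballD(1)[OF v w], of x]])
           (use ev in \<open>auto elim!: eventually_mono\<close>)
    qed
  qed
qed

lemma measurable_dir_deriv:
  fixes v :: "complex ^ 'n \<Rightarrow> complex"
  assumes v: "holomorphic_ball v" and X: "continuous_on unit_ball X"
  shows "(\<lambda>w. dir_deriv v w (X w)) \<in> borel_measurable (nu a)"
proof -
  have "(\<lambda>w. X w $ j) \<in> borel_measurable (nu a)" for j
    by (intro continuous_on_measurable_nu continuous_intros X)
  then have "(\<lambda>w. (\<Sum>j\<in>UNIV. X w $ j * dir_deriv v w (axis j 1))) \<in> borel_measurable (nu a)"
    by (intro borel_measurable_sum borel_measurable_times measurable_dir_deriv_const v)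
  then show ?thesis
    by (rule measurable_cong[THEN iffD1, rotated]) (simp add: dir_deriv_axis_sum[OF v])
qed

text \<open>The field \<open>w \<mapsto> z - w\<close> generates the contractions of the ball to the point \<open>z\<close>, so this
  is the infinitesimal form of the reproducing formula.\<close>

lemma contraction_field_orthogonal:
  fixes v :: "complex ^ 'n \<Rightarrow> complex"
  assumes a: "-1 < a" and v: "holomorphic_ball v" and z: "norm z < 1"
    and M: "\<And>w. norm w < 1 \<Longrightarrow> cmod (v w) \<le> M" "\<And>w x. norm w < 1 \<Longrightarrow> cmod (dir_deriv v w x) \<le> M * norm x"
  shows "(LINT w|nu (a + 1). dir_deriv v w (z - w) * cnj (kern (real CARD('n) + 2 + a) z w)) = 0"
proof -
  define N where "N = real CARD('n) + 1 + a"
  define K where "K = (\<lambda>w. kern (N + 1) z w)"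
  obtain B where B: "0 \<le> B" "\<And>w :: complex ^ 'n. norm w \<le> 1 \<Longrightarrow> cmod (K w) \<le> B"
    unfolding K_def using cmod_kern_bound[OF z] by metis
  obtain B' where B': "0 \<le> B'" "\<And>w :: complex ^ 'n. norm w \<le> 1 \<Longrightarrow> cmod (kern N z w) \<le> B'" using cmod_kern_bound[OF z] by metis
  have hK: "holomorphic_ball K" unfolding K_def by (rule holomorphic_ball_kern[OF z])
  have M0: "0 \<le> M" using order_trans[OF norm_ge_zero M(1)[of 0]] by simp
  have cv: "continuous_on unit_ball v" "continuous_on unit_ball K"
    using v hK by (auto intro: holomorphic_ball_continuous_on)
  have intv: "integrable (nu a) v"
    by (rule integrable_nu_bounded[OF a holomorphic_measurable_nu[OF v] M(1)])
  have int_vK: "integrable (nu a) (\<lambda>w. v w * cnj (K w))"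
    by (rule integrable_nu_mult_bounded[OF a intv, where B = B])
       (use B in \<open>auto intro!: continuous_on_measurable_nu continuous_intros cv\<close>)
  have rho_bd: "norm (of_real (rho w) :: complex) \<le> 1" if "norm w < 1" for w :: "complex ^ 'n"
    unfolding norm_of_real using rho_pos[OF that] by simp
  have mrho: "(\<lambda>w :: complex ^ 'n. of_real (rho w) :: complex) \<in> borel_measurable (nu a)"
    by (intro continuous_on_measurable_nu continuous_intros)
  have int_vKr: "integrable (nu a) (\<lambda>w. v w * cnj (K w) * of_real (rho w))"
    by (rule integrable_nu_mult_bounded[OF a int_vK mrho rho_bd])
  have hk: "holomorphic_ball (kern N z)" by (rule holomorphic_ball_kern[OF z])
  have int_vk: "integrable (nu a) (\<lambda>w. v w * cnj (kern N z w))"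
    by (rule integrable_nu_mult_bounded[OF a intv, where B = B'])
       (use B' in \<open>auto intro!: continuous_on_measurable_nu continuous_intros holomorphic_ball_continuous_on[OF hk]\<close>)
  have D_eq: "dir_deriv v w x = (\<Sum>j\<in>UNIV. x $ j * dir_deriv v w (axis j 1))" if "norm w < 1" for w x
    using dir_deriv_axis_sum[OF v that] by simp
  have mDzw: "(\<lambda>w. dir_deriv v w (z - w)) \<in> borel_measurable (nu a)"
    by (intro measurable_dir_deriv v continuous_intros)
  have int_D: "integrable (nu a) (\<lambda>w. dir_deriv v w (z - w))"
  proof (rule integrable_nu_bounded[OF a mDzw])
    fix w :: "complex ^ 'n" assume w: "norm w < 1"
    have "norm (z - w) \<le> 2" using norm_triangle_ineq4[of z w] z w by simp
    then show "norm (dir_deriv v w (z - w)) \<le> M * 2"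
      using M(2)[OF w, of "z - w"] mult_left_mono[OF _ M0] by (meson order_trans)
  qed
  have int_DK: "integrable (nu a) (\<lambda>w. dir_deriv v w (z - w) * cnj (K w))"
    by (rule integrable_nu_mult_bounded[OF a int_D, where B = B])
       (use B in \<open>auto intro!: continuous_on_measurable_nu continuous_intros cv\<close>)
  have int_DKr: "integrable (nu a) (\<lambda>w. dir_deriv v w (z - w) * cnj (K w) * of_real (rho w))"
    by (rule integrable_nu_mult_bounded[OF a int_DK mrho rho_bd])
  let ?I = "\<lambda>g. LINT w|nu a. g w"
  \<comment> \<open>The field is \<open>(z - w) * v\<close>. Its divergence has the extra term
    \<open>- n * v\<close>, because each coordinate of \<open>z - w\<close> has derivative
    \<open>-1\<close>.\<close>
  have key: "?I (\<lambda>w. (dir_deriv v w (z - w) - of_nat CARD('n) * v w) * cnj (K w) * of_real (rho w))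
    = of_real (a + 1) * ?I (\<lambda>w. ((herm z w - of_real ((norm w)\<^sup>2)) * v w) * cnj (K w))"
  proof (rule nu_divergence[OF a _ hK])
    show "holomorphic_ball (\<lambda>w. (z $ j - w $ j) * v w)" for j
      by (intro holomorphic_ball_mult holomorphic_ball_diff holomorphic_ball_const holomorphic_ball_component v)
    show "(\<Sum>j\<in>UNIV. dir_deriv (\<lambda>w. (z $ j - w $ j) * v w) w (axis j 1)) = dir_deriv v w (z - w) - of_nat CARD('n) * v w"
      if w: "norm w < 1" for w
    proof -
      have "dir_deriv (\<lambda>w. z $ j - w $ j) w (axis j 1) = - 1" for j
        by (subst dir_deriv_eqI[where D = "\<lambda>v. - (v $ j)"])
           (auto intro!: derivative_eq_intros has_derivative_component simp: axis_def)
      then have "dir_deriv (\<lambda>w. (z $ j - w $ j) * v w) w (axis j 1) = (z - w) $ j * dir_deriv v w (axis j 1) - v w" for j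
        by (subst dir_deriv_mult[OF _ v w]) (auto intro!: holomorphic_ball_diff holomorphic_ball_const holomorphic_ball_component)
      then show ?thesis by (simp add: sum_subtractf D_eq[OF w, of "z - w"])
    qed
    show "(\<Sum>j\<in>UNIV. (z $ j - w $ j) * v w * cnj (w $ j)) = (herm z w - of_real ((norm w)\<^sup>2)) * v w" for w
      unfolding herm_self[symmetric] herm_diff_left[symmetric]
      by (simp add: herm_def sum_distrib_left sum_distrib_right mult_ac)
    have "integrable (nu a) (\<lambda>w. dir_deriv v w (z - w) * cnj (K w) * of_real (rho w) - of_nat CARD('n) * (v w * cnj (K w) * of_real (rho w)))"
      using int_DKr int_vKr by (intro Bochner_Integration.integrable_diff integrable_mult_right)
    then show "integrable (nu a) (\<lambda>w. (dir_deriv v w (z - w) - of_nat CARD('n) * v w) * cnj (K w) * of_real (rho w))"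
      by (simp add: algebra_simps)
    have "integrable (nu a) (\<lambda>w. v w * cnj (K w) * (herm z w - of_real ((norm w)\<^sup>2)))"
    proof (rule integrable_nu_mult_bounded[OF a int_vK])
      have "(\<lambda>w. herm z w) \<in> borel_measurable (nu a)"
        by (rule measurable_compose[OF measurable_id_nu measurable_herm2])
      moreover have "(\<lambda>w :: complex ^ 'n. complex_of_real ((norm w)\<^sup>2)) \<in> borel_measurable (nu a)"
        by (intro continuous_on_measurable_nu continuous_intros)
      ultimately show "(\<lambda>w. herm z w - of_real ((norm w)\<^sup>2)) \<in> borel_measurable (nu a)"
        by (rule borel_measurable_diff)
      show "norm (herm z w - of_real ((norm w)\<^sup>2)) \<le> 2" if "norm w < 1" for w
        using norm_triangle_ineq4[of "herm z w" "of_real ((norm w)\<^sup>2)"] cmod_herm_le[of z w] 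
          norm_mult_less_1[OF z, of w] that abs_square_less_1[of "norm w"] unfolding norm_of_real by simp
    qed
    then show "integrable (nu a) (\<lambda>w. ((herm z w - of_real ((norm w)\<^sup>2)) * v w) * cnj (K w))"
      by (simp add: mult_ac)
  qed
  \<comment> \<open>The pairing factor splits as
    \<open>herm z w - |w|^2 = rho w - (1 - herm z w)\<close>, and \<open>1 - herm z w\<close> lowers
    the order of the conjugated kernel by one.\<close>
  have "?I (\<lambda>w. ((herm z w - of_real ((norm w)\<^sup>2)) * v w) * cnj (K w))
      = ?I (\<lambda>w. v w * cnj (K w) * of_real (rho w) - v w * cnj (kern N z w))"
  proof (rule Bochner_Integration.integral_cong[OF refl])
    fix w :: "complex ^ 'n" assume "w \<in> space (nu a)"
    then have n: "norm z * norm w < 1" using norm_mult_less_1[OF z, of w] by simp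
    have "kern N z w = (1 - herm w z) * K w"
      unfolding K_def by (rule kern_unfold_1[OF n, symmetric])
    then have eq: "cnj (kern N z w) = (1 - herm z w) * cnj (K w)" by simp
    show "((herm z w - of_real ((norm w)\<^sup>2)) * v w) * cnj (K w) = v w * cnj (K w) * of_real (rho w) - v w * cnj (kern N z w)"
      unfolding eq by (simp add: algebra_simps)
  qed
  also have "\<dots> = ?I (\<lambda>w. v w * cnj (K w) * of_real (rho w)) - ?I (\<lambda>w. v w * cnj (kern N z w))"
    by (rule Bochner_Integration.integral_diff[OF int_vKr int_vk])
  finally have e1: "?I (\<lambda>w. ((herm z w - of_real ((norm w)\<^sup>2)) * v w) * cnj (K w)) 
    = ?I (\<lambda>w. v w * cnj (K w) * of_real (rho w)) - ?I (\<lambda>w. v w * cnj (kern N z w))" .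
  have e2: "of_real N * ?I (\<lambda>w. v w * cnj (K w) * of_real (rho w)) = of_real (a + 1) * ?I (\<lambda>w. v w * cnj (kern N z w))"
    unfolding K_def N_def by (rule weight_shift_rho[OF a v intv z])
  have "?I (\<lambda>w. (dir_deriv v w (z - w) - of_nat CARD('n) * v w) * cnj (K w) * of_real (rho w))
    = ?I (\<lambda>w. dir_deriv v w (z - w) * cnj (K w) * of_real (rho w) - of_nat CARD('n) * (v w * cnj (K w) * of_real (rho w)))"
    by (rule Bochner_Integration.integral_cong) (auto simp: algebra_simps)
  also have "\<dots> = ?I (\<lambda>w. dir_deriv v w (z - w) * cnj (K w) * of_real (rho w)) - of_nat CARD('n) * ?I (\<lambda>w. v w * cnj (K w) * of_real (rho w))"
    by (subst Bochner_Integration.integral_diff) (use int_DKr int_vKr in auto)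
  finally have e3: "?I (\<lambda>w. (dir_deriv v w (z - w) - of_nat CARD('n) * v w) * cnj (K w) * of_real (rho w))
    = ?I (\<lambda>w. dir_deriv v w (z - w) * cnj (K w) * of_real (rho w)) - of_nat CARD('n) * ?I (\<lambda>w. v w * cnj (K w) * of_real (rho w))" .
  have zero: "?I (\<lambda>w. dir_deriv v w (z - w) * cnj (K w) * of_real (rho w)) = 0"
  proof -
    \<comment> \<open>Here \<open>X\<close> is the sought integral, \<open>Y\<close> and
      \<open>Z\<close> are the integrals of \<open>v\<close> against the kernels of order
      \<open>N + 1\<close> (with \<open>rho\<close>) and \<open>N\<close>, and
      \<open>A = a + 1\<close>. The second equation is the weight shift.\<close>
    have "X = 0" if "X - n * Y = A * (Y - Z)" "(n + A) * Y = A * Z" for X Y Z n A :: complex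
      using that by (simp add: algebra_simps)
    from this[OF key[unfolded e1 e3]] show ?thesis using e2 by (simp add: N_def add_ac)
  qed
  have "of_real (a + 1) * (LINT w|nu (a + 1). dir_deriv v w (z - w) * cnj (K w)) 
    = of_real (real CARD('n) + 1 + a) * ?I (\<lambda>w. dir_deriv v w (z - w) * cnj (K w) * of_real (rho w))"
    by (rule nu_shift(2)[OF a]) (use int_DK in auto)
  moreover have "complex_of_real (a + 1) \<noteq> 0" using a by (simp only: of_real_eq_0_iff)
  ultimately have "(LINT w|nu (a + 1). dir_deriv v w (z - w) * cnj (K w)) = 0"
    unfolding zero by simp
  moreover have "N + 1 = real CARD('n) + 2 + a" by (simp add: N_def)
  ultimately show ?thesis unfolding K_def by (simp only:)
qed

lemma norm_affine_le:
  assumes "norm w \<le> 1" "0 \<le> t" "t \<le> 1"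
  shows "norm (t *\<^sub>R z + (1 - t) *\<^sub>R w) \<le> 1 - t * (1 - norm z)"
proof -
  have "norm (t *\<^sub>R z + (1 - t) *\<^sub>R w) \<le> t * norm z + (1 - t) * norm w"
    using norm_triangle_ineq[of "t *\<^sub>R z" "(1 - t) *\<^sub>R w"] assms by simp
  also have "(1 - t) * norm w \<le> (1 - t) * 1" using assms by (intro mult_left_mono) auto
  finally show ?thesis by (simp add: algebra_simps)
qed

text \<open>The derivative of \<open>G\<close> is, up to the factor \<open>1 - t\<close>, the
  integral in \<open>contraction_field_orthogonal\<close> for \<open>u\<close> composed with the
  contraction, taken at weight \<open>a - 1\<close>; hence \<open>0 < a\<close>. The endpoint
  \<open>t = 0\<close> is excluded because \<open>u\<close> may be unbounded.\<close>

lemma contraction_integral_const: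
  fixes u :: "complex ^ 'n \<Rightarrow> complex"
  assumes a: "0 < a" and u: "holomorphic_ball u" and z: "norm z < 1"
  defines "G \<equiv> \<lambda>t. LINT w|nu a. u (t *\<^sub>R z + (1 - t) *\<^sub>R w) * cnj (kern (real CARD('n) + 1 + a) z w)"
  assumes st: "s \<in> {0<..<1}" "t \<in> {0<..<1}"
  shows "G s = G t"
proof -
  define K where "K = (\<lambda>w. kern (real CARD('n) + 1 + a) z w)"
  obtain B where B: "0 \<le> B" "\<And>w :: complex ^ 'n. norm w \<le> 1 \<Longrightarrow> cmod (K w) \<le> B"
    unfolding K_def using cmod_kern_bound[OF z] by metis
  have hK: "holomorphic_ball K" unfolding K_def by (rule holomorphic_ball_kern[OF z])
  have a': "-1 < a" "-1 < a - 1" using a by auto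
  have der: "(G has_vector_derivative 0) (at t)" if t: "t \<in> {0<..<1}" for t
  proof -
    \<comment> \<open>For parameters at least \<open>t / 2\<close> the contraction maps the ball
      into radius \<open>R < 1\<close>, where \<open>u\<close> and its derivative are
      bounded.\<close>
    define R where "R = 1 - t / 2 * (1 - norm z)"
    have "0 < t / 2 * (1 - norm z)" using t z by simp
    moreover have "t / 2 * (1 - norm z) \<le> 1 * 1" using t z by (intro mult_mono) auto
    ultimately have R: "0 \<le> R" "R < 1" unfolding R_def by linarith+
    obtain M where M: "0 \<le> M" "\<And>w. norm w \<le> R \<Longrightarrow> cmod (u w) \<le> M"
      "\<And>w v. norm w \<le> R \<Longrightarrow> cmod (dir_deriv u w v) \<le> M * norm v"
      using holomorphic_ball_bounds[OF u R] by metis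
    define r where "r = min t (1 - t) / 2"
    have r: "0 < r" using t by (auto simp: r_def)
    have near: "0 \<le> t'" "t' \<le> 1" "t / 2 \<le> t'" if "\<bar>t' - t\<bar> < r" for t'
    proof -
      have "\<bar>t' - t\<bar> < t / 2" "\<bar>t' - t\<bar> < (1 - t) / 2" using that unfolding r_def by auto
      then have "- (t / 2) < t' - t" "t' - t < (1 - t) / 2" by (auto simp only: abs_less_iff minus_less_iff)
      then show "0 \<le> t'" "t' \<le> 1" "t / 2 \<le> t'" using t by auto
    qed
    have in_R: "norm (t' *\<^sub>R z + (1 - t') *\<^sub>R w) \<le> R" if "\<bar>t' - t\<bar> < r" "norm w \<le> 1" for t' w
    proof -
      have "t / 2 * (1 - norm z) \<le> t' * (1 - norm z)" using near[OF that(1)] z by (intro mult_right_mono) auto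
      then show ?thesis using norm_affine_le[OF that(2) near(1,2)[OF that(1)], of z] unfolding R_def by linarith
    qed
    have "(G has_vector_derivative (LINT w|nu a. dir_deriv u (t *\<^sub>R z + (1 - t) *\<^sub>R w) (z - w) * cnj (K w))) (at t)"
      unfolding G_def K_def[symmetric]
    proof (rule has_vector_derivative_integral_dominated[OF r])
      fix t' assume t': "\<bar>t' - t\<bar> < r"
      fix w :: "complex ^ 'n" assume "w \<in> space (nu a)"
      then have w: "norm w < 1" by simp
      have n: "norm (t' *\<^sub>R z + (1 - t') *\<^sub>R w) < 1" using in_R[OF t', of w] w R by simp
      have "((\<lambda>t. t *\<^sub>R z + (1 - t) *\<^sub>R w) has_derivative (\<lambda>x. x *\<^sub>R (z - w))) (at t')"
        by (auto intro!: derivative_eq_intros simp: algebra_simps)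
      from has_derivative_compose[OF this holomorphic_ballD(1)[OF u n]]
      have "((\<lambda>t. u (t *\<^sub>R z + (1 - t) *\<^sub>R w)) has_vector_derivative dir_deriv u (t' *\<^sub>R z + (1 - t') *\<^sub>R w) (z - w)) (at t')"
        using linear_scale[OF linear_dir_deriv[OF u n]] by (simp add: has_vector_derivative_def)
      then show "((\<lambda>t. u (t *\<^sub>R z + (1 - t) *\<^sub>R w) * cnj (K w)) has_vector_derivative
          dir_deriv u (t' *\<^sub>R z + (1 - t') *\<^sub>R w) (z - w) * cnj (K w)) (at t')"
        by (rule has_vector_derivative_mult_left)
      have "norm (z - w) \<le> 2" using norm_triangle_ineq4[of z w] z w by simp
      then have "cmod (dir_deriv u (t' *\<^sub>R z + (1 - t') *\<^sub>R w) (z - w)) \<le> M * 2"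
        using M(3)[OF in_R[OF t'], of w "z - w"] w mult_left_mono[OF _ M(1)] by (meson order_trans less_imp_le)
      then show "norm (dir_deriv u (t' *\<^sub>R z + (1 - t') *\<^sub>R w) (z - w) * cnj (K w)) \<le> M * 2 * B"
        unfolding norm_mult complex_mod_cnj using B w M by (intro mult_mono) auto
    next
      show "integrable (nu a) (\<lambda>w :: complex ^ 'n. M * 2 * B)"
        by (rule integrable_nu_bounded[OF a'(1)]) auto
      fix t' assume t': "\<bar>t' - t\<bar> < r"
      show "integrable (nu a) (\<lambda>w. u (t' *\<^sub>R z + (1 - t') *\<^sub>R w) * cnj (K w))"
      proof (rule integrable_nu_bounded[OF a'(1)])
        show "(\<lambda>w. u (t' *\<^sub>R z + (1 - t') *\<^sub>R w) * cnj (K w)) \<in> borel_measurable (nu a)"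
          using hK holomorphic_ball_affine[OF u z near(1,2)[OF t']]
          by (intro continuous_on_measurable_nu continuous_intros holomorphic_ball_continuous_on)
        show "norm (u (t' *\<^sub>R z + (1 - t') *\<^sub>R w) * cnj (K w)) \<le> M * B" if "norm w < 1" for w
          unfolding norm_mult complex_mod_cnj using B M in_R[OF t', of w] that by (intro mult_mono) auto
      qed
    qed
    moreover have "(LINT w|nu a. dir_deriv u (t *\<^sub>R z + (1 - t) *\<^sub>R w) (z - w) * cnj (K w)) = 0"
    proof -
      let ?v = "\<lambda>w. u (t *\<^sub>R z + (1 - t) *\<^sub>R w)"
      have t01: "0 \<le> t" "t \<le> 1" using t by auto
      have dv: "dir_deriv ?v w x = of_real (1 - t) * dir_deriv u (t *\<^sub>R z + (1 - t) *\<^sub>R w) x" if "norm w < 1" for w x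
        by (rule dir_deriv_eqI[OF dir_deriv_affine(2)[OF u z t01 that]])
      have "(LINT w|nu (a - 1 + 1). dir_deriv ?v w (z - w) * cnj (kern (real CARD('n) + 2 + (a - 1)) z w)) = 0"
      proof (rule contraction_field_orthogonal[OF a'(2) holomorphic_ball_affine[OF u z t01] z])
        fix w :: "complex ^ 'n" assume w: "norm w < 1"
        have nR: "norm (t *\<^sub>R z + (1 - t) *\<^sub>R w) \<le> R" using in_R[of t w] r w by simp
        then show "cmod (?v w) \<le> M" by (rule M(2))
        show "cmod (dir_deriv ?v w x) \<le> M * norm x" for x
        proof -
          have "cmod (dir_deriv ?v w x) \<le> 1 * (M * norm x)"
            unfolding dv[OF w] norm_mult norm_of_real using t M(3)[OF nR] by (intro mult_mono) auto
          then show ?thesis by simp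
        qed
      qed
      also have "(LINT w|nu (a - 1 + 1). dir_deriv ?v w (z - w) * cnj (kern (real CARD('n) + 2 + (a - 1)) z w))
        = (LINT w|nu a. of_real (1 - t) * (dir_deriv u (t *\<^sub>R z + (1 - t) *\<^sub>R w) (z - w) * cnj (K w)))"
      proof -
        have "a - 1 + 1 = a" "real CARD('n) + 2 + (a - 1) = real CARD('n) + 1 + a" by auto
        then show ?thesis unfolding K_def
          by (simp only:) (rule Bochner_Integration.integral_cong, auto simp only: dv space_nu mem_ball_0 mult.assoc)
      qed
      finally show ?thesis using t by simp
    qed
    ultimately show ?thesis by simp
  qed
  show ?thesis
    by (rule has_derivative_zero_unique[of "{0<..<1}"])
       (use der st in \<open>auto simp: has_vector_derivative_def intro: has_derivative_at_withinI\<close>)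
qed

lemma lborel_integral_affine:
  fixes f :: "'a::euclidean_space \<Rightarrow> 'b::{banach, second_countable_topology}"
  assumes f: "f \<in> borel_measurable borel" and c: "c \<noteq> 0"
  shows "(LINT x|lborel. f x) = \<bar>c\<bar> ^ DIM('a) *\<^sub>R (LINT x|lborel. f (t + c *\<^sub>R x))"
proof -
  have "(LINT x|lborel. f x) = (LINT x|density (distr lborel borel (\<lambda>x. t + c *\<^sub>R x)) (\<lambda>_. ennreal (\<bar>c\<bar> ^ DIM('a))). f x)"
    using lborel_affine[OF c, of t] by (simp add: ennreal_power)
  also have "\<dots> = (LINT x|distr lborel borel (\<lambda>x. t + c *\<^sub>R x). \<bar>c\<bar> ^ DIM('a) *\<^sub>R f x)"
    by (rule integral_density) (use f in auto)
  also have "\<dots> = (LINT x|lborel. \<bar>c\<bar> ^ DIM('a) *\<^sub>R f (t + c *\<^sub>R x))"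
    by (rule integral_distr) (use f in auto)
  finally show ?thesis by simp
qed

text \<open>The constant value of \<open>G\<close> is read off at both ends. As
  \<open>t -> 1\<close> the contraction collapses to \<open>z\<close> and the mean value of the
  kernel leaves \<open>u z\<close>. As \<open>t -> 0\<close> the integral tends to the left-hand
  side.\<close>

lemma reproducing_formula_pos:
  fixes u :: "complex ^ 'n \<Rightarrow> complex"
  assumes a: "0 < a" and u: "holomorphic_ball u" "integrable (nu a) u" and z: "norm z < 1"
  shows "(LINT w|nu a. u w * cnj (kern (real CARD('n) + 1 + a) z w)) = u z"
proof -
  define K where "K = (\<lambda>w. kern (real CARD('n) + 1 + a) z w)"
  define G where "G = (\<lambda>t. LINT w|nu a. u (t *\<^sub>R z + (1 - t) *\<^sub>R w) * cnj (K w))"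
  obtain B where B: "0 \<le> B" "\<And>w :: complex ^ 'n. norm w \<le> 1 \<Longrightarrow> cmod (K w) \<le> B"
    unfolding K_def using cmod_kern_bound[OF z] by metis
  have hK: "holomorphic_ball K" unfolding K_def by (rule holomorphic_ball_kern[OF z])
  have a': "-1 < a" using a by auto
  let ?e = "\<lambda>k. inverse (real (k + 2))"
  have e0: "?e \<longlonglongrightarrow> 0"
    using LIMSEQ_ignore_initial_segment[OF tendsto_inverse_0_at_top[OF filterlim_real_sequentially], of 2] by simp
  have e: "0 < ?e k" "?e k < 1" "?e k \<le> 1 / 2" for k by (auto simp: field_simps)
  have Gconst: "G s = G t" if "s \<in> {0<..<1}" "t \<in> {0<..<1}" for s t
    unfolding G_def K_def by (rule contraction_integral_const[OF a u(1) z that])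
  have cont_u: "isCont u y" if "norm y < 1" for y
    using holomorphic_ballD(1)[OF u(1) that] by (rule has_derivative_continuous)
  have mG: "(\<lambda>w. u (t *\<^sub>R z + (1 - t) *\<^sub>R w) * cnj (K w)) \<in> borel_measurable (nu a)" if "0 \<le> t" "t \<le> 1" for t
    using hK holomorphic_ball_affine[OF u(1) z that]
    by (intro continuous_on_measurable_nu continuous_intros holomorphic_ball_continuous_on)
  have lim1: "(\<lambda>k. G (1 - ?e k)) \<longlonglongrightarrow> u z"
  proof -
    define R where "R = 1 - 1 / 2 * (1 - norm z)"
    have R: "0 \<le> R" "R < 1" using z norm_ge_zero[of z] unfolding R_def by (simp_all add: field_simps add_nonneg_nonneg)
    obtain M where M: "0 \<le> M" "\<And>w. norm w \<le> R \<Longrightarrow> cmod (u w) \<le> M"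
      using holomorphic_ball_bounds[OF u(1) R] by metis
    have "(\<lambda>k. G (1 - ?e k)) \<longlonglongrightarrow> (LINT w|nu a. u z * cnj (K w))"
      unfolding G_def
    proof (rule integral_dominated_convergence)
      show "(\<lambda>w. u z * cnj (K w)) \<in> borel_measurable (nu a)"
        using hK by (intro continuous_on_measurable_nu continuous_intros holomorphic_ball_continuous_on)
      show "(\<lambda>w. u ((1 - ?e k) *\<^sub>R z + (1 - (1 - ?e k)) *\<^sub>R w) * cnj (K w)) \<in> borel_measurable (nu a)" for k
        by (rule mG) (use e[of k] in auto)
      show "integrable (nu a) (\<lambda>w :: complex ^ 'n. M * B)" by (rule integrable_nu_bounded[OF a']) auto
      show "AE w in nu a. (\<lambda>k. u ((1 - ?e k) *\<^sub>R z + (1 - (1 - ?e k)) *\<^sub>R w) * cnj (K w)) \<longlonglongrightarrow> u z * cnj (K w)"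
      proof (intro AE_I2)
        fix w :: "complex ^ 'n"
        have "(\<lambda>k. (1 - ?e k) *\<^sub>R z + (1 - (1 - ?e k)) *\<^sub>R w) \<longlonglongrightarrow> (1 - 0) *\<^sub>R z + (1 - (1 - 0)) *\<^sub>R w"
          by (intro tendsto_intros e0)
        then show "(\<lambda>k. u ((1 - ?e k) *\<^sub>R z + (1 - (1 - ?e k)) *\<^sub>R w) * cnj (K w)) \<longlonglongrightarrow> u z * cnj (K w)"
          by (intro tendsto_intros isCont_tendsto_compose[OF cont_u[OF z]]) simp
      qed
      show "AE w in nu a. norm (u ((1 - ?e k) *\<^sub>R z + (1 - (1 - ?e k)) *\<^sub>R w) * cnj (K w)) \<le> M * B" for k
      proof (intro AE_I2)
        fix w :: "complex ^ 'n" assume "w \<in> space (nu a)"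
        then have w: "norm w \<le> 1" by simp
        have "1 / 2 * (1 - norm z) \<le> (1 - ?e k) * (1 - norm z)"
          using e[of k] z by (intro mult_right_mono) auto
        then have "norm ((1 - ?e k) *\<^sub>R z + (1 - (1 - ?e k)) *\<^sub>R w) \<le> R"
          using norm_affine_le[OF w, of "1 - ?e k" z] e[of k] unfolding R_def by linarith
        then show "norm (u ((1 - ?e k) *\<^sub>R z + (1 - (1 - ?e k)) *\<^sub>R w) * cnj (K w)) \<le> M * B"
          unfolding norm_mult complex_mod_cnj using M B w by (intro mult_mono) auto
      qed
    qed
    also have "(LINT w|nu a. u z * cnj (K w)) = u z"
      using integral_kern[OF a' z, of "real CARD('n) + 1 + a"] unfolding K_def by simp
    finally show ?thesis .
  qed
  have lim0: "(\<lambda>k. G (?e k)) \<longlonglongrightarrow> (LINT w|nu a. u w * cnj (K w))"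
  proof -
    let ?c = "nu_mass TYPE('n) a"
    define h where "h = (\<lambda>t w. indicator unit_ball w *\<^sub>R (u (t *\<^sub>R z + (1 - t) *\<^sub>R w) * cnj (K w) * of_real (rho w powr a)))"
    have h_meas: "h t \<in> borel_measurable borel" if "0 \<le> t" "t \<le> 1" for t
    proof -
      have "(\<lambda>w. indicator unit_ball w *\<^sub>R (u (t *\<^sub>R z + (1 - t) *\<^sub>R w) * cnj (K w))) \<in> borel_measurable borel"
        using hK holomorphic_ball_affine[OF u(1) z that]
        by (intro borel_measurable_continuous_on_indicator continuous_intros holomorphic_ball_continuous_on) auto
      then have "(\<lambda>w. (indicator unit_ball w *\<^sub>R (u (t *\<^sub>R z + (1 - t) *\<^sub>R w) * cnj (K w))) * of_real (rho w powr a)) \<in> borel_measurable borel"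
        by (rule borel_measurable_times) measurable
      then show ?thesis unfolding h_def by simp
    qed
    \<comment> \<open>The substitution \<open>y = t z + (1 - t) w\<close> evaluates \<open>u\<close>
      at the fixed point \<open>y\<close> and moves the dependence on \<open>t\<close> into the
      kernel and the weight. An integrable \<open>u\<close> then dominates although it may be
      unbounded.\<close>
    let ?H = "\<lambda>t y. h t ((1 / (1 - t)) *\<^sub>R (y - t *\<^sub>R z))"
    have H_meas: "?H t \<in> borel_measurable borel" if "0 \<le> t" "t \<le> 1" for t
      by (rule measurable_compose[OF _ h_meas[OF that]]) measurable
    have G_eq: "(1 - t) ^ DIM(complex ^ 'n) *\<^sub>R G t = (LINT y|lborel. ?H t y) / ?c" if t: "0 \<le> t" "t < 1" for t
    proof -
      have "(LINT y|lborel. ?H t y) = \<bar>1 - t\<bar> ^ DIM(complex ^ 'n) *\<^sub>R (LINT w|lborel. ?H t (t *\<^sub>R z + (1 - t) *\<^sub>R w))"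
        by (rule lborel_integral_affine[OF H_meas]) (use t in auto)
      also have "(\<lambda>w. ?H t (t *\<^sub>R z + (1 - t) *\<^sub>R w)) = h t"
        using t by (simp add: fun_eq_iff)
      finally have 1: "(LINT y|lborel. ?H t y) = \<bar>1 - t\<bar> ^ DIM(complex ^ 'n) *\<^sub>R integral\<^sup>L lborel (h t)" .
      have 2: "G t = integral\<^sup>L lborel (h t) / ?c"
        unfolding G_def h_def by (rule nu_integral(2)[OF a' mG]) (use t in auto)
      show ?thesis unfolding 1 2 using t by (simp add: scaleR_conv_of_real[where 'a = complex])
    qed
    have int0: "integrable lborel (\<lambda>w. indicator unit_ball w *\<^sub>R (u w * of_real (rho w powr a)))"
      using u(2) nu_integral(1)[OF a' holomorphic_measurable_nu[OF u(1)]] by simp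
    have "(\<lambda>k. LINT y|lborel. ?H (?e k) y) \<longlonglongrightarrow> (LINT y|lborel. h 0 y)"
    proof (rule integral_dominated_convergence)
      show "h 0 \<in> borel_measurable lborel" using h_meas[of 0] by simp
      show "?H (?e k) \<in> borel_measurable lborel" for k using H_meas[of "?e k"] e[of k] by simp
      show "integrable lborel (\<lambda>y. norm (indicator unit_ball y *\<^sub>R (u y * of_real (rho y powr a))) * (B * 4 powr a))"
        by (intro integrable_mult_left integrable_norm int0)
      have pt: "y = t *\<^sub>R z + (1 - t) *\<^sub>R ((1 / (1 - t)) *\<^sub>R (y - t *\<^sub>R z))" if "t < 1" for t y
        using that by simp
      show "AE y in lborel. norm (?H (?e k) y) \<le> norm (indicator unit_ball y *\<^sub>R (u y * of_real (rho y powr a))) * (B * 4 powr a)" for k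
      proof (intro AE_I2)
        fix y :: "complex ^ 'n"
        define t where "t = ?e k"
        have t: "0 < t" "t < 1" "t \<le> 1 / 2" using e[of k] by (auto simp: t_def)
        define w where "w = (1 / (1 - t)) *\<^sub>R (y - t *\<^sub>R z)"
        have y: "y = t *\<^sub>R z + (1 - t) *\<^sub>R w" unfolding w_def by (rule pt[OF t(2)])
        show "norm (?H (?e k) y) \<le> norm (indicator unit_ball y *\<^sub>R (u y * of_real (rho y powr a))) * (B * 4 powr a)"
        proof (cases "norm w < 1")
          case True
          have ny: "norm y < 1" using dir_deriv_affine(1)[OF u(1) z _ _ True, of t] t y by simp
          \<comment> \<open>With \<open>t \<le> 1/2\<close> the contraction at most halves the
            distance to the sphere: \<open>1 - |w| \<le> 2 (1 - |y|)\<close>, so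
            \<open>rho w \<le> 4 * rho y\<close>. Raising this to the power \<open>a\<close> uses
            \<open>0 < a\<close>.\<close>
          have "norm y \<le> t * norm z + (1 - t) * norm w"
            using norm_triangle_ineq[of "t *\<^sub>R z" "(1 - t) *\<^sub>R w"] t by (simp add: y)
          also have "t * norm z \<le> t * 1" using t z by (intro mult_left_mono) auto
          finally have "(1 - t) * (1 - norm w) \<le> 1 - norm y" by (simp add: algebra_simps)
          moreover have "1 / 2 * (1 - norm w) \<le> (1 - t) * (1 - norm w)" using t True by (intro mult_right_mono) auto
          ultimately have "1 / 2 * (1 - norm w) \<le> 1 - norm y" by (rule order_trans[rotated])
          then have "1 - norm w \<le> 2 * (1 - norm y)" by simp
          have "rho w \<le> 2 * (1 - norm w)" by (rule rho_le[OF less_imp_le[OF True]])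
          also have "\<dots> \<le> 2 * (2 * (1 - norm y))" by (rule mult_left_mono) (fact, simp)
          also have "\<dots> \<le> 2 * (2 * rho y)" by (intro mult_left_mono le_rho less_imp_le[OF ny]) auto
          finally have "rho w \<le> 4 * rho y" by simp
          then have "rho w powr a \<le> (4 * rho y) powr a" using rho_pos[OF True] a by (intro powr_mono2) auto
          moreover have "(4 * rho y) powr a = 4 powr a * rho y powr a"
            using rho_pos[OF ny] by (subst powr_mult) auto
          ultimately have rr: "rho w powr a \<le> 4 powr a * rho y powr a" by (simp only:)
          have "norm (?H (?e k) y) = cmod (u y) * cmod (K w) * rho w powr a"
            using True y unfolding h_def t_def[symmetric] w_def[symmetric] by (simp add: norm_mult)
          also have "\<dots> \<le> cmod (u y) * B * (4 powr a * rho y powr a)"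
            using B True rr by (intro mult_mono mult_nonneg_nonneg) auto
          finally show ?thesis using ny by (simp add: norm_mult mult_ac)
        next
          case False
          then have H0: "?H (?e k) y = 0"
            unfolding h_def t_def[symmetric] w_def[symmetric] by simp
          show ?thesis unfolding H0 using B by simp
        qed
      qed
      show "AE y in lborel. (\<lambda>k. ?H (?e k) y) \<longlonglongrightarrow> h 0 y"
      proof (intro AE_I2)
        fix y :: "complex ^ 'n"
        define W where "W = (\<lambda>k. (1 / (1 - ?e k)) *\<^sub>R (y - ?e k *\<^sub>R z))"
        have Wy: "?e k *\<^sub>R z + (1 - ?e k) *\<^sub>R W k = y" for k
          unfolding W_def by (rule pt[symmetric]) (rule e)
        show "(\<lambda>k. ?H (?e k) y) \<longlonglongrightarrow> h 0 y"
        proof (cases "norm y < 1")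
          case True
          have "W \<longlonglongrightarrow> (1 / (1 - 0)) *\<^sub>R (y - 0 *\<^sub>R z)"
            unfolding W_def by (intro tendsto_intros e0) auto
          then have W: "W \<longlonglongrightarrow> y" by simp
          have ev: "\<forall>\<^sub>F k in sequentially. norm (W k) < 1"
            by (rule order_tendstoD(2)[OF tendsto_norm[OF W] True])
          have "isCont K y" using holomorphic_ballD(1)[OF hK True] by (rule has_derivative_continuous)
          then have KW: "(\<lambda>k. K (W k)) \<longlonglongrightarrow> K y" by (rule isCont_tendsto_compose[OF _ W])
          have "(\<lambda>k. u y * cnj (K (W k)) * of_real (rho (W k) powr a)) \<longlonglongrightarrow> u y * cnj (K y) * of_real (rho y powr a)"
            by (intro tendsto_intros KW W) (use rho_pos[OF True] in auto)
          then have "(\<lambda>k. h (?e k) (W k)) \<longlonglongrightarrow> u y * cnj (K y) * of_real (rho y powr a)"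
          proof (rule Lim_transform_eventually)
            show "\<forall>\<^sub>F k in sequentially. u y * cnj (K (W k)) * of_real (rho (W k) powr a) = h (?e k) (W k)"
              using ev by (rule eventually_mono) (simp only: h_def Wy, simp)
          qed
          then show ?thesis using True unfolding W_def by (simp add: h_def)
        next
          case False
          have "\<not> norm (W k) < 1" for k
            using dir_deriv_affine(1)[OF u(1) z _ _, of "?e k" "W k"] e[of k] False unfolding Wy by auto
          then have hW: "h (?e k) (W k) = 0" for k unfolding h_def by simp
          have h0: "h 0 y = 0" using False by (simp add: h_def)
          show ?thesis using hW unfolding h0 W_def by (simp only: tendsto_const)
        qed
      qed
    qed
    then have 1: "(\<lambda>k. (LINT y|lborel. ?H (?e k) y) / ?c) \<longlonglongrightarrow> (LINT y|lborel. h 0 y) / ?c"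
      by (intro tendsto_intros) (use nu_mass_pos[OF a', where 'n = 'n] in auto)
    have 2: "(LINT y|lborel. h 0 y) / ?c = (LINT w|nu a. u w * cnj (K w))"
      using nu_integral(2)[OF a' mG[of 0]] by (simp add: h_def)
    have "(\<lambda>k. (1 / (1 - ?e k) ^ DIM(complex ^ 'n)) *\<^sub>R ((LINT y|lborel. ?H (?e k) y) / ?c)) \<longlonglongrightarrow> (1 / (1 - 0) ^ DIM(complex ^ 'n)) *\<^sub>R ((LINT y|lborel. h 0 y) / ?c)"
      by (intro tendsto_intros 1 e0) auto
    moreover have "(1 / (1 - ?e k) ^ DIM(complex ^ 'n)) *\<^sub>R ((LINT y|lborel. ?H (?e k) y) / ?c) = G (?e k)" for k
      using G_eq[of "?e k"] e[of k] by (simp flip: G_eq)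
    ultimately show ?thesis unfolding 2 by simp
  qed
  have "G (?e k) = G (1/2)" "G (1 - ?e k) = G (1/2)" for k
    using e[of k] by (intro Gconst; simp)+
  then show ?thesis
    using lim0 lim1 unfolding K_def[symmetric] by (simp add: LIMSEQ_const_iff)
qed

text \<open>The weight \<open>a + 1\<close> is positive, and \<open>weight_shift\<close> identifies
  its projection with that of weight \<open>a\<close>.\<close>

theorem reproducing_formula:
  fixes u :: "complex ^ 'n \<Rightarrow> complex"
  assumes a: "-1 < a" and u: "holomorphic_ball u" "integrable (nu a) u" and z: "norm z < 1"
  shows "(LINT w|nu a. u w * cnj (kern (real CARD('n) + 1 + a) z w)) = u z"
proof -
  have "integrable (nu a) (\<lambda>w. u w * of_real (rho w))"
  proof (rule integrable_nu_mult_bounded[OF a u(2)])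
    show "norm (of_real (rho w) :: complex) \<le> 1" if "norm w < 1" for w :: "complex ^ 'n"
      unfolding norm_of_real using rho_pos[OF that] by simp
  qed (intro continuous_on_measurable_nu continuous_intros)
  then have "integrable (nu (a + 1)) u"
    using nu_shift(1)[OF a holomorphic_measurable_nu[OF u(1)]] by simp
  then have "(LINT w|nu (a + 1). u w * cnj (kern (real CARD('n) + 1 + (a + 1)) z w)) = u z"
    by (intro reproducing_formula_pos u z) (use a in auto)
  then show ?thesis
    using weight_shift[OF a u z] by (simp add: add_ac)
qed

subsection \<open>Forelli-Rudin estimates\<close>

lemma kern_diag:
  assumes "norm z < 1"
  shows "kern s z z = of_real (rho z powr (- s))"
proof -
  have "1 - herm z z = of_real (rho z)" by (simp add: herm_self)
  moreover have "complex_of_real (rho z) powr complex_of_real (- s) = of_real (rho z powr (- s))"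
    using rho_pos[OF assms] by (intro powr_of_real) simp
  ultimately show ?thesis by (simp add: kern_def)
qed

lemma cmod_kern_add: "cmod (kern (s + t) z w) = cmod (kern s z w) * cmod (kern t z w)"
  by (simp add: kern_mult[symmetric] norm_mult)

lemma cmod_kern_commute: "cmod (kern s z w) = cmod (kern s w z)"
  by (simp add: cmod_kern cmod_one_minus_herm_commute)

lemma measurable_kern1 [measurable]: "kern s z \<in> borel_measurable borel"
  unfolding kern_def powr_def by measurable

lemma measurable_cmod_kern_nu: "(\<lambda>w. cmod (kern s z w)) \<in> borel_measurable (nu a)"
proof -
  have "(\<lambda>w. cmod (kern s z w)) \<in> borel_measurable borel" by measurable
  then show ?thesis by (rule measurable_compose[OF measurable_id_nu])
qed

text \<open>The reproducing formula for \<open>u * kern N z\<close>: the product of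
  \<open>kern N z w\<close> with its conjugate is \<open>|kern (2 * N) z w|\<close>, and the kernel
  on the diagonal is \<open>rho z powr (- N)\<close>.\<close>

lemma kern_reproducing:
  fixes u :: "complex ^ 'n \<Rightarrow> complex"
  assumes a: "-1 < a" and u: "holomorphic_ball u" "integrable (nu a) u" and z: "norm z < 1"
  defines "N \<equiv> real CARD('n) + 1 + a"
  shows "(LINT w|nu a. u w * of_real (cmod (kern (2 * N) z w))) = u z * of_real (rho z powr (- N))"
proof -
  have hk: "holomorphic_ball (kern N z)" by (rule holomorphic_ball_kern[OF z])
  obtain B where B: "\<And>w :: complex ^ 'n. norm w \<le> 1 \<Longrightarrow> cmod (kern N z w) \<le> B" using cmod_kern_bound[OF z] by metis
  have int: "integrable (nu a) (\<lambda>w. u w * kern N z w)"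
    by (rule integrable_nu_mult_bounded[OF a u(2) holomorphic_measurable_nu[OF hk], where B = B]) (use B in auto)
  have "(LINT w|nu a. (u w * kern N z w) * cnj (kern N z w)) = u z * kern N z z"
    using reproducing_formula[OF a holomorphic_ball_mult[OF u(1) hk] int z] unfolding N_def .
  moreover have "kern N z w * cnj (kern N z w) = of_real (cmod (kern (2 * N) z w))" for w
    unfolding complex_norm_square[symmetric] mult_2 cmod_kern_add by (simp add: power2_eq_square)
  ultimately show ?thesis by (simp add: kern_diag[OF z] mult.assoc)
qed

lemma nn_integral_kern_double:
  fixes z :: "complex ^ 'n"
  assumes a: "-1 < a" and z: "norm z < 1"
  defines "N \<equiv> real CARD('n) + 1 + a"
  shows "(\<integral>\<^sup>+w. ennreal (cmod (kern (2 * N) z w)) \<partial>nu a) = ennreal (rho z powr (- N))"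
proof -
  obtain B where B: "\<And>w :: complex ^ 'n. norm w \<le> 1 \<Longrightarrow> cmod (kern (2 * N) z w) \<le> B" using cmod_kern_bound[OF z] by metis
  have int: "integrable (nu a) (\<lambda>w. cmod (kern (2 * N) z w))"
    by (rule integrable_nu_bounded[OF a measurable_cmod_kern_nu, where B = B]) (use B in auto)
  have "(LINT w|nu a. 1 * complex_of_real (cmod (kern (2 * N) z w))) = 1 * of_real (rho z powr (- N))"
    unfolding N_def by (rule kern_reproducing[OF a holomorphic_ball_const _ z])
      (rule integrable_nu_bounded[OF a, where B = 1], auto)
  then have "complex_of_real (LINT w|nu a. cmod (kern (2 * N) z w)) = of_real (rho z powr (- N))"
    by simp
  then have "(LINT w|nu a. cmod (kern (2 * N) z w)) = rho z powr (- N)"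
    by (simp only: of_real_eq_iff)
  then show ?thesis
    using nn_integral_eq_integral[OF int] by simp
qed

lemma nn_integral_powr_tail:
  assumes "0 < c" "0 < d" "d \<le> 1"
  shows "(\<integral>\<^sup>+t. ennreal (t powr (- c - 1)) * indicator {d..1} t \<partial>lborel) \<le> ennreal (d powr (- c) / c)"
proof -
  have "(\<integral>\<^sup>+t. ennreal (t powr (- c - 1)) * indicator {d..1} t \<partial>lborel) = ennreal ((- (1 powr (- c) / c)) - (- (d powr (- c) / c)))"
  proof (rule nn_integral_FTC_Icc)
    show "((\<lambda>t. - (t powr (- c) / c)) has_real_derivative t powr (- c - 1)) (at t)" if "t \<in> {d..1}" for t
      using that assms by (auto intro!: derivative_eq_intros)
  qed (use assms in auto)
  also have "\<dots> \<le> ennreal (d powr (- c) / c)" using assms by (intro ennreal_leI) simp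
  finally show ?thesis .
qed

text \<open>The base \<open>1 - (1 - t) * r\<close> is at least \<open>t\<close> and at least
  \<open>1 - r\<close>; the integral is split at \<open>t = 1 - r\<close>, using the better bound on
  each side. Since \<open>1 \<le> M - c\<close>, the power of \<open>t\<close> in front is
  nondecreasing.\<close>

lemma nn_integral_radial_kernel_le:
  assumes c: "0 < c" and M: "1 \<le> M - c" and r: "0 \<le> r" "r < 1"
  shows "(\<integral>\<^sup>+t. ennreal (t powr (M - c - 1) * (1 - (1 - t) * r) powr (- M)) * indicator {0..1} t \<partial>lborel)
     \<le> ennreal ((1 + 1 / c) * (1 - r) powr (- c))"
proof -
  let ?d = "1 - r"
  have d: "0 < ?d" "?d \<le> 1" using r by auto
  have pt: "ennreal (t powr (M - c - 1) * (1 - (1 - t) * r) powr (- M)) * indicator {0..1} t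
     \<le> ennreal (?d powr (- c - 1)) * indicator {0..?d} t + ennreal (t powr (- c - 1)) * indicator {?d..1} t" for t
  proof (cases "t \<in> {0..1}")
    case True
    have ge1: "t \<le> 1 - (1 - t) * r"
      using True r mult_left_mono[of r 1 "1 - t"] by simp
    have ge2: "?d \<le> 1 - (1 - t) * r"
      using True r mult_right_mono[of "1 - t" 1 r] by simp
    show ?thesis
    proof (cases "t \<le> ?d")
      case True
      have "t powr (M - c - 1) * (1 - (1 - t) * r) powr (- M) \<le> ?d powr (M - c - 1) * ?d powr (- M)"
        using True \<open>t \<in> {0..1}\<close> M c d ge2 by (intro mult_mono powr_mono2 powr_mono2') auto
      also have "\<dots> = ?d powr (- c - 1)" by (subst powr_add[symmetric]) simp
      finally have "ennreal (t powr (M - c - 1) * (1 - (1 - t) * r) powr (- M)) \<le> ennreal (?d powr (- c - 1))"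
        by (rule ennreal_leI)
      moreover have "indicator {0..1} t = (1 :: ennreal)" "indicator {0..?d} t = (1 :: ennreal)"
        using True \<open>t \<in> {0..1}\<close> by auto
      ultimately show ?thesis by (simp only: mult_1_right) (rule add_increasing2, auto)
    next
      case False
      then have t: "0 < t" using d by simp
      have "t powr (M - c - 1) * (1 - (1 - t) * r) powr (- M) \<le> t powr (M - c - 1) * t powr (- M)"
        using M c t ge1 by (intro mult_left_mono powr_mono2') auto
      also have "\<dots> = t powr (- c - 1)" by (subst powr_add[symmetric]) simp
      finally have "ennreal (t powr (M - c - 1) * (1 - (1 - t) * r) powr (- M)) \<le> ennreal (t powr (- c - 1))"
        by (rule ennreal_leI)
      then show ?thesis using False \<open>t \<in> {0..1}\<close> by simp
    qed
  qed simp
  have "(\<integral>\<^sup>+t. ennreal (t powr (M - c - 1) * (1 - (1 - t) * r) powr (- M)) * indicator {0..1} t \<partial>lborel)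
     \<le> (\<integral>\<^sup>+t. ennreal (?d powr (- c - 1)) * indicator {0..?d} t + ennreal (t powr (- c - 1)) * indicator {?d..1} t \<partial>lborel)"
    by (intro nn_integral_mono pt)
  also have "\<dots> = (\<integral>\<^sup>+t. ennreal (?d powr (- c - 1)) * indicator {0..?d} t \<partial>lborel) + (\<integral>\<^sup>+t. ennreal (t powr (- c - 1)) * indicator {?d..1} t \<partial>lborel)"
    by (rule nn_integral_add) auto
  also have "(\<integral>\<^sup>+t. ennreal (?d powr (- c - 1)) * indicator {0..?d} t \<partial>lborel) = ennreal (?d powr (- c - 1)) * ennreal ?d"
    using d by (subst nn_integral_cmult_indicator) auto
  also have "\<dots> = ennreal (?d powr (- c))"
    using d powr_add[of ?d "- c - 1" 1] by (simp add: ennreal_mult[symmetric])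
  also have "ennreal (?d powr (- c)) + (\<integral>\<^sup>+t. ennreal (t powr (- c - 1)) * indicator {?d..1} t \<partial>lborel)
     \<le> ennreal (?d powr (- c)) + ennreal (?d powr (- c) / c)"
    by (intro add_left_mono nn_integral_powr_tail c d)
  also have "\<dots> = ennreal ((1 + 1 / c) * ?d powr (- c))"
    using c by (simp add: ennreal_plus[symmetric] field_simps del: ennreal_plus)
  finally show ?thesis .
qed

text \<open>Let \<open>x = |1 - herm w z|\<close>. For \<open>t\<close> in \<open>[x/4, x/2]\<close>
  the kernel at \<open>(1 - t) z\<close> still has base at most \<open>2 * x\<close>, so this
  interval of length \<open>x/4\<close> alone contributes a multiple of \<open>x\<close> to the
  power \<open>(M - c - 1) - 2 M + 1 = - (M + c)\<close>. The constant collects the powers of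
  4.\<close>

lemma cmod_kern_le_radial_average:
  fixes z w :: "complex ^ 'n"
  assumes c: "0 < c" and M: "1 \<le> M - c" and z: "norm z < 1" and w: "norm w < 1"
  shows "ennreal (cmod (kern (M + c) z w)) \<le> ennreal (4 powr (2 * M - c)) *
     (\<integral>\<^sup>+t. ennreal (t powr (M - c - 1) * cmod (kern (2 * M) ((1 - t) *\<^sub>R z) w)) * indicator {0..1} t \<partial>lborel)"
proof -
  define x where "x = cmod (1 - herm w z)"
  have x: "0 < x" "x \<le> 2"
    using Re_one_minus_herm(4)[OF norm_mult_less_1[OF z less_imp_le[OF w]]] cmod_one_minus_herm_le[of z w] z w
    by (auto simp: x_def)
  have M0: "0 < M" using c M by simp
  have pt: "ennreal ((x / 4) powr (M - c - 1) * (2 * x) powr (- (2 * M))) * indicator {x/4..x/2} t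
     \<le> ennreal (t powr (M - c - 1) * cmod (kern (2 * M) ((1 - t) *\<^sub>R z) w)) * indicator {0..1} t" for t
  proof (cases "t \<in> {x/4..x/2}")
    case True
    then have t: "0 \<le> t" "t \<le> 1" "x / 4 \<le> t" "t \<le> x / 2" using x by auto
    have n: "norm ((1 - t) *\<^sub>R z) < 1" using t z mult_mono[of "1 - t" 1 "norm z" "norm z"] by simp
    have eq: "1 - herm w ((1 - t) *\<^sub>R z) = (1 - herm w z) + of_real t * herm w z"
      unfolding herm_scaleR_right by (simp add: algebra_simps)
    have "cmod (1 - herm w ((1 - t) *\<^sub>R z)) \<le> x + t * cmod (herm w z)"
      unfolding eq x_def using norm_triangle_ineq[of "1 - herm w z" "of_real t * herm w z"] t by (simp add: norm_mult)
    also have "t * cmod (herm w z) \<le> t * 1"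
      using cmod_herm_le[of w z] norm_mult_less_1[OF w, of z] z t by (intro mult_left_mono) auto
    finally have le: "cmod (1 - herm w ((1 - t) *\<^sub>R z)) \<le> 2 * x" using t x by linarith
    have pos: "0 < cmod (1 - herm w ((1 - t) *\<^sub>R z))"
      using Re_one_minus_herm(4)[OF norm_mult_less_1[OF n less_imp_le[OF w]]] by simp
    have "(x / 4) powr (M - c - 1) * (2 * x) powr (- (2 * M)) \<le> t powr (M - c - 1) * cmod (kern (2 * M) ((1 - t) *\<^sub>R z) w)"
      unfolding cmod_kern using M c x t le pos M0 by (intro mult_mono powr_mono2 powr_mono2') auto
    then show ?thesis using True t by (simp add: indicator_def ennreal_leI)
  qed simp
  have "ennreal ((x / 4) powr (M - c - 1) * (2 * x) powr (- (2 * M))) * ennreal (x / 4)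
     = (\<integral>\<^sup>+t. ennreal ((x / 4) powr (M - c - 1) * (2 * x) powr (- (2 * M))) * indicator {x/4..x/2} t \<partial>lborel)"
    using x by (subst nn_integral_cmult_indicator) auto
  also have "\<dots> \<le> (\<integral>\<^sup>+t. ennreal (t powr (M - c - 1) * cmod (kern (2 * M) ((1 - t) *\<^sub>R z) w)) * indicator {0..1} t \<partial>lborel)"
    by (intro nn_integral_mono pt)
  finally have "ennreal (4 powr (2 * M - c)) * (ennreal ((x / 4) powr (M - c - 1) * (2 * x) powr (- (2 * M))) * ennreal (x / 4))
     \<le> ennreal (4 powr (2 * M - c)) * (\<integral>\<^sup>+t. ennreal (t powr (M - c - 1) * cmod (kern (2 * M) ((1 - t) *\<^sub>R z) w)) * indicator {0..1} t \<partial>lborel)"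
    by (rule mult_left_mono) simp
  moreover have "4 powr (2 * M - c) * ((x / 4) powr (M - c - 1) * (2 * x) powr (- (2 * M)) * (x / 4)) = cmod (kern (M + c) z w)"
  proof -
    have "(x / 4) powr (M - c - 1) * (x / 4) = (x / 4) powr (M - c)"
      using x powr_add[of "x / 4" "M - c - 1" 1] by simp
    also have "\<dots> = x powr (M - c) / 4 powr (M - c)" using x by (simp add: powr_divide)
    finally have 1: "(x / 4) powr (M - c - 1) * (x / 4) = x powr (M - c) / 4 powr (M - c)" .
    have "2 powr (- (2 * M)) = ((2 :: real) powr 2) powr (- M)" by (simp only: powr_powr) simp
    then have 2: "(2 * x) powr (- (2 * M)) = 4 powr (- M) * x powr (- (2 * M))"
      by (simp add: powr_mult)
    have 3: "x powr (M - c) * x powr (- (2 * M)) = x powr (- (M + c))" by (subst powr_add[symmetric]) simp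
    have 4: "4 powr (2 * M - c) * 4 powr (- M) / 4 powr (M - c) = (1 :: real)"
      by (simp add: powr_add[symmetric] powr_diff[symmetric])
    have "4 powr (2 * M - c) * ((x / 4) powr (M - c - 1) * (2 * x) powr (- (2 * M)) * (x / 4))
      = 4 powr (2 * M - c) * ((2 * x) powr (- (2 * M)) * ((x / 4) powr (M - c - 1) * (x / 4)))"
      by (simp only: mult_ac)
    also have "\<dots> = (4 powr (2 * M - c) * 4 powr (- M) / 4 powr (M - c)) * (x powr (M - c) * x powr (- (2 * M)))"
      unfolding 1 2 by (simp add: mult_ac)
    also have "\<dots> = cmod (kern (M + c) z w)"
      using 3 4 by (simp add: cmod_kern x_def[symmetric])
    finally show ?thesis .
  qed
  ultimately show ?thesis
    using x by (simp only: ennreal_mult'[symmetric] ennreal_mult''[symmetric] powr_ge_zero mult_nonneg_nonneg divide_nonneg_pos less_imp_le zero_less_numeral)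
qed

text \<open>After averaging and an exchange of integrals, the inner integral has exponent
  \<open>2 * M\<close> and is known exactly at each point \<open>(1 - t) z\<close>; a
  one-dimensional integral in \<open>t\<close> remains.\<close>

theorem forelli_rudin:
  assumes b: "-1 < b" and c: "0 < c" and M: "1 \<le> M - c" and M_def: "M = real CARD('n) + 1 + b"
  shows "\<exists>C>0. \<forall>z :: complex ^ 'n. norm z < 1 \<longrightarrow>
    (\<integral>\<^sup>+w. ennreal (cmod (kern (M + c) z w)) \<partial>nu b) \<le> ennreal (C * rho z powr (- c))"
proof -
  define K where "K = 4 powr (2 * M - c)"
  define C where "C = K * ((1 + 1 / c) * 2 powr c)"
  have K: "0 < K" by (simp add: K_def)
  have M0: "0 < M" using c M by simp
  show ?thesis
  proof (intro exI[of _ C] conjI allI impI)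
    show "0 < C" using K c by (simp add: C_def add_pos_pos)
    fix z :: "complex ^ 'n" assume z: "norm z < 1"
    interpret nu: sigma_finite_measure "nu b :: (complex ^ 'n) measure" by (rule sigma_finite_nu[OF b])
    interpret pair_sigma_finite lborel "nu b :: (complex ^ 'n) measure"
      by (intro pair_sigma_finite.intro lborel.sigma_finite_measure_axioms nu.sigma_finite_measure_axioms)
    let ?f = "\<lambda>t w. ennreal (t powr (M - c - 1) * cmod (kern (2 * M) ((1 - t) *\<^sub>R z) w)) * indicator {0..1} t"
    have mf: "fst \<in> lborel \<Otimes>\<^sub>M (nu b :: (complex ^ 'n) measure) \<rightarrow>\<^sub>M borel"
      using measurable_fst[of lborel "nu b :: (complex ^ 'n) measure"] by simp
    have ms: "snd \<in> lborel \<Otimes>\<^sub>M (nu b :: (complex ^ 'n) measure) \<rightarrow>\<^sub>M borel"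
      by (rule measurable_compose[OF measurable_snd measurable_id_nu])
    have m1: "(\<lambda>p. kern (2 * M) ((1 - fst p) *\<^sub>R z) (snd p)) \<in> borel_measurable (lborel \<Otimes>\<^sub>M nu b)"
    proof -
      have "(\<lambda>t. (1 - t) *\<^sub>R z) \<in> borel_measurable borel" by measurable
      from measurable_compose[OF measurable_Pair[OF measurable_compose[OF mf this] ms] measurable_kern]
      show ?thesis by simp
    qed
    have mi: "(\<lambda>t :: real. ennreal (t powr (M - c - 1)) * indicator {0..1} t) \<in> borel_measurable borel"
      by measurable
    have m: "case_prod ?f \<in> borel_measurable (lborel \<Otimes>\<^sub>M nu b)"
    proof -
      have "case_prod ?f = (\<lambda>p. ennreal (fst p powr (M - c - 1)) * indicator {0..1} (fst p) * ennreal (cmod (kern (2 * M) ((1 - fst p) *\<^sub>R z) (snd p))))"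
        by (auto simp: fun_eq_iff ennreal_mult mult_ac)
      then show ?thesis
        by (simp only:) (intro borel_measurable_times_ennreal measurable_compose[OF mf mi] measurable_compose[OF measurable_compose[OF m1 borel_measurable_norm] measurable_ennreal])
    qed
    have "(\<integral>\<^sup>+w. ennreal (cmod (kern (M + c) z w)) \<partial>nu b) \<le> (\<integral>\<^sup>+w. ennreal K * (\<integral>\<^sup>+t. ?f t w \<partial>lborel) \<partial>nu b)"
      unfolding K_def by (intro nn_integral_mono cmod_kern_le_radial_average c M z) simp
    also have "\<dots> = ennreal K * (\<integral>\<^sup>+w. (\<integral>\<^sup>+t. ?f t w \<partial>lborel) \<partial>nu b)"
      using lborel.borel_measurable_nn_integral_fst[OF measurable_pair_swap[OF m]] by (intro nn_integral_cmult) simp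
    also have "(\<integral>\<^sup>+w. (\<integral>\<^sup>+t. ?f t w \<partial>lborel) \<partial>nu b) = (\<integral>\<^sup>+t. (\<integral>\<^sup>+w. ?f t w \<partial>nu b) \<partial>lborel)"
      by (rule Fubini'[OF m])
    also have "\<dots> \<le> (\<integral>\<^sup>+t. ennreal (t powr (M - c - 1) * (1 - (1 - t) * norm z) powr (- M)) * indicator {0..1} t \<partial>lborel)"
    proof (rule nn_integral_mono)
      fix t :: real
      show "(\<integral>\<^sup>+w. ?f t w \<partial>nu b) \<le> ennreal (t powr (M - c - 1) * (1 - (1 - t) * norm z) powr (- M)) * indicator {0..1} t"
      proof (cases "t \<in> {0..1}")
        case True
        have n: "norm ((1 - t) *\<^sub>R z) < 1" using True z mult_mono[of "1 - t" 1 "norm z" "norm z"] by simp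
        have "(\<integral>\<^sup>+w. ?f t w \<partial>nu b) = (\<integral>\<^sup>+w. ennreal (t powr (M - c - 1)) * ennreal (cmod (kern (2 * M) ((1 - t) *\<^sub>R z) w)) \<partial>nu b)"
          using True by (simp add: ennreal_mult)
        also have "\<dots> = ennreal (t powr (M - c - 1)) * (\<integral>\<^sup>+w. ennreal (cmod (kern (2 * M) ((1 - t) *\<^sub>R z) w)) \<partial>nu b)"
          by (rule nn_integral_cmult) (intro measurable_compose[OF _ measurable_ennreal] measurable_cmod_kern_nu)
        also have "\<dots> = ennreal (t powr (M - c - 1)) * ennreal (rho ((1 - t) *\<^sub>R z) powr (- M))"
          unfolding M_def by (subst nn_integral_kern_double[OF b n]) simp
        also have "\<dots> \<le> ennreal (t powr (M - c - 1)) * ennreal ((1 - (1 - t) * norm z) powr (- M))"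
        proof -
          have "norm ((1 - t) *\<^sub>R z) = (1 - t) * norm z" using True by simp
          then have "1 - (1 - t) * norm z \<le> rho ((1 - t) *\<^sub>R z)" "0 < 1 - (1 - t) * norm z"
            using le_rho[OF less_imp_le[OF n]] n by (simp_all only: diff_gt_0_iff_gt)
          then show ?thesis using M0 by (intro mult_left_mono ennreal_leI powr_mono2') auto
        qed
        finally show ?thesis using True by (simp add: ennreal_mult)
      qed simp
    qed
    also have "\<dots> \<le> ennreal ((1 + 1 / c) * (1 - norm z) powr (- c))"
      by (rule nn_integral_radial_kernel_le[OF c M]) (use z in auto)
    also have "\<dots> \<le> ennreal ((1 + 1 / c) * (2 powr c * rho z powr (- c)))"
    proof (intro ennreal_leI mult_left_mono)
      have "rho z / 2 \<le> 1 - norm z" using rho_le[OF less_imp_le[OF z]] by simp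
      then have "(1 - norm z) powr (- c) \<le> (rho z / 2) powr (- c)"
        using c rho_pos[OF z] by (intro powr_mono2') auto
      also have "\<dots> = 2 powr c * rho z powr (- c)"
        by (simp only: powr_divide powr_minus) (simp add: field_simps)
      finally show "(1 - norm z) powr (- c) \<le> 2 powr c * rho z powr (- c)" .
    qed (use c in auto)
    finally have "(\<integral>\<^sup>+w. ennreal (cmod (kern (M + c) z w)) \<partial>nu b) \<le> ennreal K * ennreal ((1 + 1 / c) * (2 powr c * rho z powr (- c)))"
      by (simp add: mult_left_mono)
    also have "\<dots> = ennreal (C * rho z powr (- c))"
      using K by (subst ennreal_mult'[symmetric]) (auto simp: C_def mult_ac)
    finally show "(\<integral>\<^sup>+w. ennreal (cmod (kern (M + c) z w)) \<partial>nu b) \<le> ennreal (C * rho z powr (- c))" .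
  qed
qed

text \<open>The factor \<open>rho w powr (- s)\<close> is absorbed into the measure, which becomes
  \<open>nu (a - s)\<close> with critical exponent \<open>M = N - s\<close>; thus
  \<open>N = M + s\<close>. The bound on \<open>s\<close> gives both \<open>-1 < a - s\<close> and
  \<open>1 \<le> M - s\<close>.\<close>

corollary schur_weight:
  assumes a: "-1 < a" and s: "0 < s" "s \<le> (1 + a) / 2"
  shows "\<exists>C>0. \<forall>z :: complex ^ 'n. norm z < 1 \<longrightarrow>
    (\<integral>\<^sup>+w. ennreal (cmod (kern (real CARD('n) + 1 + a) z w) * rho w powr (- s)) \<partial>nu a) \<le> ennreal (C * rho z powr (- s))"
proof -
  define b where "b = a - s"
  define M where "M = real CARD('n) + 1 + b"
  have b: "-1 < b" using a s by (simp add: b_def field_simps)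
  have "1 \<le> real CARD('n)" by (simp add: Suc_leI)
  moreover have "2 * s \<le> 1 + a" using s by simp
  ultimately have M: "1 \<le> M - s" unfolding M_def b_def by linarith
  obtain C where C: "0 < C" "\<And>z :: complex ^ 'n. norm z < 1 \<Longrightarrow>
    (\<integral>\<^sup>+w. ennreal (cmod (kern (M + s) z w)) \<partial>nu b) \<le> ennreal (C * rho z powr (- s))"
    using forelli_rudin[OF b s(1) M M_def] by blast
  let ?r = "nu_mass TYPE('n) b / nu_mass TYPE('n) a"
  have mass: "0 < nu_mass TYPE('n) b" "0 < nu_mass TYPE('n) a" by (rule nu_mass_pos[OF b], rule nu_mass_pos[OF a])
  then have r: "0 < ?r" by simp
  show ?thesis
  proof (intro exI[of _ "?r * C"] conjI allI impI)
    show "0 < ?r * C" by (rule mult_pos_pos[OF r C(1)])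
    fix z :: "complex ^ 'n" assume z: "norm z < 1"
    have MN: "M + s = real CARD('n) + 1 + a" by (simp add: M_def b_def)
    have mk: "(\<lambda>w. ennreal (cmod (kern (M + s) z w))) \<in> borel_measurable (nu b)"
      by (intro measurable_compose[OF _ measurable_ennreal] measurable_cmod_kern_nu)
    have "(\<lambda>w :: complex ^ 'n. rho w powr (- s)) \<in> borel_measurable borel" by measurable
    then have mr: "(\<lambda>w :: complex ^ 'n. rho w powr (- s)) \<in> borel_measurable (nu a)"
      by (rule measurable_compose[OF measurable_id_nu])
    have "(\<integral>\<^sup>+w. ennreal (cmod (kern (M + s) z w) * rho w powr (- s)) \<partial>nu a)
      = (\<integral>\<^sup>+w. ennreal (rho w powr a / nu_mass TYPE('n) a) * ennreal (cmod (kern (M + s) z w) * rho w powr (- s)) * indicator unit_ball w \<partial>lborel)"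
      by (rule nn_integral_nu[OF a])
         (intro measurable_compose[OF _ measurable_ennreal] borel_measurable_times measurable_cmod_kern_nu mr)
    also have "\<dots> = (\<integral>\<^sup>+w. ennreal ?r * (ennreal (rho w powr b / nu_mass TYPE('n) b) * ennreal (cmod (kern (M + s) z w)) * indicator unit_ball w) \<partial>lborel)"
    proof (rule nn_integral_cong)
      fix w :: "complex ^ 'n"
      have E: "rho w powr a / nu_mass TYPE('n) a * (cmod (kern (M + s) z w) * rho w powr (- s))
        = ?r * (rho w powr b / nu_mass TYPE('n) b * cmod (kern (M + s) z w))"
        using mass by (simp add: b_def powr_diff powr_minus field_simps)
      have "ennreal (rho w powr a / nu_mass TYPE('n) a) * ennreal (cmod (kern (M + s) z w) * rho w powr (- s))
        = ennreal (rho w powr a / nu_mass TYPE('n) a * (cmod (kern (M + s) z w) * rho w powr (- s)))"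
        using mass by (intro ennreal_mult'[symmetric]) simp
      also have "\<dots> = ennreal ?r * ennreal (rho w powr b / nu_mass TYPE('n) b * cmod (kern (M + s) z w))"
        unfolding E using r by (intro ennreal_mult') simp
      also have "ennreal (rho w powr b / nu_mass TYPE('n) b * cmod (kern (M + s) z w)) = ennreal (rho w powr b / nu_mass TYPE('n) b) * ennreal (cmod (kern (M + s) z w))"
        using mass by (intro ennreal_mult') simp
      finally show "ennreal (rho w powr a / nu_mass TYPE('n) a) * ennreal (cmod (kern (M + s) z w) * rho w powr (- s)) * indicator unit_ball w
        = ennreal ?r * (ennreal (rho w powr b / nu_mass TYPE('n) b) * ennreal (cmod (kern (M + s) z w)) * indicator unit_ball w)"
        by (simp only: mult.assoc)
    qed
    also have "\<dots> = ennreal ?r * (\<integral>\<^sup>+w. ennreal (cmod (kern (M + s) z w)) \<partial>nu b)"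
      unfolding nn_integral_nu[OF b mk]
    proof (rule nn_integral_cmult)
      show "(\<lambda>w. ennreal (rho w powr b / nu_mass TYPE('n) b) * ennreal (cmod (kern (M + s) z w)) * indicator unit_ball w) \<in> borel_measurable lborel"
        by measurable
    qed
    also have "\<dots> \<le> ennreal ?r * ennreal (C * rho z powr (- s))"
      by (intro mult_left_mono C(2) z) simp
    also have "\<dots> = ennreal (?r * C * rho z powr (- s))"
      using r by (subst ennreal_mult'[symmetric]) (auto simp: mult_ac)
    finally show "(\<integral>\<^sup>+w. ennreal (cmod (kern (real CARD('n) + 1 + a) z w) * rho w powr (- s)) \<partial>nu a) \<le> ennreal (?r * C * rho z powr (- s))"
      unfolding MN .
  qed
qed

subsection \<open>Growth functions\<close>

locale dini_growth =
  fixes \<Phi> :: "real \<Rightarrow> real" and q :: real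
  assumes q: "1 \<le> q" and growth: "\<Phi> \<in> growth_class q" and regular: "regular_growth \<Phi>" and dini: "dini \<Phi>"
begin

lemma mono: "0 \<le> x \<Longrightarrow> x \<le> y \<Longrightarrow> \<Phi> x \<le> \<Phi> y"
  using growth unfolding growth_class_def growth_function_def mono_on_def by simp

lemma continuous: "continuous_on {0..} \<Phi>"
  using growth unfolding growth_class_def growth_function_def by auto

lemma range: "\<Phi> ` {0..} = {0..}"
  using growth unfolding growth_class_def growth_function_def by auto

lemma nonneg: "0 \<le> x \<Longrightarrow> 0 \<le> \<Phi> x"
  using range by auto

lemma surj:
  assumes "0 \<le> y"
  obtains x where "0 \<le> x" "\<Phi> x = y"
proof -
  have "y \<in> \<Phi> ` {0..}" using range assms by simp
  then show ?thesis using that by auto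
qed

lemma zero [simp]: "\<Phi> 0 = 0"
proof -
  obtain x where x: "0 \<le> x" "\<Phi> x = 0" using surj[of 0] by auto
  then show ?thesis using mono[of 0 x] nonneg[of 0] by simp
qed

lemma ratio_mono: "0 < x \<Longrightarrow> x \<le> y \<Longrightarrow> \<Phi> x / x \<le> \<Phi> y / y"
  using growth unfolding growth_class_def mono_on_def by auto

lemma upper_type: "\<exists>C>0. \<forall>s>0. \<forall>t\<ge>1. \<Phi> (s * t) \<le> C * t powr q * \<Phi> s"
  using growth unfolding growth_class_def upper_type_def by auto

text \<open>A zero at \<open>x > 0\<close> would propagate to all larger arguments by the upper
  type, against surjectivity.\<close>

lemma pos:
  assumes "0 < x"
  shows "0 < \<Phi> x"
proof (rule ccontr)
  assume "\<not> 0 < \<Phi> x"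
  then have x0: "\<Phi> x = 0" using nonneg[of x] assms by simp
  obtain C where C: "\<And>s t. 0 < s \<Longrightarrow> 1 \<le> t \<Longrightarrow> \<Phi> (s * t) \<le> C * t powr q * \<Phi> s"
    using upper_type by blast
  obtain y where y: "0 \<le> y" "\<Phi> y = 1" using surj[of 1] by auto
  have "\<Phi> (x * max 1 (y / x)) \<le> 0" using C[OF assms, of "max 1 (y / x)"] x0 by simp
  moreover have "y \<le> x * max 1 (y / x)" using assms by (simp add: max_def field_simps)
  ultimately show False using mono[OF y(1), of "x * max 1 (y / x)"] y(2) by simp
qed

lemma scale_le:
  assumes "0 \<le> s" "s \<le> 1" "0 \<le> t"
  shows "\<Phi> (s * t) \<le> s * \<Phi> t"
proof (cases "s = 0 \<or> t = 0")
  case False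
  then have st: "0 < s" "0 < t" using assms by auto
  have "\<Phi> (s * t) / (s * t) \<le> \<Phi> t / t"
    using st assms by (intro ratio_mono) (auto intro: mult_left_le_one_le)
  then show ?thesis using st by (simp add: field_simps)
qed auto

lemma scale_ge:
  assumes "1 \<le> s" "0 \<le> t"
  shows "s * \<Phi> t \<le> \<Phi> (s * t)"
proof -
  have "\<Phi> (1 / s * (s * t)) \<le> 1 / s * \<Phi> (s * t)"
    using assms by (intro scale_le) auto
  then show ?thesis using assms by (simp add: field_simps)
qed

lemma measurable_comp:
  assumes "f \<in> borel_measurable M" "\<And>x. x \<in> space M \<Longrightarrow> 0 \<le> f x"
  shows "(\<lambda>x. \<Phi> (f x)) \<in> borel_measurable M"
proof -
  have "continuous_on UNIV (\<lambda>x. \<Phi> (max 0 x))"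
    by (rule continuous_on_compose2[OF continuous]) (auto intro!: continuous_intros)
  then have "(\<lambda>x. \<Phi> (max 0 x)) \<in> borel_measurable borel" by (rule borel_measurable_continuous_onI)
  from measurable_compose[OF assms(1) this] show ?thesis
    by (rule measurable_cong[THEN iffD1, rotated]) (simp add: assms(2))
qed

lemma tangent:
  assumes "0 < x"
  obtains k where "\<And>y. 0 \<le> y \<Longrightarrow> \<Phi> x + k * (y - x) \<le> \<Phi> y"
proof -
  have conv: "convex_on {0..} \<Phi>" and "\<Phi> differentiable (at x)"
    using regular assms unfolding regular_growth_def by auto
  then obtain k where "(\<Phi> has_field_derivative k) (at x)"
    using real_differentiable_def by blast
  then have k: "(\<Phi> has_field_derivative k) (at x within {0..})" by (rule has_field_derivative_at_within)
  show ?thesis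
  proof (rule that)
    fix y :: real assume "0 \<le> y"
    then have "\<Phi> y - \<Phi> x \<ge> k * (y - x)"
      using convex_on_imp_above_tangent[OF conv _ _ _ k, of y] interiorI[of "{0<..}" x "{0..}"] assms by auto
    then show "\<Phi> x + k * (y - x) \<le> \<Phi> y" by simp
  qed
qed

text \<open>The total mass may be smaller than \<open>1\<close> because \<open>\<Phi> 0 = 0\<close>.\<close>

lemma jensen:
  assumes p: "integrable M p" "\<And>x. x \<in> space M \<Longrightarrow> 0 \<le> p x" "(LINT x|M. p x) \<le> 1"
    and X: "\<And>x. x \<in> space M \<Longrightarrow> 0 \<le> X x"
    and int: "integrable M (\<lambda>x. p x * X x)" "integrable M (\<lambda>x. p x * \<Phi> (X x))"
    and c: "0 \<le> c" "c \<le> (LINT x|M. p x * X x)"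
  shows "\<Phi> c \<le> (LINT x|M. p x * \<Phi> (X x))"
proof (cases "c = 0")
  case True
  then show ?thesis using p(2) X nonneg by (auto intro!: Bochner_Integration.integral_nonneg)
next
  case False
  define m where "m = (LINT x|M. p x * X x)"
  have m: "0 < m" using c False by (simp add: m_def)
  obtain k where k: "\<And>y. 0 \<le> y \<Longrightarrow> \<Phi> m + k * (y - m) \<le> \<Phi> y" using tangent[OF m] by blast
  \<comment> \<open>The tangent at \<open>m\<close> has a nonpositive intercept since \<Phi>
    vanishes at 0; multiplying this intercept by a mass of at most 1 can only raise it.\<close>
  have k0: "\<Phi> m - k * m \<le> 0" using k[of 0] by simp
  have "\<Phi> c \<le> \<Phi> m" using c by (intro mono) (auto simp: m_def)
  also have "\<dots> = (\<Phi> m - k * m) * 1 + k * m" by simp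
  also have "\<dots> \<le> (\<Phi> m - k * m) * (LINT x|M. p x) + k * m"
    using k0 p(3) by (intro add_right_mono mult_left_mono_neg) auto
  also have "\<dots> = (LINT x|M. (\<Phi> m - k * m) * p x + k * (p x * X x))"
    using p(1) int(1) by (simp add: m_def)
  also have "\<dots> \<le> (LINT x|M. p x * \<Phi> (X x))"
  proof (rule Bochner_Integration.integral_mono)
    show "integrable M (\<lambda>x. (\<Phi> m - k * m) * p x + k * (p x * X x))" using p(1) int(1) by auto
    fix x assume x: "x \<in> space M"
    have "p x * (\<Phi> m + k * (X x - m)) \<le> p x * \<Phi> (X x)"
      using k[OF X[OF x]] p(2)[OF x] by (rule mult_left_mono)
    then show "(\<Phi> m - k * m) * p x + k * (p x * X x) \<le> p x * \<Phi> (X x)"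
      by (simp add: algebra_simps)
  qed (rule int(2))
  finally show ?thesis .
qed

text \<open>The Dini condition forces \<open>\<Phi> t / t\<close> to halve when \<open>t\<close> shrinks by a fixed factor, because
  that ratio is monotone and the logarithmic length of the interval can be made large.\<close>

lemma ratio_halves: "\<exists>d. 0 < d \<and> d < 1 \<and> (\<forall>t>0. \<Phi> (d * t) / (d * t) \<le> (\<Phi> t / t) / 2)"
proof -
  obtain D where D: "0 < D" and int: "\<And>t. 0 < t \<Longrightarrow> (\<integral>\<^sup>+s\<in>{0<..t}. ennreal (\<Phi> s / s\<^sup>2) \<partial>lborel) \<le> ennreal (D * (\<Phi> t / t))"
    using dini unfolding dini_def by blast
  \<comment> \<open>The interval \<open>[d t, t]\<close> has logarithmic length
    \<open>2 * D\<close>. Its contribution to the Dini integral is at least \<open>2 * D\<close>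
    times the ratio at \<open>d * t\<close>, against the bound \<open>D\<close> times the ratio at
    \<open>t\<close>.\<close>
  define d where "d = exp (- (2 * D))"
  have d: "0 < d" "d < 1" using D by (auto simp: d_def)
  have "\<Phi> (d * t) / (d * t) \<le> (\<Phi> t / t) / 2" if t: "0 < t" for t
  proof -
    let ?r = "\<Phi> (d * t) / (d * t)"
    have dt: "0 < d * t" "d * t \<le> t" using d t by auto
    have r: "0 \<le> ?r" using dt nonneg[of "d * t"] by simp
    have "ennreal (?r * ln t - ?r * ln (d * t)) = (\<integral>\<^sup>+s. ennreal (?r / s) * indicator {d * t..t} s \<partial>lborel)"
    proof (rule nn_integral_FTC_Icc[symmetric])
      show "((\<lambda>s. ?r * ln s) has_real_derivative ?r / s) (at s)" if "s \<in> {d * t..t}" for s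
        using that dt by (auto intro!: derivative_eq_intros)
      show "0 \<le> ?r / s" if "s \<in> {d * t..t}" for s
        using that dt by (intro divide_nonneg_pos r) auto
    qed (use dt in auto)
    also have "\<dots> \<le> (\<integral>\<^sup>+s\<in>{0<..t}. ennreal (\<Phi> s / s\<^sup>2) \<partial>lborel)"
    proof (rule nn_integral_mono)
      show "ennreal (?r / s) * indicator {d * t..t} s \<le> ennreal (\<Phi> s / s\<^sup>2) * indicator {0<..t} s" for s
      proof (cases "s \<in> {d * t..t}")
        case True
        then have s: "0 < s" "s \<le> t" using dt by auto
        have "?r / s \<le> (\<Phi> s / s) / s"
          using True dt s by (intro divide_right_mono ratio_mono) auto
        then show ?thesis using True s by (simp add: power2_eq_square ennreal_leI)
      qed simp
    qed
    also have "\<dots> \<le> ennreal (D * (\<Phi> t / t))" by (rule int[OF t])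
    finally have "?r * ln t - ?r * ln (d * t) \<le> D * (\<Phi> t / t)"
      using D t nonneg[of t] by (subst (asm) ennreal_le_iff) auto
    moreover have ln: "ln (d * t) = ln t - 2 * D" using d t by (simp add: ln_mult d_def)
    have "R * L - R * (L - 2 * D) = D * (R * 2)" for R L :: real by (simp add: algebra_simps)
    ultimately have "D * (?r * 2) \<le> D * (\<Phi> t / t)" unfolding ln by (simp only:)
    then have "?r * 2 \<le> \<Phi> t / t" using D by (simp only: mult_le_cancel_left_pos)
    then show ?thesis by (simp only: le_divide_eq_numeral1)
  qed
  then show ?thesis using d by blast
qed

text \<open>Iterated halving: scaling by \<open>d ^ k\<close> divides the ratio by
  \<open>2 ^ k\<close>. The exponent \<open>e\<close> solves \<open>d powr e = 1/2\<close>, and the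
  factor 2 in the statement pays for rounding \<open>ln t / ln d\<close> down to an integer.\<close>

lemma lower_type: "\<exists>p>1. \<forall>s>0. \<forall>t. 0 < t \<and> t \<le> 1 \<longrightarrow> \<Phi> (t * s) \<le> 2 * t powr p * \<Phi> s"
proof -
  obtain d where d: "0 < d" "d < 1" and half: "\<And>t. 0 < t \<Longrightarrow> \<Phi> (d * t) / (d * t) \<le> (\<Phi> t / t) / 2"
    using ratio_halves by blast
  have iter: "\<Phi> (d ^ k * s) / (d ^ k * s) \<le> (\<Phi> s / s) / 2 ^ k" if s: "0 < s" for k s
  proof (induction k)
    case (Suc k)
    have "\<Phi> (d * (d ^ k * s)) / (d * (d ^ k * s)) \<le> (\<Phi> (d ^ k * s) / (d ^ k * s)) / 2"
      using d s by (intro half) simp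
    also have "\<dots> \<le> ((\<Phi> s / s) / 2 ^ k) / 2" by (intro divide_right_mono Suc) simp
    finally show ?case by (simp add: mult_ac)
  qed simp
  define e where "e = ln 2 / - ln d"
  have ld: "ln d < 0" using d by simp
  have e: "0 < e" unfolding e_def using ld by (intro divide_pos_pos) auto
  have de: "d powr e = 1 / 2"
    using d ld by (simp add: powr_def e_def exp_minus field_simps)
  have "\<Phi> (t * s) \<le> 2 * t powr (1 + e) * \<Phi> s" if s: "0 < s" and t: "0 < t" "t \<le> 1" for s t
  proof -
    define x where "x = ln t / ln d"
    have x: "0 \<le> x" using t ld by (simp add: x_def divide_nonpos_neg)
    define k where "k = nat \<lfloor>x\<rfloor>"
    have k: "real k \<le> x" "x < real (Suc k)"
      using x floor_correct[of x] by (simp_all add: k_def add.commute)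
    have tx: "t = d powr x" using t d ld by (simp add: powr_def x_def)
    have "t \<le> d powr real k" unfolding tx using k d by (intro powr_mono') auto
    then have t_le: "t \<le> d ^ k" using d by (simp add: powr_realpow)
    have "(1 / 2) ^ Suc k = (d powr e) powr real (Suc k)" unfolding de by (rule powr_realpow[symmetric]) simp
    also have "\<dots> = d powr (real (Suc k) * e)" by (simp add: powr_powr mult.commute)
    also have "\<dots> \<le> d powr (x * e)"
      using k d e by (intro powr_mono' mult_right_mono) auto
    also have "\<dots> = t powr e" by (simp add: tx powr_powr)
    finally have half_le: "1 / 2 ^ k \<le> 2 * t powr e" by (simp add: power_one_over)
    have "\<Phi> (t * s) / (t * s) \<le> \<Phi> (d ^ k * s) / (d ^ k * s)"
      using t s t_le by (intro ratio_mono mult_right_mono) auto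
    also have "\<dots> \<le> (\<Phi> s / s) * (1 / 2 ^ k)" using iter[OF s, of k] by simp
    also have "\<dots> \<le> (\<Phi> s / s) * (2 * t powr e)"
      using half_le s nonneg[of s] by (intro mult_left_mono) auto
    finally have "\<Phi> (t * s) \<le> (\<Phi> s / s) * (2 * t powr e) * (t * s)"
      using t s by (simp add: pos_divide_le_eq)
    also have "\<dots> = 2 * t powr (1 + e) * \<Phi> s" using t s by (simp add: powr_add)
    finally show ?thesis .
  qed
  then show ?thesis using e by (intro exI[of _ "1 + e"]) auto
qed

text \<open>One term serves \<open>t \<le> 1\<close> (lower type) and the other \<open>t > 1\<close>
  (upper type). Taking \<open>r = q + 1\<close> makes the second exponent exceed 1 even when
  \<open>q = 1\<close>.\<close>

lemma two_sided_type:
  obtains K p r where "0 < K" "1 < p" "1 < r"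
    "\<And>s t. 0 \<le> s \<Longrightarrow> 0 < t \<Longrightarrow> \<Phi> (t * s) \<le> K * (t powr p + t powr r) * \<Phi> s"
proof -
  obtain C where C: "0 < C" "\<And>s t. 0 < s \<Longrightarrow> 1 \<le> t \<Longrightarrow> \<Phi> (s * t) \<le> C * t powr q * \<Phi> s"
    using upper_type by blast
  obtain p where p: "1 < p" "\<And>s t. 0 < s \<Longrightarrow> 0 < t \<Longrightarrow> t \<le> 1 \<Longrightarrow> \<Phi> (t * s) \<le> 2 * t powr p * \<Phi> s"
    using lower_type by blast
  show ?thesis
  proof (rule that[of "C + 2" p "q + 1"])
    fix s t :: real assume s: "0 \<le> s" and t: "0 < t"
    show "\<Phi> (t * s) \<le> (C + 2) * (t powr p + t powr (q + 1)) * \<Phi> s"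
    proof (cases "s = 0")
      case False
      then have s: "0 < s" "0 \<le> \<Phi> s" using s nonneg[of s] by auto
      show ?thesis
      proof (cases "t \<le> 1")
        case True
        have "2 * t powr p \<le> (C + 2) * (t powr p + t powr (q + 1))"
          using C by (intro mult_mono) auto
        from mult_right_mono[OF this s(2)] p(2)[OF s(1) t True] show ?thesis by linarith
      next
        case False
        have "t powr q \<le> t powr (q + 1)" using False by (intro powr_mono) auto
        then have "t powr q \<le> t powr p + t powr (q + 1)" by (simp add: add_increasing)
        then have "C * t powr q \<le> (C + 2) * (t powr p + t powr (q + 1))"
          using C by (intro mult_mono) auto
        from mult_right_mono[OF this s(2)] C(2)[OF s(1), of t] False show ?thesis by (simp add: mult.commute)
      qed
    qed simp
  qed (use C p q in auto)
qed

end

subsection \<open>The positive Bergman operator on the Orlicz space\<close>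

lemma measurable_rho_powr_nu: "(\<lambda>w :: complex ^ 'n. rho w powr s) \<in> borel_measurable (nu a)"
proof -
  have "(\<lambda>w :: complex ^ 'n. rho w powr s) \<in> borel_measurable borel" by measurable
  then show ?thesis by (rule measurable_compose[OF measurable_id_nu])
qed

lemma measurable_cmod_kern_pair:
  "(\<lambda>p. cmod (kern s (fst p) (snd p))) \<in> borel_measurable (nu a \<Otimes>\<^sub>M nu b)"
proof -
  have 1: "fst \<in> nu a \<Otimes>\<^sub>M (nu b :: (complex ^ 'n) measure) \<rightarrow>\<^sub>M (borel :: (complex ^ 'n) measure)"
    by (rule measurable_compose[OF measurable_fst measurable_id_nu])
  have 2: "snd \<in> (nu a :: (complex ^ 'n) measure) \<Otimes>\<^sub>M nu b \<rightarrow>\<^sub>M (borel :: (complex ^ 'n) measure)"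
    by (rule measurable_compose[OF measurable_snd measurable_id_nu])
  from measurable_compose[OF measurable_compose[OF measurable_Pair[OF 1 2] measurable_kern] borel_measurable_norm, of s]
  show ?thesis by (simp add: case_prod_unfold)
qed

context dini_growth
begin

text \<open>A Schur test in Orlicz form: Jensen's inequality is applied to the subprobability density
  proportional to \<open>w \<mapsto> |kern N z w| (rho w) powr (- s)\<close>, and the two-sided type of \<open>\<Phi>\<close> turns the
  quotient of test weights into powers that the Forelli-Rudin estimate controls.\<close>

lemma jensen_schur:
  fixes g :: "complex ^ 'n \<Rightarrow> real" and z :: "complex ^ 'n" and a :: real
  defines "k \<equiv> \<lambda>z w :: complex ^ 'n. cmod (kern (real CARD('n) + 1 + a) z w)"
  assumes a: "-1 < a" and z: "norm z < 1" and s: "0 < s" and C1: "0 < C1"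
    and schur: "(\<integral>\<^sup>+w. ennreal (k z w * rho w powr (- s)) \<partial>nu a) \<le> ennreal (C1 * rho z powr (- s))"
    and K: "0 < K" "\<And>x t. 0 \<le> x \<Longrightarrow> 0 < t \<Longrightarrow> \<Phi> (t * x) \<le> K * (t powr p + t powr r) * \<Phi> x"
    and g: "g \<in> borel_measurable (nu a)" "\<And>w. norm w < 1 \<Longrightarrow> 0 \<le> g w" "\<And>w. norm w < 1 \<Longrightarrow> g w \<le> B"
  shows "ennreal (\<Phi> ((LINT w|nu a. k z w * g w) / C1)) \<le>
    (\<integral>\<^sup>+w. ennreal (K / C1 * \<Phi> (g w) * rho w powr (s * (p - 1))) * ennreal (k z w * rho z powr (- (s * (p - 1))))
       + ennreal (K / C1 * \<Phi> (g w) * rho w powr (s * (r - 1))) * ennreal (k z w * rho z powr (- (s * (r - 1)))) \<partial>nu a)"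
proof -
  \<comment> \<open>The Schur estimate makes \<open>P\<close> a subprobability density.
    \<open>X\<close> is \<open>g\<close> times the quotient of test weights, arranged so that
    \<open>P w * X w = k z w * g w / C1\<close>.\<close>
  define P where "P = (\<lambda>w. k z w * rho w powr (- s) / (C1 * rho z powr (- s)))"
  define X where "X = (\<lambda>w. (rho z powr (- s) * rho w powr s) * g w)"
  have rz: "0 < rho z" by (rule rho_pos[OF z])
  have k0: "0 \<le> k z w" for w by (simp add: k_def)
  have mk: "k z \<in> borel_measurable (nu a)" unfolding k_def by (rule measurable_cmod_kern_nu)
  have mP: "P \<in> borel_measurable (nu a)"
    unfolding P_def by (intro borel_measurable_divide borel_measurable_times mk measurable_rho_powr_nu borel_measurable_const)
  have mX: "X \<in> borel_measurable (nu a)"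
    unfolding X_def by (intro borel_measurable_times g measurable_rho_powr_nu borel_measurable_const)
  have P0: "0 \<le> P w" for w using k0 C1 rz by (simp add: P_def)
  have X0: "0 \<le> X w" if "norm w < 1" for w using g(2)[OF that] by (simp add: X_def)
  have c0: "0 < C1 * rho z powr (- s)" using C1 rz by simp
  have nnP: "(\<integral>\<^sup>+w. ennreal (P w) \<partial>nu a) \<le> 1"
  proof -
    have "(\<integral>\<^sup>+w. ennreal (P w) \<partial>nu a) = (\<integral>\<^sup>+w. ennreal (1 / (C1 * rho z powr (- s))) * ennreal (k z w * rho w powr (- s)) \<partial>nu a)"
      using c0 by (intro nn_integral_cong) (simp add: P_def ennreal_mult'[symmetric])
    also have "\<dots> = ennreal (1 / (C1 * rho z powr (- s))) * (\<integral>\<^sup>+w. ennreal (k z w * rho w powr (- s)) \<partial>nu a)"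
      by (rule nn_integral_cmult) (intro measurable_compose[OF _ measurable_ennreal] borel_measurable_times mk measurable_rho_powr_nu)
    also have "\<dots> \<le> ennreal (1 / (C1 * rho z powr (- s))) * ennreal (C1 * rho z powr (- s))"
      by (intro mult_left_mono schur) simp
    also have "\<dots> = ennreal ((1 / (C1 * rho z powr (- s))) * (C1 * rho z powr (- s)))"
      using c0 by (intro ennreal_mult'[symmetric]) simp
    also have "\<dots> = 1"
    proof -
      have "1 / Q * Q = 1" if "0 < Q" for Q :: real using that by simp
      from this[OF c0] show ?thesis by (simp only: ennreal_1)
    qed
    finally show ?thesis .
  qed
  have intP: "integrable (nu a) P"
    by (rule integrableI_nonneg[OF mP]) (use P0 nnP in \<open>auto intro: le_less_trans\<close>)
  have P1: "(LINT w|nu a. P w) \<le> 1"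
    using nn_integral_eq_integral[OF intP] nnP P0 by simp
  have PX: "P w * X w = k z w * g w / C1" if "norm w < 1" for w
    using rz rho_pos[OF that] C1 by (simp add: P_def X_def powr_minus field_simps)
  obtain Bk where Bk: "0 \<le> Bk" "\<And>w :: complex ^ 'n. norm w \<le> 1 \<Longrightarrow> k z w \<le> Bk"
    unfolding k_def using cmod_kern_bound[OF z] by metis
  have intkg: "integrable (nu a) (\<lambda>w. k z w * g w / C1)"
  proof (rule integrable_nu_bounded[OF a])
    show "(\<lambda>w. k z w * g w / C1) \<in> borel_measurable (nu a)"
      by (intro borel_measurable_divide borel_measurable_times mk g) simp
    show "norm (k z w * g w / C1) \<le> Bk * B / C1" if "norm w < 1" for w
      using Bk(2)[of w] g(2,3)[OF that] k0 that C1 Bk(1) by (auto simp: abs_mult intro!: divide_right_mono mult_mono)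
  qed
  have intPX: "integrable (nu a) (\<lambda>w. P w * X w)"
    using intkg by (rule Bochner_Integration.integrable_cong[OF refl, THEN iffD2, rotated]) (simp add: PX)
  have eqPX: "(LINT w|nu a. P w * X w) = (LINT w|nu a. k z w * g w) / C1"
    by (subst Bochner_Integration.integral_cong[OF refl PX]) auto
  have XB: "X w \<le> rho z powr (- s) * B" if "norm w < 1" for w
  proof -
    have "rho w powr s \<le> 1" using rho_pos[OF that] s by (intro powr_le1) auto
    then have "rho z powr (- s) * rho w powr s * g w \<le> rho z powr (- s) * 1 * B"
      using g(2,3)[OF that] by (intro mult_mono) auto
    then show ?thesis by (simp add: X_def)
  qed
  have mPhiX: "(\<lambda>w. \<Phi> (X w)) \<in> borel_measurable (nu a)"
    by (rule measurable_comp[OF mX]) (use X0 in auto)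
  have intPPhi: "integrable (nu a) (\<lambda>w. P w * \<Phi> (X w))"
  proof (rule Bochner_Integration.integrable_bound)
    show "integrable (nu a) (\<lambda>w. P w * \<Phi> (rho z powr (- s) * B))" by (intro integrable_mult_left intP)
    show "(\<lambda>w. P w * \<Phi> (X w)) \<in> borel_measurable (nu a)" using mP mPhiX by auto
    show "AE w in nu a. norm (P w * \<Phi> (X w)) \<le> norm (P w * \<Phi> (rho z powr (- s) * B))"
    proof (rule AE_I2)
      fix w assume "w \<in> space (nu a :: (complex ^ 'n) measure)"
      then have w: "norm w < 1" by simp
      have "\<Phi> (X w) \<le> \<Phi> (rho z powr (- s) * B)" by (rule mono[OF X0[OF w] XB[OF w]])
      then have "P w * \<Phi> (X w) \<le> P w * \<Phi> (rho z powr (- s) * B)" by (intro mult_left_mono P0)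
      moreover have "0 \<le> P w * \<Phi> (X w)" using P0 nonneg[OF X0[OF w]] by simp
      ultimately show "norm (P w * \<Phi> (X w)) \<le> norm (P w * \<Phi> (rho z powr (- s) * B))" by simp
    qed
  qed
  have "\<Phi> ((LINT w|nu a. k z w * g w) / C1) \<le> (LINT w|nu a. P w * \<Phi> (X w))"
  proof (rule jensen[OF intP _ P1 _ intPX intPPhi])
    show "0 \<le> (LINT w|nu a. k z w * g w) / C1"
      using C1 k0 g(2) by (auto intro!: divide_nonneg_pos Bochner_Integration.integral_nonneg)
  qed (use P0 X0 eqPX in auto)
  then have "ennreal (\<Phi> ((LINT w|nu a. k z w * g w) / C1)) \<le> ennreal (LINT w|nu a. P w * \<Phi> (X w))"
    by (rule ennreal_leI)
  also have "\<dots> = (\<integral>\<^sup>+w. ennreal (P w * \<Phi> (X w)) \<partial>nu a)"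
    by (rule nn_integral_eq_integral[symmetric, OF intPPhi]) (use P0 X0 nonneg in \<open>auto intro!: AE_I2\<close>)
  also have "\<dots> \<le> (\<integral>\<^sup>+w. ennreal (K / C1 * \<Phi> (g w) * rho w powr (s * (p - 1))) * ennreal (k z w * rho z powr (- (s * (p - 1))))
       + ennreal (K / C1 * \<Phi> (g w) * rho w powr (s * (r - 1))) * ennreal (k z w * rho z powr (- (s * (r - 1)))) \<partial>nu a)"
  proof (rule nn_integral_mono)
    fix w assume "w \<in> space (nu a :: (complex ^ 'n) measure)"
    then have w: "norm w < 1" by simp
    define t where "t = rho z powr (- s) * rho w powr s"
    have rw: "0 < rho w" by (rule rho_pos[OF w])
    have t: "0 < t" using rz rw by (simp add: t_def)
    \<comment> \<open>\<open>P w\<close> carries a factor \<open>1 / t\<close>, so each power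
      \<open>t powr x\<close> from the two-sided type loses one order; this is the origin of the
      exponents \<open>s * (x - 1)\<close>.\<close>
    have tp: "t powr x / t = rho w powr (s * (x - 1)) * rho z powr (- (s * (x - 1)))" for x
    proof -
      have "t powr x / t = t powr (x - 1)" using t powr_diff[of t x 1] by simp
      also have "\<dots> = (rho z powr (- s)) powr (x - 1) * (rho w powr s) powr (x - 1)"
        unfolding t_def by (rule powr_mult)
      finally show ?thesis by (simp add: powr_powr mult.commute)
    qed
    have Pt: "P w = k z w / C1 / t"
      using rz rw C1 by (simp add: P_def t_def powr_minus field_simps)
    have G0: "0 \<le> \<Phi> (g w)" by (rule nonneg[OF g(2)[OF w]])
    let ?A = "\<lambda>x. K / C1 * \<Phi> (g w) * rho w powr (s * (x - 1))" and ?D = "\<lambda>x. k z w * rho z powr (- (s * (x - 1)))"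
    have A0: "0 \<le> ?A x" and D0: "0 \<le> ?D x" for x using K C1 G0 k0 by auto
    have "P w * \<Phi> (X w) \<le> P w * (K * (t powr p + t powr r) * \<Phi> (g w))"
      unfolding X_def t_def[symmetric] by (intro mult_left_mono P0 K g(2) w t)
    also have "\<dots> = K / C1 * \<Phi> (g w) * k z w * (t powr p / t) + K / C1 * \<Phi> (g w) * k z w * (t powr r / t)"
      using t C1 unfolding Pt by (simp add: field_simps)
    also have "\<dots> = ?A p * ?D p + ?A r * ?D r"
      unfolding tp by (simp only: mult_ac)
    finally have "ennreal (P w * \<Phi> (X w)) \<le> ennreal (?A p * ?D p + ?A r * ?D r)" by (rule ennreal_leI)
    also have "\<dots> = ennreal (?A p * ?D p) + ennreal (?A r * ?D r)"
      by (intro ennreal_plus mult_nonneg_nonneg A0 D0)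
    also have "\<dots> = ennreal (?A p) * ennreal (?D p) + ennreal (?A r) * ennreal (?D r)"
      unfolding ennreal_mult'[OF A0] ..
    finally show "ennreal (P w * \<Phi> (X w)) \<le> ennreal (?A p) * ennreal (?D p) + ennreal (?A r) * ennreal (?D r)" .
  qed
  finally show ?thesis .
qed

text \<open>\<open>jensen_schur\<close> is integrated in \<open>z\<close> and the integrals are
  exchanged. As the modulus of the kernel is symmetric, \<open>schur_weight\<close> applies in the
  other variable, and its output cancels the powers of \<open>rho w\<close>.\<close>

lemma positive_bergman_bounded:
  assumes a: "-1 < a"
  shows "\<exists>C1>0. \<exists>C2>0. \<forall>(g :: complex ^ 'n \<Rightarrow> real) B.
    g \<in> borel_measurable (nu a) \<and> (\<forall>w. norm w < 1 \<longrightarrow> 0 \<le> g w \<and> g w \<le> B) \<longrightarrow>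
      (\<integral>\<^sup>+z. ennreal (\<Phi> ((LINT w|nu a. cmod (kern (real CARD('n) + 1 + a) z w) * g w) / C1)) \<partial>nu a)
      \<le> ennreal C2 * (\<integral>\<^sup>+w. ennreal (\<Phi> (g w)) \<partial>nu a)"
proof -
  obtain K p r where K: "0 < K" "1 < p" "1 < r" "\<And>x t. 0 \<le> x \<Longrightarrow> 0 < t \<Longrightarrow> \<Phi> (t * x) \<le> K * (t powr p + t powr r) * \<Phi> x"
    using two_sided_type by metis
  define k where "k = (\<lambda>z w :: complex ^ 'n. cmod (kern (real CARD('n) + 1 + a) z w))"
  \<comment> \<open>Small enough that \<open>s\<close>, \<open>s * (p - 1)\<close> and
    \<open>s * (r - 1)\<close> all lie in the range of \<open>schur_weight\<close>; they are
    positive because \<open>p\<close> and \<open>r\<close> exceed 1.\<close>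
  define s where "s = (1 + a) / 2 / (p + r)"
  have s0: "0 < s" using a K by (simp add: s_def)
  have s_le: "s * x \<le> (1 + a) / 2" if "x \<le> p + r" for x
  proof -
    have "s * x \<le> s * (p + r)" using s0 that by (intro mult_left_mono) auto
    also have "\<dots> = (1 + a) / 2"
    proof -
      have "x / Q * Q = x" if "Q \<noteq> 0" for x Q :: real using that by simp
      moreover have "p + r \<noteq> 0" using K by linarith
      ultimately show ?thesis unfolding s_def by blast
    qed
    finally show ?thesis .
  qed
  have schur: "\<exists>C>0. \<forall>z :: complex ^ 'n. norm z < 1 \<longrightarrow> (\<integral>\<^sup>+w. ennreal (k z w * rho w powr (- s')) \<partial>nu a) \<le> ennreal (C * rho z powr (- s'))"
    if "0 < s'" "s' \<le> (1 + a) / 2" for s'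
    unfolding k_def by (rule schur_weight[OF a that])
  obtain C1 where C1: "0 < C1" "\<And>z :: complex ^ 'n. norm z < 1 \<Longrightarrow> (\<integral>\<^sup>+w. ennreal (k z w * rho w powr (- s)) \<partial>nu a) \<le> ennreal (C1 * rho z powr (- s))"
    using schur[of s] s0 s_le[of 1] K by auto
  obtain Cp where Cp: "0 < Cp" "\<And>z :: complex ^ 'n. norm z < 1 \<Longrightarrow> (\<integral>\<^sup>+w. ennreal (k z w * rho w powr (- (s * (p - 1)))) \<partial>nu a) \<le> ennreal (Cp * rho z powr (- (s * (p - 1))))"
    using schur[of "s * (p - 1)"] s0 s_le[of "p - 1"] K by auto
  obtain Cr where Cr: "0 < Cr" "\<And>z :: complex ^ 'n. norm z < 1 \<Longrightarrow> (\<integral>\<^sup>+w. ennreal (k z w * rho w powr (- (s * (r - 1)))) \<partial>nu a) \<le> ennreal (Cr * rho z powr (- (s * (r - 1))))"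
    using schur[of "s * (r - 1)"] s0 s_le[of "r - 1"] K by auto
  have k_comm: "k z w = k w z" for z w unfolding k_def by (rule cmod_kern_commute)
  define C2 where "C2 = K / C1 * (Cp + Cr)"
  show ?thesis
  proof (rule exI[of _ C1], rule conjI, rule C1(1), rule exI[of _ C2], intro conjI allI impI)
    show "0 < C2" using K C1 Cp Cr by (simp add: C2_def)
    fix g :: "complex ^ 'n \<Rightarrow> real" and B
    assume "g \<in> borel_measurable (nu a) \<and> (\<forall>w. norm w < 1 \<longrightarrow> 0 \<le> g w \<and> g w \<le> B)"
    then have g: "g \<in> borel_measurable (nu a)" "\<And>w. norm w < 1 \<Longrightarrow> 0 \<le> g w" "\<And>w. norm w < 1 \<Longrightarrow> g w \<le> B" by auto
    interpret nu: sigma_finite_measure "nu a :: (complex ^ 'n) measure" by (rule sigma_finite_nu[OF a])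
    interpret pair_sigma_finite "nu a :: (complex ^ 'n) measure" "nu a :: (complex ^ 'n) measure"
      by (intro pair_sigma_finite.intro nu.sigma_finite_measure_axioms)
    have mPhi: "(\<lambda>w. \<Phi> (g w)) \<in> borel_measurable (nu a)"
      by (rule measurable_comp[OF g(1)]) (use g(2) in auto)
    let ?A = "\<lambda>x w. K / C1 * \<Phi> (g w) * rho w powr (s * (x - 1))" and ?D = "\<lambda>x z w. k z w * rho z powr (- (s * (x - 1)))"
    let ?f = "\<lambda>z w. ennreal (?A p w) * ennreal (?D p z w) + ennreal (?A r w) * ennreal (?D r z w)"
    have mA: "(\<lambda>w. ennreal (?A x w)) \<in> borel_measurable (nu a)" for x
      by (intro measurable_compose[OF _ measurable_ennreal] borel_measurable_times mPhi measurable_rho_powr_nu) simp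
    have mD: "(\<lambda>q. ennreal (?D x (fst q) (snd q))) \<in> borel_measurable (nu a \<Otimes>\<^sub>M nu a)" for x
      unfolding k_def
      by (intro measurable_compose[OF _ measurable_ennreal] borel_measurable_times measurable_cmod_kern_pair
           measurable_compose[OF measurable_fst measurable_rho_powr_nu])
    have m: "case_prod ?f \<in> borel_measurable (nu a \<Otimes>\<^sub>M nu a)"
      unfolding case_prod_unfold
      by (intro borel_measurable_add borel_measurable_times_ennreal mD measurable_compose[OF measurable_snd mA])
    have mD1: "(\<lambda>z. ennreal (?D x z w)) \<in> borel_measurable (nu a)" for x w
      unfolding k_def cmod_kern_commute[of _ _ w]
      by (intro measurable_compose[OF _ measurable_ennreal] borel_measurable_times measurable_cmod_kern_nu measurable_rho_powr_nu)
    have "(\<integral>\<^sup>+z. ennreal (\<Phi> ((LINT w|nu a. k z w * g w) / C1)) \<partial>nu a) \<le> (\<integral>\<^sup>+z. (\<integral>\<^sup>+w. ?f z w \<partial>nu a) \<partial>nu a)"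
    proof (rule nn_integral_mono)
      fix z :: "complex ^ 'n" assume "z \<in> space (nu a)"
      then have z: "norm z < 1" by simp
      show "ennreal (\<Phi> ((LINT w|nu a. k z w * g w) / C1)) \<le> (\<integral>\<^sup>+w. ?f z w \<partial>nu a)"
        using C1(2)[OF z] unfolding k_def
        by (rule jensen_schur[OF a z s0 C1(1) _ K(1,4) g])
    qed
    also have "\<dots> = (\<integral>\<^sup>+w. (\<integral>\<^sup>+z. ?f z w \<partial>nu a) \<partial>nu a)"
      by (rule Fubini'[OF m, symmetric])
    also have "\<dots> \<le> (\<integral>\<^sup>+w. ennreal C2 * ennreal (\<Phi> (g w)) \<partial>nu a)"
    proof (rule nn_integral_mono)
      fix w :: "complex ^ 'n" assume "w \<in> space (nu a)"
      then have w: "norm w < 1" by simp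
      have G0: "0 \<le> \<Phi> (g w)" by (rule nonneg[OF g(2)[OF w]])
      have A0: "0 \<le> ?A x w" for x using K C1 G0 by auto
      have rw: "0 < rho w" by (rule rho_pos[OF w])
      have one: "ennreal (?A x w) * (\<integral>\<^sup>+z. ennreal (?D x z w) \<partial>nu a) \<le> ennreal (K / C1 * \<Phi> (g w) * C)"
        if C: "0 < C" "(\<integral>\<^sup>+z. ennreal (k w z * rho z powr (- (s * (x - 1)))) \<partial>nu a) \<le> ennreal (C * rho w powr (- (s * (x - 1))))" for x C
      proof -
        have "ennreal (?A x w) * (\<integral>\<^sup>+z. ennreal (?D x z w) \<partial>nu a) \<le> ennreal (?A x w) * ennreal (C * rho w powr (- (s * (x - 1))))"
          unfolding k_comm[of _ w] by (intro mult_left_mono C(2)) simp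
        also have "\<dots> = ennreal (?A x w * (C * rho w powr (- (s * (x - 1)))))"
          by (rule ennreal_mult'[OF A0, symmetric])
        also have "?A x w * (C * rho w powr (- (s * (x - 1)))) = K / C1 * \<Phi> (g w) * C"
          using rw by (simp add: powr_minus)
        finally show ?thesis .
      qed
      have "(\<integral>\<^sup>+z. ?f z w \<partial>nu a) = ennreal (?A p w) * (\<integral>\<^sup>+z. ennreal (?D p z w) \<partial>nu a) + ennreal (?A r w) * (\<integral>\<^sup>+z. ennreal (?D r z w) \<partial>nu a)"
        using mD1 by (subst nn_integral_add) (auto simp: nn_integral_cmult intro!: borel_measurable_times_ennreal)
      also have "\<dots> \<le> ennreal (K / C1 * \<Phi> (g w) * Cp) + ennreal (K / C1 * \<Phi> (g w) * Cr)"
        by (intro add_mono one Cp Cr w)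
      also have "\<dots> = ennreal (K / C1 * \<Phi> (g w) * Cp + K / C1 * \<Phi> (g w) * Cr)"
        using K C1 G0 Cp Cr by (intro ennreal_plus[symmetric]) auto
      also have "K / C1 * \<Phi> (g w) * Cp + K / C1 * \<Phi> (g w) * Cr = C2 * \<Phi> (g w)"
        unfolding C2_def by (simp only: distrib_left distrib_right mult_ac)
      also have "ennreal (C2 * \<Phi> (g w)) = ennreal C2 * ennreal (\<Phi> (g w))"
        using K C1 Cp Cr by (intro ennreal_mult') (simp add: C2_def)
      finally show "(\<integral>\<^sup>+z. ?f z w \<partial>nu a) \<le> ennreal C2 * ennreal (\<Phi> (g w))" .
    qed
    also have "\<dots> = ennreal C2 * (\<integral>\<^sup>+w. ennreal (\<Phi> (g w)) \<partial>nu a)"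
      by (rule nn_integral_cmult) (rule measurable_compose[OF mPhi measurable_ennreal])
    finally show "(\<integral>\<^sup>+z. ennreal (\<Phi> ((LINT w|nu a. cmod (kern (real CARD('n) + 1 + a) z w) * g w) / C1)) \<partial>nu a)
      \<le> ennreal C2 * (\<integral>\<^sup>+w. ennreal (\<Phi> (g w)) \<partial>nu a)" unfolding k_def .
  qed
qed

end

subsection \<open>Bloch symbols\<close>

lemma hankel_eq:
  fixes z :: "complex ^ 'n"
  assumes z: "norm z < 1"
  shows "hankel a b f z = (LINT w|nu a. b w * cnj (f w * kern (real CARD('n) + 1 + a) z w))"
  unfolding hankel_def bergman_proj_def
proof (rule Bochner_Integration.integral_cong[OF refl])
  fix w :: "complex ^ 'n" assume "w \<in> space (nu a)"
  then have "norm z * norm w < 1" using norm_mult_less_1[OF z, of w] by simp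
  then have "cnj (kern (real CARD('n) + 1 + a) z w) = kern (real CARD('n) + 1 + a) w z" by (rule cnj_kern)
  also have "\<dots> = 1 / (1 - herm z w) powr complex_of_real (real CARD('n) + 1 + a)"
    unfolding kern_def powr_minus by (simp add: divide_inverse)
  finally show "b w * cnj (f w) / (1 - herm z w) powr complex_of_real (real CARD('n) + 1 + a)
      = b w * cnj (f w * kern (real CARD('n) + 1 + a) z w)" by simp
qed

lemma bergman_square_integrable:
  assumes a: "-1 < a" and b: "b \<in> bergman_orlicz a (\<lambda>t. t\<^sup>2)"
  shows "holomorphic_ball b" "integrable (nu a) (b :: complex ^ 'n \<Rightarrow> complex)"
proof -
  show hb: "holomorphic_ball b" using b by (simp add: bergman_orlicz_def)
  have fin: "(\<integral>\<^sup>+z. ennreal ((cmod (b z))\<^sup>2) \<partial>nu a) < \<infinity>" using b by (simp add: bergman_orlicz_def)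
  have mb: "b \<in> borel_measurable (nu a)" by (rule holomorphic_measurable_nu[OF hb])
  have "integrable (nu a) (\<lambda>z. (cmod (b z))\<^sup>2)"
    by (rule integrableI_nonneg) (use fin mb in auto)
  moreover have "integrable (nu a) (\<lambda>z :: complex ^ 'n. 1 :: real)"
    by (rule integrable_nu_bounded[OF a, where B = 1]) auto
  ultimately have "integrable (nu a) (\<lambda>z. 1 + (cmod (b z))\<^sup>2)"
    by (intro Bochner_Integration.integrable_add)
  then show "integrable (nu a) b"
  proof (rule Bochner_Integration.integrable_bound[OF _ mb])
    show "AE z in nu a. norm (b z) \<le> norm (1 + (cmod (b z))\<^sup>2)"
    proof (intro AE_I2)
      fix z
      have "0 \<le> (cmod (b z) - 1)\<^sup>2 + cmod (b z)" by (rule add_nonneg_nonneg) auto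
      then have "cmod (b z) \<le> 1 + (cmod (b z))\<^sup>2" by (simp add: power2_eq_square algebra_simps)
      then show "norm (b z) \<le> norm (1 + (cmod (b z))\<^sup>2)" by simp
    qed
  qed
qed

lemma has_vector_derivative_radial:
  assumes f: "holomorphic_ball f" and t: "norm (t *\<^sub>R z) < 1"
  shows "((\<lambda>t. f (t *\<^sub>R z)) has_vector_derivative dir_deriv f (t *\<^sub>R z) z) (at t)"
proof -
  have "((\<lambda>t. t *\<^sub>R z) has_derivative (\<lambda>t. t *\<^sub>R z)) (at t)" by (auto intro!: derivative_eq_intros)
  from has_derivative_compose[OF this holomorphic_ballD(1)[OF f t]] show ?thesis
    using linear_scale[OF linear_dir_deriv[OF f t]] by (simp add: has_vector_derivative_def)
qed

text \<open>The radial derivative is integrated from \<open>w / 2\<close> to \<open>w\<close>.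
  Starting at one half avoids dividing by a small \<open>t\<close> when passing from direction
  \<open>t w\<close> to \<open>w\<close>. A majorant coarser than the logarithmic growth of Bloch
  functions suffices, since only \<open>b * rho\<close> has to be bounded.\<close>

lemma bloch_bounds:
  fixes b :: "complex ^ 'n \<Rightarrow> complex"
  assumes "b \<in> bloch"
  obtains A where "0 \<le> A" "\<And>w. norm w < 1 \<Longrightarrow> cmod (dir_deriv b w w) * rho w \<le> A" "\<And>w. norm w < 1 \<Longrightarrow> cmod (b w) * rho w \<le> A"
proof -
  have b: "holomorphic_ball b" using assms by (simp add: bloch_def)
  have "bdd_above ((\<lambda>z. cmod (radial_deriv b z) * rho z) ` unit_ball)"
    using assms by (simp add: bloch_def)
  then obtain A where "\<forall>x\<in>(\<lambda>z. cmod (radial_deriv b z) * rho z) ` unit_ball. x \<le> A"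
    unfolding bdd_above_def by blast
  then have A: "cmod (dir_deriv b w w) * rho w \<le> A" if "norm w < 1" for w
    using that by (simp add: radial_deriv_eq[OF b])
  have A0: "0 \<le> A" using A[of 0] linear_0[OF linear_dir_deriv[OF b, of 0]] by simp
  have half: "0 \<le> (1/2 :: real)" "(1/2 :: real) < 1" by auto
  obtain M where M: "0 \<le> M" "\<And>w. norm w \<le> 1/2 \<Longrightarrow> cmod (b w) \<le> M"
    using holomorphic_ball_bounds[OF b half] by metis
  show ?thesis
  proof (rule that[of "4 * A + M"])
    show "0 \<le> 4 * A + M" using A0 M by simp
    fix w :: "complex ^ 'n" assume w: "norm w < 1"
    show "cmod (dir_deriv b w w) * rho w \<le> 4 * A + M" using A[OF w] A0 M by linarith
    let ?x = "norm w"
    have tw: "norm (t *\<^sub>R w) < 1" if "0 \<le> t" "t \<le> 1" for t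
      using that w mult_mono[of t 1 ?x ?x] by simp
    have pos: "0 < 1 - t * ?x" if "0 \<le> t" "t \<le> 1" for t using tw[OF that] that by simp
    \<comment> \<open>The majorant \<open>2 * A * (t / (1 - t * norm w))\<close> has derivative
      \<open>2 * A / (1 - t * norm w)\<^sup>2\<close>; in this form no division by
      \<open>norm w\<close> occurs.\<close>
    have "norm (b (1 *\<^sub>R w) - b ((1/2) *\<^sub>R w)) \<le> 2 * A * (1 / (1 - 1 * ?x)) - 2 * A * ((1/2) / (1 - 1/2 * ?x))"
    proof (rule differentiable_bound_general[where f = "\<lambda>t. b (t *\<^sub>R w)" and \<phi> = "\<lambda>t. 2 * A * (t / (1 - t * ?x))"])
      show "continuous_on {1/2..1} (\<lambda>t. b (t *\<^sub>R w))"
        using tw by (intro continuous_on_compose2[OF holomorphic_ball_continuous_on[OF b]] continuous_intros) auto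
      show "continuous_on {1/2..1} (\<lambda>t. 2 * A * (t / (1 - t * ?x)))"
      proof -
        have "1 - t * ?x \<noteq> 0" if "t \<in> {1/2..1}" for t
          using pos[of t] that by auto
        then show ?thesis by (intro continuous_intros ballI)
      qed
      fix t :: real assume t: "1/2 < t" "t < 1"
      then have t': "0 \<le> t" "t \<le> 1" by auto
      show "((\<lambda>t. b (t *\<^sub>R w)) has_vector_derivative dir_deriv b (t *\<^sub>R w) w) (at t)"
        by (rule has_vector_derivative_radial[OF b tw[OF t']])
      have p: "0 < 1 - t * ?x" by (rule pos[OF t'])
      show "((\<lambda>t. 2 * A * (t / (1 - t * ?x))) has_vector_derivative 2 * A * (1 / (1 - t * ?x)\<^sup>2)) (at t)"
        unfolding has_real_derivative_iff_has_vector_derivative[symmetric]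
        using p by (auto intro!: derivative_eq_intros simp: power2_eq_square field_simps)
      have "dir_deriv b (t *\<^sub>R w) (t *\<^sub>R w) = t *\<^sub>R dir_deriv b (t *\<^sub>R w) w"
        by (rule linear_scale[OF linear_dir_deriv[OF b tw[OF t']]])
      then have "t * cmod (dir_deriv b (t *\<^sub>R w) w) * rho (t *\<^sub>R w) \<le> A"
        using A[OF tw[OF t']] t by simp
      moreover have "1/2 * (1 - t * ?x) \<le> t * rho (t *\<^sub>R w)"
        using le_rho[OF less_imp_le[OF tw[OF t']]] t p by (intro mult_mono) auto
      then have "cmod (dir_deriv b (t *\<^sub>R w) w) * (1/2 * (1 - t * ?x)) \<le> cmod (dir_deriv b (t *\<^sub>R w) w) * (t * rho (t *\<^sub>R w))"
        by (rule mult_left_mono) simp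
      ultimately have "cmod (dir_deriv b (t *\<^sub>R w) w) * (1/2 * (1 - t * ?x)) \<le> A" by (simp add: mult_ac)
      then have "cmod (dir_deriv b (t *\<^sub>R w) w) \<le> 2 * A / (1 - t * ?x)"
        using p by (simp add: field_simps)
      also have "\<dots> \<le> 2 * A * (1 / (1 - t * ?x)\<^sup>2)"
      proof -
        have "(1 - t * ?x)\<^sup>2 \<le> 1 - t * ?x"
          using p t' by (simp add: power2_eq_square mult_left_le)
        then have "2 * A / (1 - t * ?x) \<le> 2 * A / (1 - t * ?x)\<^sup>2"
          using A0 p by (intro divide_left_mono) auto
        then show ?thesis by simp
      qed
      finally show "norm (dir_deriv b (t *\<^sub>R w) w) \<le> 2 * A * (1 / (1 - t * ?x)\<^sup>2)" .
    qed simp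
    also have "\<dots> \<le> 2 * A * (1 / (1 - ?x))"
    proof -
      have "0 \<le> 2 * A * ((1/2) / (1 - 1/2 * ?x))" using A0 w by (intro mult_nonneg_nonneg divide_nonneg_pos) auto
      then show ?thesis by simp
    qed
    finally have "norm (b w - b ((1/2) *\<^sub>R w)) \<le> 2 * A * (1 / (1 - ?x))" by simp
    moreover have "cmod (b ((1/2) *\<^sub>R w)) \<le> M" using w by (intro M) simp
    ultimately have "cmod (b w) \<le> 2 * A * (1 / (1 - ?x)) + M"
      using norm_triangle_ineq[of "b w - b ((1/2) *\<^sub>R w)" "b ((1/2) *\<^sub>R w)"] by simp
    then have "cmod (b w) * rho w \<le> (2 * A * (1 / (1 - ?x)) + M) * rho w"
      using rho_pos[OF w] by (intro mult_right_mono) auto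
    also have "\<dots> = 2 * A * (1 / (1 - ?x)) * rho w + M * rho w" by (simp only: distrib_right)
    also have "\<dots> \<le> 2 * A * (1 / (1 - ?x)) * (2 * (1 - ?x)) + M * 1"
      using rho_le[OF less_imp_le[OF w]] A0 w M by (intro add_mono mult_left_mono) auto
    also have "\<dots> = 4 * A + M"
    proof -
      have "2 * A * (1 / y) * (2 * y) + M * 1 = 4 * A + M" if "0 < y" for y :: real using that by simp
      from this[of "1 - ?x"] w show ?thesis by (simp only: diff_gt_0_iff_gt)
    qed
    finally show "cmod (b w) * rho w \<le> 4 * A + M" .
  qed
qed

lemma bloch_pairing_bound:
  fixes b :: "complex ^ 'n \<Rightarrow> complex"
  assumes a: "-1 < a" and b: "b \<in> bloch" "integrable (nu a) b"
  obtains G where "0 < G" "\<And>F B. holomorphic_ball F \<Longrightarrow> (\<And>w. norm w < 1 \<Longrightarrow> cmod (F w) \<le> B) \<Longrightarrow>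
     cmod (LINT w|nu a. b w * cnj (F w)) \<le> G * (LINT w|nu a. cmod (F w))"
proof -
  have hb: "holomorphic_ball b" using b by (simp add: bloch_def)
  obtain A where A: "0 \<le> A" "\<And>w. norm w < 1 \<Longrightarrow> cmod (dir_deriv b w w) * rho w \<le> A" "\<And>w. norm w < 1 \<Longrightarrow> cmod (b w) * rho w \<le> A"
    using bloch_bounds[OF b(1)] by metis
  define N where "N = real CARD('n) + 1 + a"
  have N: "0 < N" using a of_nat_0_le_iff[of "CARD('n)"] unfolding N_def by linarith
  \<comment> \<open>The summand 1 makes \<open>G\<close> positive even if
    \<open>A = 0\<close>.\<close>
  define G where "G = (N * A + A) / (a + 1) + 1"
  show ?thesis
  proof (rule that[of G])
    show "0 < G" using N A a by (simp add: G_def add_nonneg_pos)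
    fix F :: "complex ^ 'n \<Rightarrow> complex" and B
    assume F: "holomorphic_ball F" "\<And>w. norm w < 1 \<Longrightarrow> cmod (F w) \<le> B"
    have mF: "F \<in> borel_measurable (nu a)" by (rule holomorphic_measurable_nu[OF F(1)])
    have mcF: "(\<lambda>w. cnj (F w)) \<in> borel_measurable (nu a)"
      by (intro continuous_on_measurable_nu continuous_intros holomorphic_ball_continuous_on F)
    have int1: "integrable (nu a) (\<lambda>w. b w * cnj (F w))"
      by (rule integrable_nu_mult_bounded[OF a b(2) mcF, where B = B]) (use F in auto)
    have mD: "(\<lambda>w. dir_deriv b w w) \<in> borel_measurable (nu a)"
      by (intro measurable_dir_deriv hb continuous_intros)
    have mr: "(\<lambda>w :: complex ^ 'n. of_real (rho w) :: complex) \<in> borel_measurable (nu a)"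
      by (intro continuous_on_measurable_nu continuous_intros)
    have nr: "norm (of_real (rho w) :: complex) = rho w" if "norm w < 1" for w :: "complex ^ 'n"
      unfolding norm_of_real using rho_pos[OF that] by simp
    have int2: "integrable (nu a) (\<lambda>w. dir_deriv b w w * cnj (F w) * of_real (rho w))"
    proof (rule integrable_nu_bounded[OF a, where B = "A * B"])
      show "(\<lambda>w. dir_deriv b w w * cnj (F w) * of_real (rho w)) \<in> borel_measurable (nu a)"
        by (intro borel_measurable_times mD mcF mr)
      show "norm (dir_deriv b w w * cnj (F w) * of_real (rho w)) \<le> A * B" if "norm w < 1" for w
      proof -
        have "(cmod (dir_deriv b w w) * rho w) * cmod (F w) \<le> A * B"
          using A F(2)[OF that] that rho_pos[OF that] by (intro mult_mono) auto
        then show ?thesis unfolding norm_mult complex_mod_cnj nr[OF that] by (simp add: mult_ac)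
      qed
    qed
    have intF: "integrable (nu a) (\<lambda>w. cmod (F w))"
      by (intro integrable_norm integrable_nu_bounded[OF a mF F(2)])
    have "of_real (a + 1) * (LINT w|nu a. b w * cnj (F w)) = (LINT w|nu a. (of_real N * b w + dir_deriv b w w) * cnj (F w) * of_real (rho w))"
      unfolding N_def by (rule nu_radial[OF a hb F(1) int1 int2, symmetric])
    from arg_cong[OF this, of cmod]
    have "cmod (of_real (a + 1)) * cmod (LINT w|nu a. b w * cnj (F w)) = cmod (LINT w|nu a. (of_real N * b w + dir_deriv b w w) * cnj (F w) * of_real (rho w))"
      unfolding norm_mult[of "complex_of_real (a + 1)"] .
    then have "(a + 1) * cmod (LINT w|nu a. b w * cnj (F w)) = cmod (LINT w|nu a. (of_real N * b w + dir_deriv b w w) * cnj (F w) * of_real (rho w))"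
      unfolding norm_of_real using a by (simp only: abs_of_pos)
    also have "\<dots> \<le> (LINT w|nu a. (N * A + A) * cmod (F w))"
    proof (rule order_trans[OF Bochner_Integration.integral_norm_bound], rule integral_mono')
      show "integrable (nu a) (\<lambda>w. (N * A + A) * cmod (F w))" using intF by simp
      fix w assume "w \<in> space (nu a :: (complex ^ 'n) measure)"
      then have w: "norm w < 1" by simp
      have "cmod (of_real N * b w + dir_deriv b w w) * rho w \<le> (N * cmod (b w) + cmod (dir_deriv b w w)) * rho w"
        using norm_triangle_ineq[of "of_real N * b w" "dir_deriv b w w"] N rho_pos[OF w]
        by (intro mult_right_mono) (auto simp: norm_mult)
      also have "\<dots> = N * (cmod (b w) * rho w) + cmod (dir_deriv b w w) * rho w" by (simp add: algebra_simps)
      also have "\<dots> \<le> N * A + A" using A w N by (intro add_mono mult_left_mono) auto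
      finally have "(cmod (of_real N * b w + dir_deriv b w w) * rho w) * cmod (F w) \<le> (N * A + A) * cmod (F w)"
        by (rule mult_right_mono) simp
      then show "norm ((of_real N * b w + dir_deriv b w w) * cnj (F w) * of_real (rho w)) \<le> (N * A + A) * cmod (F w)"
        unfolding norm_mult complex_mod_cnj nr[OF w] by (simp add: mult_ac)
    qed (use N A in auto)
    also have "\<dots> = (N * A + A) * (LINT w|nu a. cmod (F w))" by simp
    finally have "cmod (LINT w|nu a. b w * cnj (F w)) \<le> (N * A + A) / (a + 1) * (LINT w|nu a. cmod (F w))"
      using a by (simp add: field_simps)
    also have "\<dots> \<le> G * (LINT w|nu a. cmod (F w))"
      by (intro mult_right_mono Bochner_Integration.integral_nonneg) (auto simp: G_def)
    finally show "cmod (LINT w|nu a. b w * cnj (F w)) \<le> G * (LINT w|nu a. cmod (F w))" .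
  qed
qed

text \<open>If \<open>r\<close> is admissible in the Luxemburg norm of \<open>f\<close>, then
  \<open>L * r\<close> is admissible for the image. The modular constant \<open>C2\<close> is
  converted into a norm constant by \<open>scale_le\<close>: dividing the argument by
  \<open>K \<ge> C2\<close> divides the modular by at least \<open>K\<close>.\<close>

lemma (in dini_growth) bloch_imp_hankel_bounded:
  fixes b :: "complex ^ 'n \<Rightarrow> complex"
  assumes a: "-1 < a" and b: "b \<in> bloch" "integrable (nu a) b"
  shows "hankel_extends_bounded a b \<Phi> \<Phi>"
proof -
  define N where "N = real CARD('n) + 1 + a"
  obtain G where G: "0 < G" "\<And>F B. holomorphic_ball F \<Longrightarrow> (\<And>w. norm w < 1 \<Longrightarrow> cmod (F w) \<le> B) \<Longrightarrow>
     cmod (LINT w|nu a. b w * cnj (F w)) \<le> G * (LINT w|nu a. cmod (F w))"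
    using bloch_pairing_bound[OF a b] by metis
  obtain C1 C2 where C: "0 < C1" "0 < C2"
    and bound: "\<forall>(g :: complex ^ 'n \<Rightarrow> real) B.
      g \<in> borel_measurable (nu a) \<and> (\<forall>w. norm w < 1 \<longrightarrow> 0 \<le> g w \<and> g w \<le> B) \<longrightarrow>
      (\<integral>\<^sup>+z. ennreal (\<Phi> ((LINT w|nu a. cmod (kern N z w) * g w) / C1)) \<partial>nu a)
      \<le> ennreal C2 * (\<integral>\<^sup>+w. ennreal (\<Phi> (g w)) \<partial>nu a)"
    using positive_bergman_bounded[OF a, where 'n = 'n] unfolding N_def by blast
  define K where "K = max 1 C2"
  have K: "1 \<le> K" "C2 \<le> K" by (auto simp: K_def)
  define L where "L = G * C1 * K"
  have L: "0 < L" using G C K by (simp add: L_def)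
  show ?thesis
    unfolding hankel_extends_bounded_def
  proof (intro exI[of _ L] allI impI)
    fix f :: "complex ^ 'n \<Rightarrow> complex"
    assume "holomorphic_ball f \<and> bounded (f ` unit_ball)"
    then obtain Bf where "holomorphic_ball f" "\<forall>y\<in>f ` unit_ball. cmod y \<le> Bf"
      unfolding bounded_iff by blast
    then have f: "holomorphic_ball f" "\<And>w. norm w < 1 \<Longrightarrow> cmod (f w) \<le> Bf"
      by auto
    have Bf0: "0 \<le> Bf" using order_trans[OF norm_ge_zero f(2)[of 0]] by simp
    have pt: "cmod (hankel a b f z) \<le> G * (LINT w|nu a. cmod (kern N z w) * cmod (f w))" if z: "norm z < 1" for z
    proof -
      obtain Bk where Bk: "0 \<le> Bk" "\<And>w :: complex ^ 'n. norm w \<le> 1 \<Longrightarrow> cmod (kern N z w) \<le> Bk" using cmod_kern_bound[OF z] by metis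
      have "cmod (hankel a b f z) \<le> G * (LINT w|nu a. cmod (f w * kern N z w))"
        unfolding hankel_eq[OF z] N_def[symmetric]
      proof (rule G(2))
        show "holomorphic_ball (\<lambda>w. f w * kern N z w)" by (intro holomorphic_ball_mult f holomorphic_ball_kern z)
        show "cmod (f w * kern N z w) \<le> Bf * Bk" if "norm w < 1" for w
          unfolding norm_mult using f(2)[OF that] Bk that Bf0 by (intro mult_mono) auto
      qed
      then show ?thesis by (simp add: norm_mult mult.commute)
    qed
    have adm: "(\<integral>\<^sup>+z. ennreal (\<Phi> (cmod (hankel a b f z) / (L * r))) \<partial>nu a) \<le> 1"
      if r: "0 < r" "(\<integral>\<^sup>+z. ennreal (\<Phi> (cmod (f z) / r)) \<partial>nu a) \<le> 1" for r
    proof -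
      let ?g = "\<lambda>w. cmod (f w) / r"
      let ?P = "\<lambda>z. (LINT w|nu a. cmod (kern N z w) * ?g w) / C1"
      have mg: "?g \<in> borel_measurable (nu a)" using holomorphic_measurable_nu[OF f(1)] by simp
      have P0: "0 \<le> ?P z" for z using C r by (auto intro!: divide_nonneg_pos Bochner_Integration.integral_nonneg)
      have "(\<integral>\<^sup>+z. ennreal (\<Phi> (cmod (hankel a b f z) / (L * r))) \<partial>nu a) \<le> (\<integral>\<^sup>+z. ennreal (1 / K * \<Phi> (?P z)) \<partial>nu a)"
      proof (intro nn_integral_mono ennreal_leI)
        fix z assume "z \<in> space (nu a :: (complex ^ 'n) measure)"
        then have z: "norm z < 1" by simp
        have "cmod (hankel a b f z) / (L * r) \<le> G * (LINT w|nu a. cmod (kern N z w) * cmod (f w)) / (L * r)"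
          using L r by (intro divide_right_mono pt z) auto
        also have "\<dots> = 1 / K * ?P z"
          using G C K r by (simp add: L_def)
        finally have "\<Phi> (cmod (hankel a b f z) / (L * r)) \<le> \<Phi> (1 / K * ?P z)"
          using L r by (intro mono) auto
        also have "\<dots> \<le> 1 / K * \<Phi> (?P z)" using K P0 by (intro scale_le) auto
        finally show "\<Phi> (cmod (hankel a b f z) / (L * r)) \<le> 1 / K * \<Phi> (?P z)" .
      qed
      also have "\<dots> = (\<integral>\<^sup>+z. ennreal (1 / K) * ennreal (\<Phi> (?P z)) \<partial>nu a)"
        using K by (intro nn_integral_cong ennreal_mult') simp
      also have "\<dots> = ennreal (1 / K) * (\<integral>\<^sup>+z. ennreal (\<Phi> (?P z)) \<partial>nu a)"
      proof (rule nn_integral_cmult)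
        interpret nu: sigma_finite_measure "nu a :: (complex ^ 'n) measure" by (rule sigma_finite_nu[OF a])
        have "(\<lambda>z. LINT w|nu a. cmod (kern N z w) * ?g w) \<in> borel_measurable (nu a)"
          by (rule nu.borel_measurable_lebesgue_integral)
             (unfold case_prod_unfold, intro borel_measurable_times measurable_cmod_kern_pair measurable_compose[OF measurable_snd mg])
        then have "?P \<in> borel_measurable (nu a)" by (rule borel_measurable_divide) (rule borel_measurable_const)
        then have "(\<lambda>z. \<Phi> (?P z)) \<in> borel_measurable (nu a)" by (rule measurable_comp) (use P0 in auto)
        then show "(\<lambda>z. ennreal (\<Phi> (?P z))) \<in> borel_measurable (nu a)" by (rule measurable_compose[OF _ measurable_ennreal])
      qed
      also have "\<dots> \<le> ennreal (1 / K) * (ennreal C2 * 1)"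
      proof (intro mult_left_mono)
        have "(\<integral>\<^sup>+z. ennreal (\<Phi> (?P z)) \<partial>nu a) \<le> ennreal C2 * (\<integral>\<^sup>+w. ennreal (\<Phi> (?g w)) \<partial>nu a)"
          by (rule bound[rule_format, of _ "Bf / r"]) (use r f mg in \<open>auto intro: divide_right_mono\<close>)
        also have "\<dots> \<le> ennreal C2 * 1" by (intro mult_left_mono r) simp
        finally show "(\<integral>\<^sup>+z. ennreal (\<Phi> (?P z)) \<partial>nu a) \<le> ennreal C2 * 1" .
      qed simp
      also have "\<dots> = ennreal (1 / K * C2)" unfolding mult_1_right using K by (intro ennreal_mult'[symmetric]) simp
      also have "\<dots> \<le> ennreal 1" using K by (intro ennreal_leI) simp
      finally show ?thesis by simp
    qed
    let ?R = "{r. r > 0 \<and> (\<integral>\<^sup>+z. ennreal (\<Phi> (cmod (f z) / r)) \<partial>nu a) \<le> 1}"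
    have "lux_norm a \<Phi> (hankel a b f) \<le> ennreal L * ennreal r" if "r \<in> ?R" for r
    proof -
      have "lux_norm a \<Phi> (hankel a b f) \<le> ennreal (L * r)"
        unfolding lux_norm_def using that L adm by (intro INF_lower) auto
      then show ?thesis using L by (simp add: ennreal_mult')
    qed
    then have "lux_norm a \<Phi> (hankel a b f) / ennreal L \<le> (INF r\<in>?R. ennreal r)"
      using L by (intro INF_greatest) (simp add: divide_le_posI_ennreal mult.commute)
    then have "ennreal L * (lux_norm a \<Phi> (hankel a b f) / ennreal L) \<le> ennreal L * lux_norm a \<Phi> f"
      unfolding lux_norm_def[of a \<Phi> f] by (rule mult_left_mono) simp
    moreover have "ennreal L * (x / ennreal L) = x" for x
      using L by (simp add: ennreal_times_divide mult.commute[of "ennreal L"] ennreal_mult_divide_eq)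
    ultimately show "lux_norm a \<Phi> (hankel a b f) \<le> ennreal L * lux_norm a \<Phi> f"
      by (simp only:)
  qed
qed

subsection \<open>Kernel transforms of an integrable symbol\<close>

text \<open>Holomorphic in \<open>z\<close>. At the critical exponent \<open>s = N\<close> it is the
  Bergman projection of \<psi> on the ball; larger \<open>s\<close> gives fractional derivatives of
  it.\<close>

definition kernel_transform :: "real \<Rightarrow> (complex ^ 'n \<Rightarrow> complex) \<Rightarrow> real \<Rightarrow> complex ^ 'n \<Rightarrow> complex" where
  "kernel_transform a \<psi> s z = (LINT w|nu a. \<psi> w * kern s w z)"

lemma cmod_kern_le':
  fixes w z :: "complex ^ 'n"
  assumes "norm w < 1" "norm z \<le> R" "R < 1" "0 \<le> s"
  shows "cmod (kern s w z) \<le> (1 - R) powr (- s)"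
proof -
  have "cmod (kern s w z) = cmod (kern s z w)" by (rule cmod_kern_commute)
  also have "\<dots> \<le> (1 - norm z) powr (- s)" using assms by (intro cmod_kern_le) auto
  also have "\<dots> \<le> (1 - R) powr (- s)" using assms by (intro powr_mono2') auto
  finally show ?thesis .
qed

lemma measurable_kern_left_nu: "(\<lambda>w :: complex ^ 'n. kern s w z) \<in> borel_measurable (nu a)"
proof -
  have "(\<lambda>w :: complex ^ 'n. kern s w z) \<in> borel_measurable borel"
    unfolding kern_def powr_def by measurable
  then show ?thesis by (rule measurable_compose[OF measurable_id_nu])
qed

context
  fixes a s :: real and \<psi> :: "complex ^ 'n \<Rightarrow> complex"
  assumes a: "-1 < a" and \<psi>: "integrable (nu a) \<psi>" and s: "0 \<le> s"
begin

lemma integrable_kernel_transform: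
  assumes "norm z < 1"
  shows "integrable (nu a) (\<lambda>w. \<psi> w * kern s w z)"
  by (rule integrable_nu_mult_bounded[OF a \<psi> measurable_kern_left_nu])
     (rule cmod_kern_le'[OF _ order_refl assms s])

lemma has_derivative_kernel_transform:
  assumes z: "norm z < 1"
  shows "(kernel_transform a \<psi> s has_derivative (\<lambda>v. LINT w|nu a. \<psi> w * (of_real s * herm v w * kern (s + 1) w z))) (at z)"
  unfolding kernel_transform_def
proof (rule has_derivative_integral_dominated)
  let ?r = "(1 - norm z) / 2" and ?R = "(1 + norm z) / 2"
  show "0 < ?r" using z by simp
  have R: "?R < 1" using z by simp
  fix q assume "q \<in> ball z ?r"
  then have "norm q \<le> norm z + ?r"
    using norm_triangle_ineq2[of q z] by (simp add: dist_norm norm_minus_commute field_simps)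
  then have q: "norm q \<le> ?R" by (simp add: field_simps)
  show "integrable (nu a) (\<lambda>w. \<psi> w * kern s w q)"
    by (rule integrable_kernel_transform) (use q R in linarith)
  fix w assume "w \<in> space (nu a :: (complex ^ 'n) measure)"
  then have w: "norm w < 1" by simp
  have n: "norm w * norm q < 1" using norm_mult_less_1[OF w, of q] q R by simp
  show "((\<lambda>q. \<psi> w * kern s w q) has_derivative (\<lambda>v. \<psi> w * (of_real s * herm v w * kern (s + 1) w q))) (at q)"
    by (rule has_derivative_mult_right[OF has_derivative_kern[OF n]])
  fix v
  have "cmod (of_real s * herm v w * kern (s + 1) w q) \<le> s * norm v * (1 - ?R) powr (- (s + 1))"
    unfolding norm_mult norm_of_real
  proof (intro mult_mono)
    show "cmod (herm v w) \<le> norm v" using cmod_herm_le[of v w] w mult_left_mono[of "norm w" 1 "norm v"] by simp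
    show "cmod (kern (s + 1) w q) \<le> (1 - ?R) powr (- (s + 1))" using s by (intro cmod_kern_le'[OF w q R]) simp
  qed (use s in auto)
  from mult_left_mono[OF this norm_ge_zero[of "\<psi> w"]]
  show "norm (\<psi> w * (of_real s * herm v w * kern (s + 1) w q)) \<le> (cmod (\<psi> w) * (s * (1 - ?R) powr (- (s + 1)))) * norm v"
    unfolding norm_mult[of "\<psi> w"] by (simp only: mult_ac)
next
  show "integrable (nu a) (\<lambda>w. cmod (\<psi> w) * (s * (1 - (1 + norm z) / 2) powr (- (s + 1))))"
    by (intro integrable_mult_left integrable_norm \<psi>)
qed

lemma holomorphic_kernel_transform: "holomorphic_ball (kernel_transform a \<psi> s)"
proof (rule holomorphic_ballI[OF has_derivative_kernel_transform])
  fix z v :: "complex ^ 'n" and c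
  have "(LINT w|nu a. \<psi> w * (of_real s * herm (c *s v) w * kern (s + 1) w z))
    = (LINT w|nu a. c * (\<psi> w * (of_real s * herm v w * kern (s + 1) w z)))"
    by (rule Bochner_Integration.integral_cong) (auto simp: herm_scale_left)
  then show "(LINT w|nu a. \<psi> w * (of_real s * herm (c *s v) w * kern (s + 1) w z))
    = c * (LINT w|nu a. \<psi> w * (of_real s * herm v w * kern (s + 1) w z))" by simp
qed

end

text \<open>Differentiation yields \<open>herm z w * kern (s + 1) w z\<close>, and writing
  \<open>herm z w = 1 - (1 - herm z w)\<close> lets the second term lower the order back to
  \<open>s\<close>.\<close>

lemma radial_kernel_transform:
  fixes \<psi> :: "complex ^ 'n \<Rightarrow> complex"
  assumes a: "-1 < a" and \<psi>: "integrable (nu a) \<psi>" and s: "0 \<le> s" and z: "norm z < 1"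
  shows "dir_deriv (kernel_transform a \<psi> s) z z = of_real s * (kernel_transform a \<psi> (s + 1) z - kernel_transform a \<psi> s z)"
proof -
  have s1: "0 \<le> s + 1" using s by simp
  have "dir_deriv (kernel_transform a \<psi> s) z z = (LINT w|nu a. \<psi> w * (of_real s * herm z w * kern (s + 1) w z))"
    by (rule dir_deriv_eqI[OF has_derivative_kernel_transform[OF a \<psi> s z]])
  also have "\<dots> = (LINT w|nu a. of_real s * (\<psi> w * kern (s + 1) w z - \<psi> w * kern s w z))"
  proof (rule Bochner_Integration.integral_cong[OF refl])
    fix w assume "w \<in> space (nu a :: (complex ^ 'n) measure)"
    then have "norm w * norm z < 1" using norm_mult_less_1[of w z] z by simp
    from kern_unfold_1[OF this, of s]
    have eq: "kern s w z = (1 - herm z w) * kern (s + 1) w z" by (rule sym)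
    show "\<psi> w * (of_real s * herm z w * kern (s + 1) w z) = of_real s * (\<psi> w * kern (s + 1) w z - \<psi> w * kern s w z)"
      unfolding eq by (simp add: algebra_simps)
  qed
  also have "\<dots> = of_real s * (LINT w|nu a. \<psi> w * kern (s + 1) w z - \<psi> w * kern s w z)" by simp
  also have "(LINT w|nu a. \<psi> w * kern (s + 1) w z - \<psi> w * kern s w z) = kernel_transform a \<psi> (s + 1) z - kernel_transform a \<psi> s z"
    unfolding kernel_transform_def
    by (rule Bochner_Integration.integral_diff) (rule integrable_kernel_transform[OF a \<psi> s1 z], rule integrable_kernel_transform[OF a \<psi> s z])
  finally show ?thesis .
qed

text \<open>The derivative of \<open>t powr s * kernel_transform a \<psi> s (t z)\<close> is
  \<open>s * t powr (s - 1) * kernel_transform a \<psi> (s + 1) (t z)\<close>; integrating it lowers both the order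
  of the kernel and the growth exponent by one.\<close>

lemma kernel_transform_descend:
  fixes \<psi> :: "complex ^ 'n \<Rightarrow> complex"
  assumes a: "-1 < a" and \<psi>: "integrable (nu a) \<psi>" and s: "1 \<le> s" and m: "1 \<le> m" and C: "0 \<le> C"
    and growth: "\<And>z. norm z < 1 \<Longrightarrow> cmod (kernel_transform a \<psi> (s + 1) z) \<le> C * (1 - norm z) powr (- (m + 1))"
    and z: "norm z < 1"
  shows "cmod (kernel_transform a \<psi> s z) \<le> s * C * (1 - norm z) powr (- m)"
proof -
  let ?F = "\<lambda>s. kernel_transform a \<psi> s" and ?x = "norm z"
  have s0: "0 \<le> s" using s by simp
  have hF: "holomorphic_ball (?F s)" by (rule holomorphic_kernel_transform[OF a \<psi> s0])
  have tz: "norm (t *\<^sub>R z) < 1" if "0 \<le> t" "t \<le> 1" for t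
    using that z mult_mono[of t 1 ?x ?x] by simp
  have pos: "0 < 1 - t * ?x" if "0 \<le> t" "t \<le> 1" for t using tz[OF that] that by simp
  have "norm ((1 powr s) *\<^sub>R ?F s (1 *\<^sub>R z) - (0 powr s) *\<^sub>R ?F s (0 *\<^sub>R z)) \<le> s * C * (1 * (1 - 1 * ?x) powr (- m)) - s * C * (0 * (1 - 0 * ?x) powr (- m))"
  \<comment> \<open>The majorant has derivative at least
    \<open>s * C * (1 - t * norm z) powr (- m - 1)\<close>, because
    \<open>1 - t * norm z + m * t * norm z \<ge> 1\<close> for \<open>m \<ge> 1\<close>. On the
    other side \<open>t powr (s - 1) \<le> 1\<close> uses \<open>s \<ge> 1\<close>.\<close>
  proof (rule differentiable_bound_general[where f = "\<lambda>t. (t powr s) *\<^sub>R ?F s (t *\<^sub>R z)" and \<phi> = "\<lambda>t. s * C * (t * (1 - t * ?x) powr (- m))"])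
    show "continuous_on {0..1} (\<lambda>t. (t powr s) *\<^sub>R ?F s (t *\<^sub>R z))"
    proof (intro continuous_on_scaleR)
      show "continuous_on {0..1} (\<lambda>t. t powr s)" using s by (intro continuous_on_powr' continuous_intros) auto
      show "continuous_on {0..1} (\<lambda>t. ?F s (t *\<^sub>R z))"
        using tz by (intro continuous_on_compose2[OF holomorphic_ball_continuous_on[OF hF]] continuous_intros) auto
    qed
    show "continuous_on {0..1} (\<lambda>t. s * C * (t * (1 - t * ?x) powr (- m)))"
    proof -
      have "1 - t * ?x \<noteq> 0" if "t \<in> {0..1}" for t using pos[of t] that by auto
      then show ?thesis by (intro continuous_intros ballI)
    qed
    fix t :: real assume t: "0 < t" "t < 1"
    then have t': "0 \<le> t" "t \<le> 1" by auto
    have p: "0 < 1 - t * ?x" by (rule pos[OF t'])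
    let ?D = "dir_deriv (?F s) (t *\<^sub>R z) z"
    have d1: "((\<lambda>t. t powr s) has_real_derivative s * t powr (s - 1)) (at t)"
      using t by (intro has_real_derivative_powr) auto
    show "((\<lambda>t. (t powr s) *\<^sub>R ?F s (t *\<^sub>R z)) has_vector_derivative (t powr s) *\<^sub>R ?D + (s * t powr (s - 1)) *\<^sub>R ?F s (t *\<^sub>R z)) (at t)"
      by (rule has_vector_derivative_scaleR[OF d1 has_vector_derivative_radial[OF hF tz[OF t']]])
    have "dir_deriv (?F s) (t *\<^sub>R z) (t *\<^sub>R z) = t *\<^sub>R ?D"
      by (rule linear_scale[OF linear_dir_deriv[OF hF tz[OF t']]])
    then have tD: "t *\<^sub>R ?D = of_real s * (?F (s + 1) (t *\<^sub>R z) - ?F s (t *\<^sub>R z))"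
      using radial_kernel_transform[OF a \<psi> s0 tz[OF t']] by simp
    have ts: "t powr s = t powr (s - 1) * t" using t powr_add[of t "s - 1" 1] by simp
    have "(t powr s) *\<^sub>R ?D + (s * t powr (s - 1)) *\<^sub>R ?F s (t *\<^sub>R z) = (t powr (s - 1)) *\<^sub>R (t *\<^sub>R ?D) + (s * t powr (s - 1)) *\<^sub>R ?F s (t *\<^sub>R z)"
      unfolding ts by simp
    also have "\<dots> = (s * t powr (s - 1)) *\<^sub>R ?F (s + 1) (t *\<^sub>R z)"
      unfolding tD by (simp add: scaleR_conv_of_real[where 'a = complex] algebra_simps)
    finally have d_eq: "(t powr s) *\<^sub>R ?D + (s * t powr (s - 1)) *\<^sub>R ?F s (t *\<^sub>R z) = (s * t powr (s - 1)) *\<^sub>R ?F (s + 1) (t *\<^sub>R z)" .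
    let ?y = "1 - t * ?x"
    show "((\<lambda>t. s * C * (t * (1 - t * ?x) powr (- m))) has_vector_derivative s * C * (?y powr (- m) + t * (m * ?x * ?y powr (- m - 1)))) (at t)"
      unfolding has_real_derivative_iff_has_vector_derivative[symmetric]
      using p by (auto intro!: derivative_eq_intros)
    have ny: "norm (t *\<^sub>R z) = t * ?x" using t by simp
    have "norm ((t powr s) *\<^sub>R ?D + (s * t powr (s - 1)) *\<^sub>R ?F s (t *\<^sub>R z)) = s * t powr (s - 1) * cmod (?F (s + 1) (t *\<^sub>R z))"
      unfolding d_eq using s t by simp
    also have "\<dots> \<le> s * 1 * (C * ?y powr (- (m + 1)))"
      using growth[OF tz[OF t']] s t unfolding ny
      by (intro mult_mono powr_le1 mult_nonneg_nonneg) auto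
    also have "\<dots> \<le> s * C * (?y powr (- m) + t * (m * ?x * ?y powr (- m - 1)))"
    proof -
      have "?y powr (- m) = ?y powr (- m - 1) * ?y" using p powr_add[of ?y "- m - 1" 1] by simp
      then have "?y powr (- m) + t * (m * ?x * ?y powr (- m - 1)) = ?y powr (- m - 1) * (?y + m * (t * ?x))"
        by (simp add: algebra_simps)
      moreover have "1 \<le> ?y + m * (t * ?x)"
        using mult_right_mono[OF m, of "t * ?x"] t by simp
      ultimately have "?y powr (- m - 1) \<le> ?y powr (- m) + t * (m * ?x * ?y powr (- m - 1))"
        using mult_left_mono[of 1 "?y + m * (t * ?x)" "?y powr (- m - 1)"] by simp
      moreover have "- (m + 1) = - m - 1" by simp
      ultimately have "?y powr (- (m + 1)) \<le> ?y powr (- m) + t * (m * ?x * ?y powr (- m - 1))" by (simp only:)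
      from mult_left_mono[OF this, of "s * C"] show ?thesis using s C by (simp only: mult.assoc mult_1 mult_nonneg_nonneg)
    qed
    finally show "norm ((t powr s) *\<^sub>R ?D + (s * t powr (s - 1)) *\<^sub>R ?F s (t *\<^sub>R z)) \<le> s * C * (?y powr (- m) + t * (m * ?x * ?y powr (- m - 1)))" .
  qed simp
  then show ?thesis using s by simp
qed

text \<open>The descent ends at growth exponent 1, as one more step would aim at exponent 0, outside
  the range \<open>1 \<le> m\<close> of \<open>kernel_transform_descend\<close>.\<close>

lemma kernel_transform_descend_to_1:
  fixes \<psi> :: "complex ^ 'n \<Rightarrow> complex"
  assumes a: "-1 < a" and \<psi>: "integrable (nu a) \<psi>" and N: "1 \<le> N" and C: "0 \<le> C"
    and growth: "\<And>z. norm z < 1 \<Longrightarrow> cmod (kernel_transform a \<psi> (N + real (Suc k)) z) \<le> C * (1 - norm z) powr (- real (Suc k))"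
  shows "\<exists>C'\<ge>0. \<forall>z. norm z < 1 \<longrightarrow> cmod (kernel_transform a \<psi> (N + 1) z) \<le> C' * (1 - norm z) powr (- 1)"
  using C growth
proof (induction k arbitrary: C)
  case 0
  then show ?case by (intro exI[of _ C]) simp
next
  case (Suc k)
  have "cmod (kernel_transform a \<psi> (N + real (Suc k)) z) \<le> (N + real (Suc k)) * C * (1 - norm z) powr (- real (Suc k))"
    if z: "norm z < 1" for z
  proof (rule kernel_transform_descend[OF a \<psi> _ _ Suc.prems(1) _ z])
    show "cmod (kernel_transform a \<psi> (N + real (Suc k) + 1) z) \<le> C * (1 - norm z) powr (- (real (Suc k) + 1))"
      if "norm z < 1" for z using Suc.prems(2)[OF that] by (simp add: add_ac)
  qed (use N in auto)
  then show ?case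
    by (rule Suc.IH[rotated]) (use N Suc.prems(1) in auto)
qed

lemma kernel_transform_reproduces:
  fixes b :: "complex ^ 'n \<Rightarrow> complex"
  assumes a: "-1 < a" and b: "holomorphic_ball b" "integrable (nu a) b" and z: "norm z < 1"
  shows "kernel_transform a b (real CARD('n) + 1 + a) z = b z"
proof -
  have "kernel_transform a b (real CARD('n) + 1 + a) z = (LINT w|nu a. b w * cnj (kern (real CARD('n) + 1 + a) z w))"
    unfolding kernel_transform_def
  proof (rule Bochner_Integration.integral_cong[OF refl])
    fix w assume "w \<in> space (nu a :: (complex ^ 'n) measure)"
    then have "norm z * norm w < 1" using norm_mult_less_1[OF z, of w] by simp
    from cnj_kern[OF this] show "b w * kern (real CARD('n) + 1 + a) w z = b w * cnj (kern (real CARD('n) + 1 + a) z w)" by simp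
  qed
  then show ?thesis using reproducing_formula[OF a b z] by simp
qed

text \<open>At the critical exponent the transform is \<open>b\<close> itself, so \<open>R b\<close>
  is \<open>N\<close> times the transform of order \<open>N + 1\<close> minus \<open>b\<close>. Both
  terms are at most of order \<open>1 / (1 - |z|)\<close>.\<close>

lemma bloch_if_kernel_transform_growth:
  fixes b :: "complex ^ 'n \<Rightarrow> complex"
  assumes a: "-1 < a" and b: "holomorphic_ball b" "integrable (nu a) b"
    and C: "0 \<le> C" "\<And>z. norm z < 1 \<Longrightarrow> cmod (kernel_transform a b (real CARD('n) + 1 + a + real (Suc k)) z) \<le> C * (1 - norm z) powr (- real (Suc k))"
  shows "b \<in> bloch"
proof -
  define N where "N = real CARD('n) + 1 + a"
  have "1 \<le> real CARD('n)" by (simp add: Suc_leI)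
  then have N: "1 \<le> N" using a unfolding N_def by linarith
  obtain C1 where C1: "0 \<le> C1" "\<And>z. norm z < 1 \<Longrightarrow> cmod (kernel_transform a b (N + 1) z) \<le> C1 * (1 - norm z) powr (- 1)"
    using kernel_transform_descend_to_1[OF a b(2) N C(1) C(2)[folded N_def]] by blast
  \<comment> \<open>The growth exponent 1 of the transform of order \<open>N + 1\<close> is weakened
    to 2, so that one more descent with \<open>m = 1\<close> applies.\<close>
  have C0: "cmod (b z) \<le> N * C1 * (1 - norm z) powr (- 1)" if z: "norm z < 1" for z
  proof -
    have "cmod (kernel_transform a b N z) \<le> N * C1 * (1 - norm z) powr (- 1)"
    proof (rule kernel_transform_descend[OF a b(2) N order_refl C1(1) _ z])
      fix z :: "complex ^ 'n" assume z: "norm z < 1"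
      have "C1 * (1 - norm z) powr (- 1) \<le> C1 * (1 - norm z) powr (- (1 + 1))"
        using z C1(1) by (intro mult_left_mono powr_mono') auto
      then show "cmod (kernel_transform a b (N + 1) z) \<le> C1 * (1 - norm z) powr (- (1 + 1))"
        using C1(2)[OF z] by linarith
    qed
    then show ?thesis using kernel_transform_reproduces[OF a b z] by (simp add: N_def)
  qed
  have rad: "cmod (radial_deriv b z) * rho z \<le> 2 * N * (C1 + N * C1)" if z: "norm z < 1" for z
  proof -
    have N0: "0 \<le> N" using N by simp
    have "((kernel_transform a b N) has_derivative dir_deriv (kernel_transform a b N) z) (at z)"
      by (rule holomorphic_ballD(1)[OF holomorphic_kernel_transform[OF a b(2) N0] z])
    then have "(b has_derivative dir_deriv (kernel_transform a b N) z) (at z)"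
      by (rule has_derivative_transform_within_open[where s = unit_ball])
         (use z kernel_transform_reproduces[OF a b] in \<open>auto simp: N_def\<close>)
    then have "radial_deriv b z = dir_deriv (kernel_transform a b N) z z"
      using radial_deriv_eq[OF b(1) z] dir_deriv_eqI by metis
    also have "\<dots> = of_real N * (kernel_transform a b (N + 1) z - b z)"
      using radial_kernel_transform[OF a b(2) N0 z] kernel_transform_reproduces[OF a b z] by (simp add: N_def)
    finally have "cmod (radial_deriv b z) = N * cmod (kernel_transform a b (N + 1) z - b z)"
      using N0 by (simp add: norm_mult)
    also have "\<dots> \<le> N * (C1 * (1 - norm z) powr (- 1) + N * C1 * (1 - norm z) powr (- 1))"
      using norm_triangle_ineq4[of "kernel_transform a b (N + 1) z" "b z"] C1(2)[OF z] C0[OF z] N0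
      by (intro mult_left_mono) auto
    also have "\<dots> = N * (C1 + N * C1) / (1 - norm z)"
    proof -
      have "(1 - norm z) powr (- 1) = 1 / (1 - norm z)" using z by (simp add: powr_minus divide_inverse)
      moreover have "n * (c * (1 / y) + n * c * (1 / y)) = n * (c + n * c) / y" for n c y :: real
        by (simp add: add_divide_distrib distrib_left)
      ultimately show ?thesis by (simp only:)
    qed
    finally have R: "cmod (radial_deriv b z) \<le> N * (C1 + N * C1) / (1 - norm z)" .
    have "0 \<le> N * (C1 + N * C1) / (1 - norm z)"
      using N0 C1(1) z by (intro divide_nonneg_pos mult_nonneg_nonneg add_nonneg_nonneg) auto
    then have "cmod (radial_deriv b z) * rho z \<le> N * (C1 + N * C1) / (1 - norm z) * (2 * (1 - norm z))"
      using rho_le[OF less_imp_le[OF z]] less_imp_le[OF rho_pos[OF z]] R by (intro mult_mono)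
    also have "\<dots> = 2 * N * (C1 + N * C1)"
    proof -
      have "X / y * (2 * y) = 2 * X" if "0 < y" for X y :: real using that by simp
      from this[of "1 - norm z"] z show ?thesis by (simp only: diff_gt_0_iff_gt mult.assoc)
    qed
    finally show ?thesis .
  qed
  show ?thesis
    unfolding bloch_def using b(1) rad by (auto intro!: bdd_aboveI2)
qed

subsection \<open>Testing on kernel functions\<close>

text \<open>The exponent is split into \<open>2 * N\<close>, where the integral is exact, and the
  excess \<open>k - 2 * N\<close>, which is bounded by its supremum.\<close>

lemma nn_integral_kern_le:
  fixes z :: "complex ^ 'n"
  assumes a: "-1 < a" and z: "norm z < 1"
  defines "N \<equiv> real CARD('n) + 1 + a"
  assumes k: "2 * N \<le> k"
  shows "(\<integral>\<^sup>+w. ennreal (cmod (kern k z w)) \<partial>nu a) \<le> ennreal (2 powr (k - 2 * N) * rho z powr (N - k))"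
proof -
  let ?c = "2 powr (k - 2 * N) * rho z powr (2 * N - k)"
  have rz: "0 < rho z" by (rule rho_pos[OF z])
  have bd: "cmod (kern (k - 2 * N) z w) \<le> ?c" if "norm w < 1" for w
  proof -
    have "cmod (kern (k - 2 * N) z w) \<le> (1 - norm z) powr (- (k - 2 * N))"
      using k that by (intro cmod_kern_le[OF z]) auto
    also have "\<dots> \<le> (rho z / 2) powr (- (k - 2 * N))"
      using k rz rho_le[OF less_imp_le[OF z]] by (intro powr_mono2') auto
    also have "\<dots> = ?c"
      by (simp only: powr_divide powr_minus) (simp add: powr_minus[symmetric] divide_inverse mult.commute)
    finally show ?thesis .
  qed
  have "(\<integral>\<^sup>+w. ennreal (cmod (kern k z w)) \<partial>nu a) \<le> (\<integral>\<^sup>+w. ennreal ?c * ennreal (cmod (kern (2 * N) z w)) \<partial>nu a)"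
  proof (rule nn_integral_mono)
    fix w assume "w \<in> space (nu a :: (complex ^ 'n) measure)"
    then have w: "norm w < 1" by simp
    have "cmod (kern k z w) = cmod (kern (k - 2 * N) z w) * cmod (kern (2 * N) z w)"
      unfolding cmod_kern_add[symmetric] by simp
    also have "\<dots> \<le> ?c * cmod (kern (2 * N) z w)" by (intro mult_right_mono bd w) simp
    finally have "ennreal (cmod (kern k z w)) \<le> ennreal (?c * cmod (kern (2 * N) z w))" by (rule ennreal_leI)
    also have "\<dots> = ennreal ?c * ennreal (cmod (kern (2 * N) z w))" by (intro ennreal_mult') simp
    finally show "ennreal (cmod (kern k z w)) \<le> ennreal ?c * ennreal (cmod (kern (2 * N) z w))" .
  qed
  also have "\<dots> = ennreal ?c * (\<integral>\<^sup>+w. ennreal (cmod (kern (2 * N) z w)) \<partial>nu a)"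
    by (rule nn_integral_cmult) (rule measurable_compose[OF measurable_cmod_kern_nu measurable_ennreal])
  also have "\<dots> = ennreal ?c * ennreal (rho z powr (- N))"
    unfolding N_def by (subst nn_integral_kern_double[OF a z]) simp
  also have "\<dots> = ennreal (?c * rho z powr (- N))" by (intro ennreal_mult'[symmetric]) simp
  also have "?c * rho z powr (- N) = 2 powr (k - 2 * N) * rho z powr (N - k)"
    unfolding mult.assoc powr_add[symmetric] by simp
  finally show ?thesis .
qed

text \<open>\<open>rho z powr N * |kern (2 * N) z w|\<close> is a probability density that
  reproduces \<open>u z\<close>. Jensen's inequality moves \<Phi> inside, and the density is at most
  \<open>4 powr N * rho z powr (- N)\<close> because \<open>1 - |z| \<ge> rho z / 2\<close>.\<close>

lemma (in dini_growth) pointwise_bound: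
  fixes u :: "complex ^ 'n \<Rightarrow> complex"
  assumes a: "-1 < a" and u: "holomorphic_ball u" and r: "0 < r"
    and int: "(\<integral>\<^sup>+z. ennreal (\<Phi> (cmod (u z) / r)) \<partial>nu a) \<le> 1" and z: "norm z < 1"
  defines "N \<equiv> real CARD('n) + 1 + a"
  shows "\<Phi> (cmod (u z) / r) \<le> 4 powr N * rho z powr (- N)"
proof -
  let ?X = "\<lambda>w. cmod (u w) / r"
  have N0: "0 \<le> N" using a unfolding N_def by simp
  have rz: "0 < rho z" by (rule rho_pos[OF z])
  have mu: "u \<in> borel_measurable (nu a)" by (rule holomorphic_measurable_nu[OF u])
  have mX: "?X \<in> borel_measurable (nu a)" using mu by simp
  have X0: "0 \<le> ?X w" for w using r by simp
  have mPhi: "(\<lambda>w. \<Phi> (?X w)) \<in> borel_measurable (nu a)" by (rule measurable_comp[OF mX X0])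
  have intPhi: "integrable (nu a) (\<lambda>w. \<Phi> (?X w))"
    by (rule integrableI_nonneg[OF mPhi]) (use int X0 nonneg in \<open>auto intro: le_less_trans\<close>)
  have Phi1: "0 < \<Phi> 1" by (rule pos) simp
  have int1: "integrable (nu a) (\<lambda>z :: complex ^ 'n. 1 :: real)"
    by (rule integrable_nu_bounded[OF a, where B = 1]) auto
  have intX: "integrable (nu a) ?X"
  proof (rule Bochner_Integration.integrable_bound[OF _ mX])
    show "integrable (nu a) (\<lambda>w. 1 + \<Phi> (?X w) / \<Phi> 1)"
      by (intro Bochner_Integration.integrable_add int1 integrable_divide intPhi)
    \<comment> \<open>Growth at least linear beyond 1 makes \<open>u\<close> integrable, as the
      reproducing formula requires.\<close>
    have "?X w \<le> 1 + \<Phi> (?X w) / \<Phi> 1" for w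
    proof (cases "?X w \<le> 1")
      case True
      then show ?thesis using nonneg[OF X0[of w]] Phi1 by (intro order_trans[OF True]) simp
    next
      case False
      then have "?X w * \<Phi> 1 \<le> \<Phi> (?X w)" using scale_ge[of "?X w" 1] by simp
      then have "?X w \<le> \<Phi> (?X w) / \<Phi> 1" using Phi1 by (simp only: pos_le_divide_eq)
      then show ?thesis by linarith
    qed
    moreover have "0 \<le> 1 + \<Phi> (?X w) / \<Phi> 1" for w
      using nonneg[OF X0[of w]] Phi1 by (intro add_nonneg_nonneg divide_nonneg_pos) auto
    ultimately show "AE w in nu a. norm (?X w) \<le> norm (1 + \<Phi> (?X w) / \<Phi> 1)"
      using X0 by (intro AE_I2) (simp only: real_norm_def abs_of_nonneg)
  qed
  have intu: "integrable (nu a) u"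
  proof (rule integrable_norm_cancel[OF _ mu])
    have "integrable (nu a) (\<lambda>w. ?X w * r)" by (intro integrable_mult_left intX)
    then show "integrable (nu a) (\<lambda>w. norm (u w))" using r by simp
  qed
  let ?P = "\<lambda>w. rho z powr N * cmod (kern (2 * N) z w)"
  have mP: "?P \<in> borel_measurable (nu a)" by (intro borel_measurable_times borel_measurable_const measurable_cmod_kern_nu)
  have P0: "0 \<le> ?P w" for w by simp
  have PB: "?P w \<le> 4 powr N * rho z powr (- N)" if "norm w < 1" for w
  proof -
    have "cmod (kern (2 * N) z w) \<le> (1 - norm z) powr (- (2 * N))"
      using that N0 by (intro cmod_kern_le[OF z]) auto
    also have "\<dots> \<le> (rho z / 2) powr (- (2 * N))"
      using N0 rz rho_le[OF less_imp_le[OF z]] by (intro powr_mono2') auto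
    also have "\<dots> = 2 powr (2 * N) * rho z powr (- (2 * N))"
      by (simp only: powr_divide powr_minus) (simp add: divide_inverse mult.commute)
    also have "2 powr (2 * N) = ((2 :: real) powr 2) powr N" by (simp only: powr_powr)
    also have "\<dots> = 4 powr N" by simp
    finally have "rho z powr N * cmod (kern (2 * N) z w) \<le> rho z powr N * (4 powr N * rho z powr (- (2 * N)))"
      by (intro mult_left_mono) auto
    also have "\<dots> = 4 powr N * (rho z powr N * rho z powr (- (2 * N)))" by (simp only: mult_ac)
    also have "rho z powr N * rho z powr (- (2 * N)) = rho z powr (- N)" by (subst powr_add[symmetric]) simp
    finally show ?thesis .
  qed
  have intP: "integrable (nu a) ?P"
    by (rule integrable_nu_bounded[OF a mP, where B = "4 powr N * rho z powr (- N)"]) (use PB P0 in auto)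
  have "(\<integral>\<^sup>+w. ennreal (?P w) \<partial>nu a) = (\<integral>\<^sup>+w. ennreal (rho z powr N) * ennreal (cmod (kern (2 * N) z w)) \<partial>nu a)"
    by (intro nn_integral_cong ennreal_mult') simp
  also have "\<dots> = ennreal (rho z powr N) * (\<integral>\<^sup>+w. ennreal (cmod (kern (2 * N) z w)) \<partial>nu a)"
    by (rule nn_integral_cmult) (rule measurable_compose[OF measurable_cmod_kern_nu measurable_ennreal])
  also have "\<dots> = ennreal (rho z powr N) * ennreal (rho z powr (- N))"
    unfolding N_def by (subst nn_integral_kern_double[OF a z]) simp
  also have "\<dots> = ennreal (rho z powr N * rho z powr (- N))" by (intro ennreal_mult'[symmetric]) simp
  also have "rho z powr N * rho z powr (- N) = 1"
    using rz by (subst powr_add[symmetric]) simp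
  finally have "ennreal (LINT w|nu a. ?P w) = ennreal 1"
    using nn_integral_eq_integral[OF intP] P0 by simp
  then have P1: "(LINT w|nu a. ?P w) \<le> 1"
    by (subst (asm) ennreal_inj) (auto intro!: Bochner_Integration.integral_nonneg)
  have dom: "norm (A * x) \<le> norm (B * x)" if "0 \<le> A" "A \<le> B" "0 \<le> x" for A B x :: real
    using that by (simp add: abs_mult mult_right_mono)
  have intPX: "integrable (nu a) (\<lambda>w. ?P w * ?X w)"
  proof (rule Bochner_Integration.integrable_bound)
    show "integrable (nu a) (\<lambda>w. (4 powr N * rho z powr (- N)) * ?X w)" by (intro integrable_mult_right intX)
    show "(\<lambda>w. ?P w * ?X w) \<in> borel_measurable (nu a)" by (intro borel_measurable_times mP mX)
    show "AE w in nu a. norm (?P w * ?X w) \<le> norm ((4 powr N * rho z powr (- N)) * ?X w)"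
      by (intro AE_I2 dom P0 PB X0) simp
  qed
  have intPPhi: "integrable (nu a) (\<lambda>w. ?P w * \<Phi> (?X w))"
  proof (rule Bochner_Integration.integrable_bound)
    show "integrable (nu a) (\<lambda>w. (4 powr N * rho z powr (- N)) * \<Phi> (?X w))" by (intro integrable_mult_right intPhi)
    show "(\<lambda>w. ?P w * \<Phi> (?X w)) \<in> borel_measurable (nu a)" by (intro borel_measurable_times mP mPhi)
    show "AE w in nu a. norm (?P w * \<Phi> (?X w)) \<le> norm ((4 powr N * rho z powr (- N)) * \<Phi> (?X w))"
      by (intro AE_I2 dom P0 PB nonneg X0) simp
  qed
  have "u z * of_real (rho z powr (- N)) = (LINT w|nu a. u w * of_real (cmod (kern (2 * N) z w)))"
    unfolding N_def by (rule kern_reproducing[OF a u intu z, symmetric])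
  then have "cmod (u z) * rho z powr (- N) \<le> (LINT w|nu a. cmod (u w) * cmod (kern (2 * N) z w))"
    using Bochner_Integration.integral_norm_bound[of "nu a" "\<lambda>w. u w * of_real (cmod (kern (2 * N) z w))"]
    by (metis (no_types, lifting) Bochner_Integration.integral_cong abs_norm_cancel norm_mult norm_of_real abs_of_nonneg powr_ge_zero)
  then have "rho z powr N * (cmod (u z) * rho z powr (- N)) / r \<le> rho z powr N * (LINT w|nu a. cmod (u w) * cmod (kern (2 * N) z w)) / r"
    using r by (intro divide_right_mono mult_left_mono) auto
  also have "\<dots> = (LINT w|nu a. ?P w * ?X w)"
    by (simp add: mult_ac flip: integral_mult_right_zero integral_divide_zero)
  also have "rho z powr N * (cmod (u z) * rho z powr (- N)) / r = ?X z"
    using rz by (simp add: powr_minus)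
  finally have le: "?X z \<le> (LINT w|nu a. ?P w * ?X w)" .
  have "\<Phi> (?X z) \<le> (LINT w|nu a. ?P w * \<Phi> (?X w))"
    by (rule jensen[OF intP P0 P1 X0 intPX intPPhi X0 le])
  also have "\<dots> \<le> (LINT w|nu a. (4 powr N * rho z powr (- N)) * \<Phi> (?X w))"
    using PB nonneg[OF X0] by (intro Bochner_Integration.integral_mono intPPhi integrable_mult_right intPhi mult_right_mono) auto
  also have "\<dots> = (4 powr N * rho z powr (- N)) * (LINT w|nu a. \<Phi> (?X w))" by simp
  also have "\<dots> \<le> (4 powr N * rho z powr (- N)) * 1"
  proof (intro mult_left_mono)
    have "ennreal (LINT w|nu a. \<Phi> (?X w)) \<le> 1"
      using nn_integral_eq_integral[OF intPhi] int nonneg[OF X0] by simp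
    then show "(LINT w|nu a. \<Phi> (?X w)) \<le> 1" by (simp add: ennreal_le_1)
  qed simp
  finally show ?thesis by simp
qed

text \<open>The normalised kernel \<open>f\<close> is bounded and its integral is at most a multiple
  of \<open>rho z powr N\<close>. With \<open>\<Phi> T = rho z powr (- N)\<close> this makes
  \<open>R\<close>, a multiple of \<open>1 / T\<close>, admissible for \<open>f\<close>, while
  \<open>pointwise_bound\<close> limits the image at \<open>z\<close> to a multiple of
  \<open>T\<close> times its norm.\<close>

lemma (in dini_growth) hankel_bounded_imp_bloch:
  fixes b :: "complex ^ 'n \<Rightarrow> complex"
  assumes a: "-1 < a" and b: "holomorphic_ball b" "integrable (nu a) b"
    and bounded: "hankel_extends_bounded a b \<Phi> \<Phi>"
  shows "b \<in> bloch"
proof -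
  define N where "N = real CARD('n) + 1 + a"
  have N0: "0 < N" using a of_nat_0_le_iff[of "CARD('n)"] unfolding N_def by linarith
  \<comment> \<open>The order \<open>Suc k\<close> is at least \<open>2 * N\<close>, as
    \<open>nn_integral_kern_le\<close> asks; it is an integer so that unit descents reach 1.\<close>
  define k where "k = nat \<lceil>2 * N\<rceil>"
  have k: "2 * N \<le> real (Suc k)" unfolding k_def by linarith
  let ?k = "real (Suc k)"
  obtain C where "\<forall>f. holomorphic_ball f \<and> bounded (f ` unit_ball) \<longrightarrow> lux_norm a \<Phi> (hankel a b f) \<le> ennreal C * lux_norm a \<Phi> f"
    using bounded unfolding hankel_extends_bounded_def by blast
  \<comment> \<open>A nonpositive \<open>C\<close> is replaced by 1, so that the norm bound below is
    a positive number and can be enlarged strictly.\<close>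
  then have C: "lux_norm a \<Phi> (hankel a b f) \<le> ennreal (max 1 C) * lux_norm a \<Phi> f" if "holomorphic_ball f" "bounded (f ` unit_ball)" for f
    using that by (meson ennreal_leI max.cobounded2 mult_right_mono order_trans zero_le)
  define C' where "C' = max 1 C"
  have C': "1 \<le> C'" by (simp add: C'_def)
  define CF where "CF = 2 powr (?k - 2 * N)"
  define c where "c = max 1 CF"
  have c: "1 \<le> c" "CF \<le> c" by (auto simp: c_def)
  \<comment> \<open>The factors are: 2 for the slack above the infimum in the norm,
    \<open>C'\<close> for the operator, \<open>c * 2 powr ?k\<close> for the test function and
    \<open>4 powr N\<close> for point evaluation.\<close>
  define E where "E = 2 * C' * (c * 2 powr ?k) * 4 powr N"
  have E0: "0 \<le> E" using C' c by (simp add: E_def)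
  have "cmod (kernel_transform a b (N + ?k) z) \<le> E * (1 - norm z) powr (- ?k)" if z: "norm z < 1" for z
  proof -
    have rz: "0 < rho z" by (rule rho_pos[OF z])
    define f where "f = (\<lambda>w. of_real (rho z powr ?k) * kern ?k z w)"
    have hf: "holomorphic_ball f"
      unfolding f_def by (intro holomorphic_ball_mult holomorphic_ball_const holomorphic_ball_kern z)
    have fB: "cmod (f w) \<le> 2 powr ?k" if "norm w < 1" for w
    proof -
      have "cmod (f w) = rho z powr ?k * cmod (kern ?k z w)" by (simp add: f_def norm_mult)
      also have "\<dots> \<le> rho z powr ?k * (1 - norm z) powr (- ?k)"
        using that by (intro mult_left_mono cmod_kern_le[OF z]) auto
      also have "\<dots> \<le> rho z powr ?k * (rho z / 2) powr (- ?k)"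
        using rz rho_le[OF less_imp_le[OF z]] by (intro mult_left_mono powr_mono2') auto
      also have "\<dots> = 2 powr ?k * (rho z powr ?k * rho z powr (- ?k))"
        by (simp only: powr_divide powr_minus) (simp add: divide_inverse mult_ac)
      also have "rho z powr ?k * rho z powr (- ?k) = 1" using rz by (subst powr_add[symmetric]) simp
      finally show ?thesis by simp
    qed
    have bf: "bounded (f ` unit_ball)" using fB unfolding bounded_iff by (intro exI[of _ "2 powr ?k"]) auto
    obtain T where T: "0 \<le> T" "\<Phi> T = rho z powr (- N)" using surj[of "rho z powr (- N)"] by auto
    have T0: "0 < T"
    proof (rule ccontr)
      assume "\<not> 0 < T"
      then have "T = 0" using T(1) by simp
      then show False using T(2) rz by simp
    qed
    define R where "R = c * 2 powr ?k / T"
    have R: "0 < R" using c T0 by (simp add: R_def)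
    have adm: "(\<integral>\<^sup>+w. ennreal (\<Phi> (cmod (f w) / R)) \<partial>nu a) \<le> 1"
    proof -
      let ?d = "c * 2 powr ?k"
      have d: "0 < ?d" using c by simp
      have "(\<integral>\<^sup>+w. ennreal (\<Phi> (cmod (f w) / R)) \<partial>nu a) \<le> (\<integral>\<^sup>+w. ennreal (rho z powr (?k - N) / ?d) * ennreal (cmod (kern ?k z w)) \<partial>nu a)"
      proof (rule nn_integral_mono)
        fix w assume "w \<in> space (nu a :: (complex ^ 'n) measure)"
        then have w: "norm w < 1" by simp
        have "cmod (f w) \<le> 1 * 2 powr ?k" using fB[OF w] by simp
        also have "\<dots> \<le> ?d" using c by (intro mult_right_mono) auto
        finally have "cmod (f w) / ?d \<le> 1" using d by (simp only: pos_divide_le_eq mult_1)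
        \<comment> \<open>\<open>\<Phi>\<close> is linearised on \<open>[0, T]\<close>, which
          reduces the modular to the integral of \<open>|f|\<close>.\<close>
        then have "\<Phi> (cmod (f w) / ?d * T) \<le> cmod (f w) / ?d * \<Phi> T"
          using d T by (intro scale_le) auto
        also have "cmod (f w) / ?d * T = cmod (f w) / R" using T0 by (simp add: R_def)
        also have "cmod (f w) / ?d * \<Phi> T = rho z powr (?k - N) / ?d * cmod (kern ?k z w)"
        proof -
          have "rho z powr (?k - N) = rho z powr ?k * rho z powr (- N)" by (subst powr_add[symmetric]) simp
          moreover have "cmod (f w) = rho z powr ?k * cmod (kern ?k z w)" by (simp add: f_def norm_mult)
          ultimately show ?thesis unfolding T(2) by (simp only: times_divide_eq_left times_divide_eq_right mult_ac)
        qed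
        finally have "ennreal (\<Phi> (cmod (f w) / R)) \<le> ennreal (rho z powr (?k - N) / ?d * cmod (kern ?k z w))" by (rule ennreal_leI)
        also have "\<dots> = ennreal (rho z powr (?k - N) / ?d) * ennreal (cmod (kern ?k z w))"
          using d by (intro ennreal_mult') simp
        finally show "ennreal (\<Phi> (cmod (f w) / R)) \<le> ennreal (rho z powr (?k - N) / ?d) * ennreal (cmod (kern ?k z w))" .
      qed
      also have "\<dots> = ennreal (rho z powr (?k - N) / ?d) * (\<integral>\<^sup>+w. ennreal (cmod (kern ?k z w)) \<partial>nu a)"
        by (rule nn_integral_cmult) (rule measurable_compose[OF measurable_cmod_kern_nu measurable_ennreal])
      also have "\<dots> \<le> ennreal (rho z powr (?k - N) / ?d) * ennreal (CF * rho z powr (N - ?k))"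
        unfolding CF_def N_def by (intro mult_left_mono nn_integral_kern_le[OF a z] k[unfolded N_def]) simp
      also have "\<dots> = ennreal (rho z powr (?k - N) / ?d * (CF * rho z powr (N - ?k)))"
        using d by (intro ennreal_mult'[symmetric]) simp
      also have "rho z powr (?k - N) / ?d * (CF * rho z powr (N - ?k)) = CF / ?d * (rho z powr (?k - N) * rho z powr (N - ?k))"
        by (simp only: times_divide_eq_left times_divide_eq_right mult_ac)
      also have "rho z powr (?k - N) * rho z powr (N - ?k) = 1" using rz by (subst powr_add[symmetric]) simp
      also have "ennreal (CF / ?d * 1) \<le> ennreal 1"
      proof (rule ennreal_leI)
        have "1 \<le> 2 powr ?k" by (rule ge_one_powr_ge_zero) auto
        then have "c * 1 \<le> ?d" using c by (intro mult_left_mono) auto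
        with c(2) have "CF \<le> ?d" by (simp only: mult_1_right order_trans)
        then show "CF / ?d * 1 \<le> 1" using d by (simp only: mult_1_right pos_divide_le_eq mult_1)
      qed
      finally show ?thesis by simp
    qed
    have "lux_norm a \<Phi> f \<le> ennreal R"
      unfolding lux_norm_def using R adm by (intro INF_lower) auto
    then have "lux_norm a \<Phi> (hankel a b f) \<le> ennreal C' * ennreal R"
      using C[OF hf bf] unfolding C'_def by (meson mult_left_mono order_trans zero_le)
    also have "\<dots> = ennreal (C' * R)" using C' by (intro ennreal_mult'[symmetric]) simp
    \<comment> \<open>Doubling makes the inequality strict, so the infimum provides an admissible
      \<open>r\<close> below \<open>2 * C' * R\<close>.\<close>
    also have "\<dots> < ennreal (2 * C' * R)" using C' R by (intro ennreal_lessI) auto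
    finally have "(INF r\<in>{r::real. r > 0 \<and> (\<integral>\<^sup>+z. ennreal (\<Phi> (cmod (hankel a b f z) / r)) \<partial>nu a) \<le> 1}. ennreal r) < ennreal (2 * C' * R)"
      unfolding lux_norm_def .
    then obtain r where r: "0 < r" "(\<integral>\<^sup>+z. ennreal (\<Phi> (cmod (hankel a b f z) / r)) \<partial>nu a) \<le> 1" "ennreal r < ennreal (2 * C' * R)"
      unfolding INF_less_iff by auto
    have r_le: "r \<le> 2 * C' * R" using r(1,3) by (simp add: ennreal_less_iff)
    \<comment> \<open>The image of \<open>f\<close> as a kernel transform, which is known to be
      holomorphic and agrees with \<open>hankel a b f\<close> on the ball.\<close>
    define u where "u = kernel_transform a (\<lambda>w. b w * cnj (f w)) N"
    have int_bf: "integrable (nu a) (\<lambda>w. b w * cnj (f w))"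
      by (rule integrable_nu_mult_bounded[OF a b(2), where B = "2 powr ?k"])
         (use fB in \<open>auto intro!: continuous_on_measurable_nu continuous_intros holomorphic_ball_continuous_on[OF hf]\<close>)
    have hu: "holomorphic_ball u"
      unfolding u_def by (rule holomorphic_kernel_transform[OF a int_bf less_imp_le[OF N0]])
    have kern_cnj: "cnj (kern s y w) = kern s w y" if "norm y < 1" "norm w < 1" for s and y w :: "complex ^ 'n"
      by (rule cnj_kern) (use norm_mult_less_1[of y w] that in simp)
    have u_eq: "hankel a b f y = u y" if y: "norm y < 1" for y
      unfolding hankel_eq[OF y] u_def kernel_transform_def N_def[symmetric]
      by (rule Bochner_Integration.integral_cong) (auto simp: kern_cnj[OF y])
    have int_u: "(\<integral>\<^sup>+y. ennreal (\<Phi> (cmod (u y) / r)) \<partial>nu a) \<le> 1"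
    proof -
      have "(\<integral>\<^sup>+y. ennreal (\<Phi> (cmod (u y) / r)) \<partial>nu a) = (\<integral>\<^sup>+y. ennreal (\<Phi> (cmod (hankel a b f y) / r)) \<partial>nu a)"
        by (rule nn_integral_cong) (simp add: u_eq)
      then show ?thesis using r(2) by simp
    qed
    have "\<Phi> (cmod (u z) / r) \<le> 4 powr N * rho z powr (- N)"
      unfolding N_def by (rule pointwise_bound[OF a hu r(1) int_u z])
    then have Phi_le: "\<Phi> (cmod (u z) / r) \<le> 4 powr N * \<Phi> T" unfolding T(2) .
    \<comment> \<open>Since \<Phi> grows at least linearly, the factor \<open>4 powr N\<close>
      outside \<Phi> can be moved to its argument.\<close>
    have u_le: "cmod (u z) / r \<le> 4 powr N * T"
    proof (rule ccontr)
      define y where "y = cmod (u z) / r / T"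
      assume "\<not> cmod (u z) / r \<le> 4 powr N * T"
      then have y: "4 powr N < y" by (simp only: y_def pos_less_divide_eq[OF T0] not_le)
      moreover have one: "1 \<le> 4 powr N" using N0 by (intro ge_one_powr_ge_zero) auto
      ultimately have "y * \<Phi> T \<le> \<Phi> (y * T)" using T(1) by (intro scale_ge) auto
      moreover have "y * T = cmod (u z) / r" using T0 by (simp add: y_def)
      moreover have "4 powr N * \<Phi> T < y * \<Phi> T" using y pos[OF T0] by (rule mult_strict_right_mono)
      ultimately show False using Phi_le by simp
    qed
    \<comment> \<open>At the same point \<open>z\<close> the conjugated test function is a kernel
      too, and it raises the order of the Bergman kernel from \<open>N\<close> to
      \<open>N + ?k\<close>.\<close>
    have "u z = of_real (rho z powr ?k) * kernel_transform a b (N + ?k) z"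
    proof -
      have "u z = (LINT w|nu a. of_real (rho z powr ?k) * (b w * kern (N + ?k) w z))"
        unfolding u_def kernel_transform_def
      proof (rule Bochner_Integration.integral_cong[OF refl])
        fix w assume "w \<in> space (nu a :: (complex ^ 'n) measure)"
        then have w: "norm w < 1" by simp
        have "cnj (f w) = of_real (rho z powr ?k) * kern ?k w z" by (simp add: f_def kern_cnj[OF z w])
        then show "b w * cnj (f w) * kern N w z = of_real (rho z powr ?k) * (b w * kern (N + ?k) w z)"
          unfolding kern_mult[of N w z ?k, symmetric] by (simp only: mult_ac)
      qed
      then show ?thesis by (simp add: kernel_transform_def)
    qed
    then have "rho z powr ?k * cmod (kernel_transform a b (N + ?k) z) = cmod (u z)" by (simp add: norm_mult)
    also have "\<dots> \<le> 4 powr N * T * r" using u_le r(1) by (simp only: pos_divide_le_eq)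
    also have "\<dots> \<le> 4 powr N * T * (2 * C' * R)" using r_le T by (intro mult_left_mono) auto
    also have "\<dots> = E" using T0 by (simp add: E_def R_def)
    finally have "rho z powr (- ?k) * (rho z powr ?k * cmod (kernel_transform a b (N + ?k) z)) \<le> rho z powr (- ?k) * E"
      by (rule mult_left_mono) simp
    moreover have "rho z powr (- ?k) * rho z powr ?k = 1" using rz by (subst powr_add[symmetric]) simp
    ultimately have "cmod (kernel_transform a b (N + ?k) z) \<le> rho z powr (- ?k) * E"
      by (simp only: mult.assoc[symmetric] mult_1)
    also have "\<dots> \<le> (1 - norm z) powr (- ?k) * E"
      using E0 z le_rho[OF less_imp_le[OF z]] by (intro mult_right_mono powr_mono2') auto
    finally show ?thesis by (simp only: mult.commute)
  qed
  then show ?thesis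
    unfolding N_def by (intro bloch_if_kernel_transform_growth[OF a b E0, where k = k])
qed

theorem theorem4p2:
  fixes \<alpha> q :: real
    and \<Phi> :: "real \<Rightarrow> real"
    and b :: "complex ^ 'n \<Rightarrow> complex"
  assumes "\<alpha> > -1"
    and "q \<ge> 1"
    and "\<Phi> \<in> growth_class q"
    and "regular_growth \<Phi>"
    and "dini \<Phi>"
    and "b \<in> bergman_orlicz \<alpha> (\<lambda>t. t\<^sup>2)"
  shows "hankel_extends_bounded \<alpha> b \<Phi> \<Phi> \<longleftrightarrow> b \<in> bloch"
proof -
  interpret dini_growth \<Phi> q by unfold_locales (fact assms)+
  note b = bergman_square_integrable[OF assms(1,6)]
  show ?thesis
    using bloch_imp_hankel_bounded[OF assms(1) _ b(2)] hankel_bounded_imp_bloch[OF assms(1) b] by blast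
qed

end
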